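(* For every integer $m>1$, there exist families $(X_k)_{k\ge1}$ and $(Y_k)_{k\ge 1}$ of simplicial $m$-balls such that: (1) $\lambda^{m-1}(X_k)\ge\dfrac{(m-1)^2}{2(m+1)}$ for all $k$, but $h^{m-1}(X_k)\to0$ as $k\to\infty$; (2) $\lambda^{m-1}(Y_k)\le\dfrac{1}{m^{k-1}}$ for all $k>1$, but $h^{m-1}(Y_k)\ge\dfrac1k$ for all $k$.
   Context: A simplicial complex is a finite abstract simplicial complex. A simplicial $m$-ball is a simplicial complex whose geometric realization is homeomorphic to the Euclidean ball $\{x\in\mathbb{R}^m:\lVert x\rVert_2\le1\}$. For a simplicial complex $X$ and a field $F$, $C^k(F)=C^k(X;F)$ is the space of (oriented) simplicial $k$-cochains over $F$, identified with the space of $k$-chains via the basis of $k$-simplexes, each given one orientation; $\delta=\delta^k:C^k(F)\to C^{k+1}(F)$ is the coboundary map, i.e. the transpose of the usual simplicial boundary map $\partial_{k+1}:C_{k+1}(F)\to C_k(F)$. In the quotients below $\operatorname{im}\delta$ means $\operatorname{im}\delta^{k-1}\subseteq C^k(F)$. A cochain over $\mathbb{Z}_2$ is identified with the set of simplexes to which it assigns coefficient $1$, and $\lVert\cdot\rVert$ denotes the Hamming norm on $C^k(\mathbb{Z}_2)$ (number of simplexes with coefficient $1$); $\lVert\cdot\rVert_2$ denotes the Euclidean norm on $C^k(\mathbb{R})$ with respect to the basis of $k$-simplexes. The $k$-th coboundary Cheeger number is $$h^k=h^k(X)=\min_{\substack{\phi\in C^k(\mathbb{Z}_2)\\ \phi\notin\operatorname{im}\delta}}\frac{\lVert\delta\phi\rVert}{\min_{\psi\in\operatorname{im}\delta}\lVert\phi+\psi\rVert},$$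 and $$\lambda^k=\lambda^k(X)=\min_{\substack{f\in C^k(\mathbb{R})\\ f\notin\operatorname{im}\delta}}\frac{\lVert\delta f\rVert_2^2}{\min_{g\in\operatorname{im}\delta}\lVert f+g\rVert_2^2}.$$ *)

theory Defs
  imports "HOL-Analysis.Analysis" "HOL-Library.Z2"
begin

text \<open>
  Simplicial complexes contain the empty face, which is their only face of dimension \<open>-1\<close>;
  degrees are therefore integers. This matters only in degrees \<open>-1\<close> and \<open>0\<close>.
\<close>

definition abstract_simplicial_complex :: "'a set set \<Rightarrow> bool" where
  "abstract_simplicial_complex X \<longleftrightarrow>
     finite X \<and> {} \<in> X \<and> (\<forall>\<sigma>\<in>X. finite \<sigma> \<and> (\<forall>\<tau>. \<tau> \<subseteq> \<sigma> \<longrightarrow> \<tau> \<in> X))"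

definition simplexes :: "'a set set \<Rightarrow> int \<Rightarrow> 'a set set" where
  "simplexes X k = {\<sigma> \<in> X. int (card \<sigma>) = k + 1}"

text \<open>
  Points are given by barycentric coordinates. As \<open>X\<close> is finite, only finitely many
  coordinates are not identically zero, so the subspace topology of the product
  is the usual topology.
\<close>

definition geometric_realization :: "'a set set \<Rightarrow> ('a \<Rightarrow> real) topology" where
  "geometric_realization X =
     subtopology (powertop_real UNIV)
       {x. (\<forall>v. 0 \<le> x v) \<and> {v. x v \<noteq> 0} \<in> X \<and> (\<Sum>v | x v \<noteq> 0. x v) = 1}"

definition Euclidean_ball :: "nat \<Rightarrow> (nat \<Rightarrow> real) topology" where
  "Euclidean_ball m = subtopology (Euclidean_space m) {x. (\<Sum>i<m. (x i)\<^sup>2) \<le> 1}"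

definition simplicial_ball :: "nat \<Rightarrow> 'a set set \<Rightarrow> bool" where
  "simplicial_ball m X \<longleftrightarrow>
     abstract_simplicial_complex X \<and>
     geometric_realization X homeomorphic_space Euclidean_ball m"

text \<open>
  A \<open>k\<close>-cochain is given by its coefficients on the \<open>k\<close>-simplexes, extended by zero to
  all vertex sets. Each simplex carries the orientation induced by the order on the vertices.
\<close>

definition cochains :: "'a set set \<Rightarrow> int \<Rightarrow> ('a set \<Rightarrow> 'f::field) set" where
  "cochains X k = {\<phi>. \<forall>\<sigma>. \<sigma> \<notin> simplexes X k \<longrightarrow> \<phi> \<sigma> = 0}"

text \<open>
  The coefficient of \<open>\<sigma>\<close> in the boundary of \<open>\<tau>\<close>: for \<open>v\<^sub>0 < \<dots> < v\<^sub>p\<close> the boundary of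
  \<open>[v\<^sub>0, \<dots>, v\<^sub>p]\<close> is the sum of the faces omitting \<open>v\<^sub>i\<close>, with signs \<open>(-1)^i\<close>. The sum below
  has at most one summand.
\<close>

definition boundary_coeff :: "'a::linorder set \<Rightarrow> 'a set \<Rightarrow> 'f::field" where
  "boundary_coeff \<tau> \<sigma> = (\<Sum>v | v \<in> \<tau> \<and> \<tau> - {v} = \<sigma>. (- 1) ^ card {u \<in> \<tau>. u < v})"

text \<open>The transpose of the boundary map from \<open>(k+1)\<close>-chains to \<open>k\<close>-chains:\<close>

definition coboundary ::
    "'a::linorder set set \<Rightarrow> int \<Rightarrow> ('a set \<Rightarrow> 'f::field) \<Rightarrow> ('a set \<Rightarrow> 'f)" where
  "coboundary X k \<phi> = (\<lambda>\<tau>. if \<tau> \<in> simplexes X (k + 1)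
                             then (\<Sum>\<sigma>\<in>simplexes X k. boundary_coeff \<tau> \<sigma> * \<phi> \<sigma>) else 0)"

definition coboundaries :: "'a::linorder set set \<Rightarrow> int \<Rightarrow> ('a set \<Rightarrow> 'f::field) set" where
  "coboundaries X k = coboundary X (k - 1) ` cochains X (k - 1)"

definition hamming_norm :: "'a set set \<Rightarrow> int \<Rightarrow> ('a set \<Rightarrow> bit) \<Rightarrow> nat" where
  "hamming_norm X k \<phi> = card {\<sigma> \<in> simplexes X k. \<phi> \<sigma> = 1}"

definition l2_norm :: "'a set set \<Rightarrow> int \<Rightarrow> ('a set \<Rightarrow> real) \<Rightarrow> real" where
  "l2_norm X k f = sqrt (\<Sum>\<sigma>\<in>simplexes X k. (f \<sigma>)\<^sup>2)"

definition cheeger_number :: "int \<Rightarrow> 'a::linorder set set \<Rightarrow> real" where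
  "cheeger_number k X =
     (MIN \<phi> \<in> cochains X k - coboundaries X k.
        real (hamming_norm X (k + 1) (coboundary X k \<phi>)) /
        real (MIN \<psi> \<in> coboundaries X k. hamming_norm X k (\<lambda>\<sigma>. \<phi> \<sigma> + \<psi> \<sigma>)))"

text \<open>
  Both infima are attained: the inner one because it is the distance to a subspace of a
  finite-dimensional space, the outer one because, the quotient being unchanged by scaling
  and by adding coboundaries, \<open>f\<close> may be restricted to unit vectors orthogonal to the coboundaries.
\<close>

definition lambda_number :: "int \<Rightarrow> 'a::linorder set set \<Rightarrow> real" where
  "lambda_number k X =
     (INF f \<in> cochains X k - coboundaries X k.
        (l2_norm X (k + 1) (coboundary X k f))\<^sup>2 /
        (INF g \<in> coboundaries X k. (l2_norm X k (\<lambda>\<sigma>. f \<sigma> + g \<sigma>))\<^sup>2))"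

end

theory Submission
  imports Defs
begin

text \<open>
  In an \<open>m\<close>-ball every cocycle of degree \<open>m - 1\<close> is a coboundary, so a class \<open>f + im \<delta>\<close> is determined
  by \<open>w = \<delta> f\<close>, and both numbers ask how expensive it is to write a given \<open>w\<close> as \<open>\<delta> f\<close>. Up to signs
  \<open>f\<close> is a flow on the dual graph: the facets are edges, the \<open>m\<close>-simplexes are vertices carrying the
  sources \<open>w\<close>, and the flow leaves through the boundary facets. Counting the facets used gives \<open>h\<close>,
  measuring the energy of the flow gives \<open>\<lambda>\<close>. If every single \<open>m\<close>-simplex can be discharged across at
  most \<open>k\<close> facets, then \<open>h \<ge> 1/k\<close>; if some simplex needs \<open>k\<close> facets, then \<open>h \<le> 1/k\<close>.

  The balls \<open>X\<^sub>k\<close> are stacked: starting from one simplex, new simplexes are glued onto boundary facets.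
  The dual graph is a tree in which every simplex has at least \<open>m\<close> facets pointing outwards, and
  passing the flow on in equal parts through them keeps its energy within a constant factor of
  \<open>\<parallel>w\<parallel>\<^sup>2\<close>, whatever the size of the tree (\<open>stacked_filling_energy\<close>). This is the bound on \<open>\<lambda>\<close>.
  Gluing a simplex onto every boundary facet, \<open>k\<close> times over, surrounds the first simplex by \<open>k\<close>
  disjoint cuts, so \<open>h \<le> 1/k\<close> (\<open>stacked_deep\<close>).

  The balls \<open>Y\<^sub>k\<close> turn this tree inside out. Starting from the cone with apex \<open>w\<close> over the boundary of a
  simplex, all \<open>m\<close>-simplexes containing \<open>w\<close> are starred at interior points, over and over. Each such
  step replaces a simplex at depth \<open>j\<close> by one at depth \<open>j\<close> and \<open>m\<close> at depth \<open>j + 1\<close>, so after \<open>k - 1\<close>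
  rounds every simplex has depth at most \<open>k\<close> (\<open>layered_fills\<close>), but there are at least
  \<open>(m + 1) m^(k - 1)\<close> of them, while the boundary still has only \<open>m + 1\<close> facets. A flow with sources \<open>1\<close>
  everywhere has to squeeze through these; pairing it with the fundamental chain, which starring
  preserves, and using Cauchy-Schwarz bounds \<open>\<lambda>\<close> by \<open>(m + 1)\<close> over the number of simplexes
  (\<open>lambda_number_le\<close>).

  That all these complexes are balls is shown by explicit homeomorphisms: starring a simplex and
  stacking onto a boundary facet do not change the geometric realization, and a simplex is
  homeomorphic to a Euclidean ball by radial rescaling. The same two moves preserve exactness in
  degree \<open>m - 1\<close>.
\<close>

section \<open>The coboundary operator on all functions of finite sets\<close>

definition face_sign :: "'a::linorder set \<Rightarrow> 'a \<Rightarrow> 'f::field" where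
  "face_sign \<tau> x = (- 1) ^ card {u \<in> \<tau>. u < x}"

lemma face_sign_square [simp]: "face_sign \<tau> x * face_sign \<tau> x = 1"
  by (simp add: face_sign_def flip: power_add)

lemma face_sign_square_left [simp]: "face_sign \<tau> x * (face_sign \<tau> x * a) = a"
  by (metis face_sign_square mult.assoc mult_1)

lemma face_sign_power2 [simp]: "(face_sign \<tau> x)\<^sup>2 = 1"
  by (simp add: power2_eq_square)

lemma face_sign_nonzero [simp]: "face_sign \<tau> x \<noteq> 0"
  by (simp add: face_sign_def)

lemma face_sign_swap_less:
  assumes "finite \<tau>" "a \<in> \<tau>" "b \<in> \<tau>" "a < b"
  shows "(face_sign \<tau> a * face_sign (\<tau> - {a}) b :: 'f::field) =
         - (face_sign \<tau> b * face_sign (\<tau> - {b}) a)"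
proof -
  have "{u \<in> \<tau>. u < b} = insert a {u \<in> \<tau> - {a}. u < b}"
    using assms by auto
  then have "card {u \<in> \<tau>. u < b} = Suc (card {u \<in> \<tau> - {a}. u < b})"
    using assms by simp
  moreover have "{u \<in> \<tau> - {b}. u < a} = {u \<in> \<tau>. u < a}"
    using assms by auto
  ultimately show ?thesis
    by (simp add: face_sign_def mult.commute)
qed

lemma face_sign_swap:
  assumes "finite \<tau>" "a \<in> \<tau>" "b \<in> \<tau>" "a \<noteq> b"
  shows "(face_sign \<tau> a * face_sign (\<tau> - {a}) b :: 'f::field) =
         - (face_sign \<tau> b * face_sign (\<tau> - {b}) a)"
proof (cases "a < b")
  case True
  then show ?thesis using face_sign_swap_less[of \<tau> a b] assms by simp
next
  case False
  then have "b < a" using assms by simp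
  then show ?thesis using face_sign_swap_less[of \<tau> b a, where ?'f = 'f] assms by simp
qed

lemma boundary_coeff_face:
  assumes "x \<in> \<tau>"
  shows "boundary_coeff \<tau> (\<tau> - {x}) = face_sign \<tau> x"
proof -
  have "{v. v \<in> \<tau> \<and> \<tau> - {v} = \<tau> - {x}} = {x}" using assms by auto
  then show ?thesis by (simp add: boundary_coeff_def face_sign_def)
qed

lemma boundary_coeff_eq_0:
  assumes "\<And>x. x \<in> \<tau> \<Longrightarrow> \<sigma> \<noteq> \<tau> - {x}"
  shows "boundary_coeff \<tau> \<sigma> = 0"
proof -
  have "{v. v \<in> \<tau> \<and> \<tau> - {v} = \<sigma>} = {}" using assms by auto
  then show ?thesis unfolding boundary_coeff_def by (simp only: sum.empty)
qed

text \<open>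
  The coboundary without reference to a complex: as all faces of a simplex of a complex belong to
  the complex, \<open>coboundary X k \<phi>\<close> agrees with \<open>cobd \<phi>\<close> on the \<open>(k+1)\<close>-simplexes of \<open>X\<close>. This avoids
  extending and restricting cochains when the complex changes.
\<close>

definition cobd :: "('a::linorder set \<Rightarrow> 'f::field) \<Rightarrow> 'a set \<Rightarrow> 'f" where
  "cobd \<phi> \<sigma> = (\<Sum>x\<in>\<sigma>. face_sign \<sigma> x * \<phi> (\<sigma> - {x}))"

lemma cobd_add: "cobd (\<lambda>\<rho>. \<phi> \<rho> + \<psi> \<rho>) \<sigma> = cobd \<phi> \<sigma> + cobd \<psi> \<sigma>"
  by (simp add: cobd_def distrib_left sum.distrib)

lemma cobd_diff: "cobd (\<lambda>\<rho>. \<phi> \<rho> - \<psi> \<rho>) \<sigma> = cobd \<phi> \<sigma> - cobd \<psi> \<sigma>"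
  by (simp add: cobd_def right_diff_distrib sum_subtractf)

lemma cobd_scale: "cobd (\<lambda>\<rho>. c * \<phi> \<rho>) \<sigma> = c * cobd \<phi> \<sigma>"
  by (simp add: cobd_def sum_distrib_left mult.left_commute)

lemma cobd_sum: "cobd (\<lambda>\<rho>. \<Sum>i\<in>I. \<phi> i \<rho>) \<sigma> = (\<Sum>i\<in>I. cobd (\<phi> i) \<sigma>)"
  unfolding cobd_def by (simp add: sum_distrib_left) (rule sum.swap)

lemma cobd_cong:
  "(\<And>x. x \<in> \<sigma> \<Longrightarrow> \<phi> (\<sigma> - {x}) = \<psi> (\<sigma> - {x})) \<Longrightarrow> cobd \<phi> \<sigma> = cobd \<psi> \<sigma>"
  by (simp add: cobd_def)

lemma cobd_zero: "(\<And>x. x \<in> \<sigma> \<Longrightarrow> \<phi> (\<sigma> - {x}) = 0) \<Longrightarrow> cobd \<phi> \<sigma> = 0"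
  by (simp add: cobd_def)

lemma cobd_single:
  assumes "finite \<sigma>" "y \<in> \<sigma>" "\<And>x. x \<in> \<sigma> \<Longrightarrow> x \<noteq> y \<Longrightarrow> \<phi> (\<sigma> - {x}) = 0"
  shows "cobd \<phi> \<sigma> = face_sign \<sigma> y * \<phi> (\<sigma> - {y})"
  unfolding cobd_def using assms by (subst sum.remove[of _ y]) (auto intro: sum.neutral)

text \<open>
  The faces \<open>\<tau> - {a, b}\<close> are reached in two orders, with opposite signs by \<open>face_sign_swap\<close>.
\<close>

lemma cobd_cobd:
  fixes \<phi> :: "'a::linorder set \<Rightarrow> 'f::field"
  assumes "finite \<tau>"
  shows "cobd (cobd \<phi>) \<tau> = 0"
proof -
  define t :: "'a \<Rightarrow> 'a \<Rightarrow> 'f"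
    where "t a b = face_sign \<tau> a * face_sign (\<tau> - {a}) b * \<phi> (\<tau> - {a} - {b})" for a b
  have swap: "t a b = - t b a" if "a \<in> \<tau>" "b \<in> \<tau>" "a \<noteq> b" for a b
  proof -
    have "\<tau> - {a} - {b} = \<tau> - {b} - {a}" by auto
    then show ?thesis
      using face_sign_swap[of \<tau> a b, where ?'f = 'f] that assms by (simp add: t_def)
  qed
  have "cobd (cobd \<phi>) \<tau> = (\<Sum>a\<in>\<tau>. \<Sum>b\<in>\<tau> - {a}. t a b)"
    by (simp add: cobd_def t_def sum_distrib_left mult.assoc del: Diff_insert0 Diff_idemp)
  also have "\<dots> = (\<Sum>a\<in>\<tau>. (\<Sum>b\<in>{b\<in>\<tau>. a < b}. t a b) + (\<Sum>b\<in>{b\<in>\<tau>. b < a}. t a b))"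
  proof (rule sum.cong)
    fix a assume "a \<in> \<tau>"
    have "(\<Sum>b\<in>\<tau> - {a}. t a b) = (\<Sum>b\<in>{b\<in>\<tau>. a < b} \<union> {b\<in>\<tau>. b < a}. t a b)"
      by (rule sum.cong) auto
    also have "\<dots> = (\<Sum>b\<in>{b\<in>\<tau>. a < b}. t a b) + (\<Sum>b\<in>{b\<in>\<tau>. b < a}. t a b)"
      using assms by (intro sum.union_disjoint) auto
    finally show "(\<Sum>b\<in>\<tau> - {a}. t a b) = (\<Sum>b\<in>{b\<in>\<tau>. a < b}. t a b) + (\<Sum>b\<in>{b\<in>\<tau>. b < a}. t a b)" .
  qed simp
  also have "\<dots> = (\<Sum>a\<in>\<tau>. \<Sum>b\<in>{b\<in>\<tau>. a < b}. t a b) + (\<Sum>a\<in>\<tau>. \<Sum>b\<in>{b\<in>\<tau>. b < a}. t a b)"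
    by (rule sum.distrib)
  also have "(\<Sum>a\<in>\<tau>. \<Sum>b\<in>{b\<in>\<tau>. b < a}. t a b) = (\<Sum>b\<in>\<tau>. \<Sum>a\<in>{a\<in>\<tau>. b < a}. t a b)"
    by (rule sum.swap_restrict[OF assms assms])
  also have "\<dots> = (\<Sum>b\<in>\<tau>. \<Sum>a\<in>{a\<in>\<tau>. b < a}. - t b a)"
  proof (intro sum.cong[OF refl])
    fix b a assume "b \<in> \<tau>" "a \<in> {a\<in>\<tau>. b < a}"
    then show "t a b = - t b a" by (intro swap) auto
  qed
  finally show ?thesis by (simp add: sum_negf)
qed

text \<open>
  The transpose of the chain map \<open>\<rho> \<mapsto> w * \<rho>\<close>, which joins a face to the apex \<open>w\<close>; the cone
  formula below says that it is a contracting homotopy.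
\<close>

definition coning :: "'a::linorder \<Rightarrow> ('a set \<Rightarrow> 'f::field) \<Rightarrow> 'a set \<Rightarrow> 'f" where
  "coning w \<phi> \<rho> = (if w \<in> \<rho> then 0 else face_sign (insert w \<rho>) w * \<phi> (insert w \<rho>))"

lemma cone_homotopy:
  fixes \<phi> :: "'a::linorder set \<Rightarrow> 'f::field"
  assumes "finite \<sigma>"
  shows "\<phi> \<sigma> = cobd (coning w \<phi>) \<sigma> + coning w (cobd \<phi>) \<sigma>"
proof (cases "w \<in> \<sigma>")
  case True
  have "cobd (coning w \<phi>) \<sigma> = face_sign \<sigma> w * coning w \<phi> (\<sigma> - {w})"
    using assms True by (intro cobd_single) (auto simp: coning_def)
  then show ?thesis using True by (simp add: coning_def insert_absorb)
next
  case False
  define \<tau> where "\<tau> = insert w \<sigma>"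
  have "cobd \<phi> \<tau> = face_sign \<tau> w * \<phi> \<sigma> + (\<Sum>x\<in>\<sigma>. face_sign \<tau> x * \<phi> (\<tau> - {x}))"
    unfolding cobd_def using assms False by (simp add: \<tau>_def)
  then have "coning w (cobd \<phi>) \<sigma> =
      \<phi> \<sigma> + (\<Sum>x\<in>\<sigma>. face_sign \<tau> w * (face_sign \<tau> x * \<phi> (\<tau> - {x})))"
    using False by (simp add: coning_def distrib_left sum_distrib_left flip: \<tau>_def)
  moreover have "cobd (coning w \<phi>) \<sigma> = (\<Sum>x\<in>\<sigma>. - (face_sign \<tau> w * (face_sign \<tau> x * \<phi> (\<tau> - {x}))))"
    unfolding cobd_def
  proof (rule sum.cong)
    fix x assume x: "x \<in> \<sigma>"
    then have ne: "w \<noteq> x" and ins: "insert w (\<sigma> - {x}) = \<tau> - {x}" and "\<tau> - {w} = \<sigma>"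
      using False by (auto simp: \<tau>_def)
    then have "face_sign \<tau> w * face_sign \<sigma> x = - ((face_sign \<tau> x * face_sign (\<tau> - {x}) w) :: 'f)"
      using face_sign_swap[of \<tau> w x, where ?'f = 'f] assms x by (simp add: \<tau>_def)
    then have "face_sign \<tau> w * (face_sign \<tau> w * face_sign \<sigma> x) * face_sign (\<tau> - {x}) w
        = face_sign \<tau> w * - ((face_sign \<tau> x * face_sign (\<tau> - {x}) w) :: 'f) * face_sign (\<tau> - {x}) w"
      by (rule arg_cong)
    then have "face_sign \<sigma> x * face_sign (\<tau> - {x}) w = - (face_sign \<tau> w * face_sign \<tau> x :: 'f)"
      by (simp add: mult.assoc)
    then show "face_sign \<sigma> x * coning w \<phi> (\<sigma> - {x}) = - (face_sign \<tau> w * (face_sign \<tau> x * \<phi> (\<tau> - {x})))"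
      using False by (simp add: coning_def ins flip: mult.assoc)
  qed simp
  ultimately show ?thesis by (simp add: sum_negf)
qed

section \<open>Exactness and its behaviour under gluing and starring\<close>

lemma complexD:
  assumes "abstract_simplicial_complex X"
  shows "finite X" "{} \<in> X" "\<sigma> \<in> X \<Longrightarrow> finite \<sigma>" "\<sigma> \<in> X \<Longrightarrow> \<tau> \<subseteq> \<sigma> \<Longrightarrow> \<tau> \<in> X"
  using assms by (auto simp: abstract_simplicial_complex_def)

lemma complex_Pow: "finite \<tau> \<Longrightarrow> abstract_simplicial_complex (Pow \<tau>)"
  by (auto simp: abstract_simplicial_complex_def finite_subset)

lemma complex_Un:
  "abstract_simplicial_complex X \<Longrightarrow> abstract_simplicial_complex Y \<Longrightarrow> abstract_simplicial_complex (X \<union> Y)"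
  unfolding abstract_simplicial_complex_def by blast

lemma coboundary_eq_cobd:
  fixes \<phi> :: "'a::linorder set \<Rightarrow> 'f::field"
  assumes X: "abstract_simplicial_complex X" and \<tau>: "\<tau> \<in> simplexes X (k + 1)"
  shows "coboundary X k \<phi> \<tau> = cobd \<phi> \<tau>"
proof -
  have fin: "finite \<tau>" and "\<tau> \<in> X" and card: "int (card \<tau>) = k + 2"
    using \<tau> complexD[OF X] by (auto simp: simplexes_def)
  have sub: "(\<lambda>x. \<tau> - {x}) ` \<tau> \<subseteq> simplexes X k"
  proof clarify
    fix x assume "x \<in> \<tau>"
    then have "Suc (card (\<tau> - {x})) = card \<tau>" using fin by (rule_tac card_Suc_Diff1)
    then show "\<tau> - {x} \<in> simplexes X k"
      using card \<open>\<tau> \<in> X\<close> complexD(4)[OF X] by (auto simp: simplexes_def)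
  qed
  have "coboundary X k \<phi> \<tau> = (\<Sum>\<sigma>\<in>simplexes X k. boundary_coeff \<tau> \<sigma> * \<phi> \<sigma>)"
    using \<tau> by (simp add: coboundary_def)
  also have "\<dots> = (\<Sum>\<sigma>\<in>(\<lambda>x. \<tau> - {x}) ` \<tau>. boundary_coeff \<tau> \<sigma> * \<phi> \<sigma>)"
  proof (rule sum.mono_neutral_right[OF _ sub])
    show "finite (simplexes X k)" using complexD(1)[OF X] by (simp add: simplexes_def)
    show "\<forall>\<sigma>\<in>simplexes X k - (\<lambda>x. \<tau> - {x}) ` \<tau>. boundary_coeff \<tau> \<sigma> * \<phi> \<sigma> = 0"
      by (auto intro!: boundary_coeff_eq_0)
  qed
  also have "\<dots> = cobd \<phi> \<tau>"
    unfolding cobd_def by (subst sum.reindex) (auto simp: inj_on_def boundary_coeff_face intro!: sum.cong)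
  finally show ?thesis .
qed

text \<open>
  Simplexes with \<open>n\<close> vertices have dimension \<open>n - 1\<close>: this is the vanishing of the reduced cohomology
  of \<open>X\<close> in degree \<open>n - 1\<close>. Quantifying over all functions instead of cochains is harmless, as only
  their values on \<open>X\<close> enter.
\<close>

definition exact_at :: "'f::field itself \<Rightarrow> 'a::linorder set set \<Rightarrow> nat \<Rightarrow> bool" where
  "exact_at _ X n \<longleftrightarrow> (\<forall>\<phi> :: 'a set \<Rightarrow> 'f.
     (\<forall>\<tau>\<in>X. card \<tau> = Suc n \<longrightarrow> cobd \<phi> \<tau> = 0) \<longrightarrow>
     (\<exists>\<psi> :: 'a set \<Rightarrow> 'f. \<forall>\<sigma>\<in>X. card \<sigma> = n \<longrightarrow> cobd \<psi> \<sigma> = \<phi> \<sigma>))"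

lemma exact_atD:
  fixes \<phi> :: "'a::linorder set \<Rightarrow> 'f::field"
  assumes "exact_at TYPE('f) X n" "\<And>\<tau>. \<tau> \<in> X \<Longrightarrow> card \<tau> = Suc n \<Longrightarrow> cobd \<phi> \<tau> = 0"
  obtains \<psi> where "\<And>\<sigma>. \<sigma> \<in> X \<Longrightarrow> card \<sigma> = n \<Longrightarrow> cobd \<psi> \<sigma> = \<phi> \<sigma>"
  using assms unfolding exact_at_def by metis

lemma exact_at_simplex:
  assumes "finite \<tau>" "w \<in> \<tau>"
  shows "exact_at TYPE('f::field) (Pow \<tau>) n"
  unfolding exact_at_def
proof (intro allI impI)
  fix \<phi> :: "'a set \<Rightarrow> 'f"
  assume z: "\<forall>\<tau>\<in>Pow \<tau>. card \<tau> = Suc n \<longrightarrow> cobd \<phi> \<tau> = 0"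
  show "\<exists>\<psi> :: 'a set \<Rightarrow> 'f. \<forall>\<sigma>\<in>Pow \<tau>. card \<sigma> = n \<longrightarrow> cobd \<psi> \<sigma> = \<phi> \<sigma>"
  proof (intro exI ballI impI)
    fix \<sigma> assume "\<sigma> \<in> Pow \<tau>" "card \<sigma> = n"
    moreover from this have "finite \<sigma>" using assms finite_subset by auto
    ultimately have "coning w (cobd \<phi>) \<sigma> = 0"
      using assms z by (auto simp: coning_def)
    then show "cobd (coning w \<phi>) \<sigma> = \<phi> \<sigma>"
      using cone_homotopy[OF \<open>finite \<sigma>\<close>, of \<phi> w] by simp
  qed
qed

text \<open>
  If the intersection of \<open>X\<close> with the new simplex \<open>\<tau>\<close> is a cone with apex \<open>w\<close>, then after correcting a
  cocycle so that it vanishes on \<open>X\<close>, coning with \<open>w\<close> inside \<open>\<tau>\<close> writes the rest as a coboundary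
  of something that does not disturb \<open>X\<close>.
\<close>

lemma exact_at_attach:
  assumes X: "abstract_simplicial_complex X" and ex: "exact_at TYPE('f::field) X n"
    and \<tau>: "finite \<tau>" "w \<in> \<tau>"
    and conic: "\<And>\<rho>. \<rho> \<in> X \<Longrightarrow> \<rho> \<subseteq> \<tau> \<Longrightarrow> insert w \<rho> \<in> X"
  shows "exact_at TYPE('f) (X \<union> Pow \<tau>) n"
  unfolding exact_at_def
proof (intro allI impI)
  fix \<phi> :: "'a set \<Rightarrow> 'f"
  assume z: "\<forall>\<tau>\<in>X \<union> Pow \<tau>. card \<tau> = Suc n \<longrightarrow> cobd \<phi> \<tau> = 0"
  then obtain \<psi> where \<psi>: "\<And>\<sigma>. \<sigma> \<in> X \<Longrightarrow> card \<sigma> = n \<Longrightarrow> cobd \<psi> \<sigma> = \<phi> \<sigma>"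
    using exact_atD[OF ex] by blast
  have fin: "finite \<sigma>" if "\<sigma> \<in> X \<union> Pow \<tau>" for \<sigma>
    using that complexD[OF X] \<tau> finite_subset by auto
  define \<phi>' where "\<phi>' \<sigma> = \<phi> \<sigma> - cobd \<psi> \<sigma>" for \<sigma>
  have \<phi>'0: "\<phi>' \<sigma> = 0" if "\<sigma> \<in> X" "card \<sigma> = n" for \<sigma>
    using \<psi> that by (simp add: \<phi>'_def)
  have z': "cobd \<phi>' \<sigma> = 0" if "\<sigma> \<in> X \<union> Pow \<tau>" "card \<sigma> = Suc n" for \<sigma>
    using that z fin[of \<sigma>] unfolding \<phi>'_def by (simp add: cobd_diff cobd_cobd)
  define \<psi>' where "\<psi>' \<rho> = (if \<rho> \<subseteq> \<tau> then coning w \<phi>' \<rho> else 0)" for \<rho>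
  have "cobd \<psi>' \<sigma> = \<phi>' \<sigma>" if "\<sigma> \<in> X \<union> Pow \<tau>" "card \<sigma> = n" for \<sigma>
  proof (cases "\<sigma> \<subseteq> \<tau>")
    case True
    have "cobd \<psi>' \<sigma> = cobd (coning w \<phi>') \<sigma>"
      using True by (intro cobd_cong) (auto simp: \<psi>'_def)
    moreover have "coning w (cobd \<phi>') \<sigma> = 0"
      using True \<tau> that fin[of \<sigma>] z'[of "insert w \<sigma>"] by (auto simp: coning_def)
    ultimately show ?thesis
      using cone_homotopy[OF fin[OF that(1)], of \<phi>' w] by simp
  next
    case False
    then have "\<sigma> \<in> X" using that by auto
    have "cobd \<psi>' \<sigma> = 0"
    proof (rule cobd_zero)
      fix x assume x: "x \<in> \<sigma>"
      have "\<sigma> - {x} \<in> X" using complexD(4)[OF X \<open>\<sigma> \<in> X\<close>] by auto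
      moreover have "card (insert w (\<sigma> - {x})) = n" if "w \<notin> \<sigma> - {x}"
        using card_Suc_Diff1[OF fin[OF \<open>\<sigma> \<in> X \<union> Pow \<tau>\<close>] x] that fin[OF \<open>\<sigma> \<in> X \<union> Pow \<tau>\<close>] \<open>card \<sigma> = n\<close>
        by (metis card_insert_disjoint finite_Diff)
      ultimately show "\<psi>' (\<sigma> - {x}) = 0"
        using conic \<phi>'0 by (simp add: \<psi>'_def coning_def)
    qed
    then show ?thesis using \<phi>'0[OF \<open>\<sigma> \<in> X\<close>] that by simp
  qed
  then have "\<forall>\<sigma>\<in>X \<union> Pow \<tau>. card \<sigma> = n \<longrightarrow> cobd (\<lambda>\<rho>. \<psi> \<rho> + \<psi>' \<rho>) \<sigma> = \<phi> \<sigma>"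
    by (simp add: cobd_add \<phi>'_def)
  then show "\<exists>\<psi> :: 'a set \<Rightarrow> 'f. \<forall>\<sigma>\<in>X \<union> Pow \<tau>. card \<sigma> = n \<longrightarrow> cobd \<psi> \<sigma> = \<phi> \<sigma>" by blast
qed

text \<open>
  The stellar subdivision of \<open>X\<close> at the simplex \<open>\<tau>\<close>, with \<open>v\<close> as the new interior point, in the case that
  \<open>\<tau>\<close> is a maximal simplex of \<open>X\<close>.
\<close>

definition starred_at :: "'a set set \<Rightarrow> 'a set \<Rightarrow> 'a \<Rightarrow> 'a set set" where
  "starred_at X \<tau> v = (X - {\<tau>}) \<union> insert v ` {\<rho>. \<rho> \<subset> \<tau>}"

lemma starred_at_complex:
  assumes X: "abstract_simplicial_complex X" and \<tau>: "\<tau> \<in> X" "\<tau> \<noteq> {}"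
    and max: "\<And>\<rho>. \<rho> \<in> X \<Longrightarrow> \<tau> \<subseteq> \<rho> \<Longrightarrow> \<rho> = \<tau>"
  shows "abstract_simplicial_complex (starred_at X \<tau> v)"
  unfolding abstract_simplicial_complex_def
proof (intro conjI ballI allI impI)
  show "finite (starred_at X \<tau> v)"
    using complexD[OF X] \<tau> finite_subset[of "{\<rho>. \<rho> \<subset> \<tau>}" "Pow \<tau>"] by (auto simp: starred_at_def)
  show "{} \<in> starred_at X \<tau> v" using complexD[OF X] \<tau> by (auto simp: starred_at_def)
  fix \<sigma> assume \<sigma>: "\<sigma> \<in> starred_at X \<tau> v"
  show "finite \<sigma>" using \<sigma> complexD[OF X] \<tau> finite_subset by (fastforce simp: starred_at_def)
  fix \<rho> assume \<rho>: "\<rho> \<subseteq> \<sigma>"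
  consider "\<sigma> \<in> X" "\<sigma> \<noteq> \<tau>" | \<kappa> where "\<sigma> = insert v \<kappa>" "\<kappa> \<subset> \<tau>"
    using \<sigma> by (auto simp: starred_at_def)
  then show "\<rho> \<in> starred_at X \<tau> v"
  proof cases
    case 1
    then show ?thesis using \<rho> max[of \<sigma>] complexD(4)[OF X 1(1)] max[of \<rho>] by (auto simp: starred_at_def)
  next
    case 2
    show ?thesis
    proof (cases "v \<in> \<rho>")
      case True
      have "\<rho> - {v} \<subset> \<tau>" using 2 \<rho> by auto
      then have "insert v (\<rho> - {v}) \<in> starred_at X \<tau> v" unfolding starred_at_def by blast
      then show ?thesis using True by (simp add: insert_absorb)
    next
      case False
      then have "\<rho> \<subset> \<tau>" using 2 \<rho> by auto
      then show ?thesis using complexD(4)[OF X \<tau>(1)] by (auto simp: starred_at_def)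
    qed
  qed
qed

text \<open>
  Coning with \<open>v\<close> first makes a cocycle vanish on the star of \<open>v\<close>, in particular on the boundary of
  \<open>\<tau>\<close>. What is left is then a cocycle of \<open>X\<close>, hence the coboundary of some \<open>\<psi>2\<close>. This \<open>\<psi>2\<close> is a cocycle
  on \<open>\<tau>\<close>; coning with a vertex of \<open>\<tau>\<close> makes it vanish there, so that it extends by zero to the star
  of \<open>v\<close> without creating new values of the coboundary.
\<close>

lemma exact_at_starred:
  assumes X: "abstract_simplicial_complex X" and ex: "exact_at TYPE('f::field) X n"
    and \<tau>: "\<tau> \<in> X" "card \<tau> = Suc n" and v: "v \<notin> \<Union>X"
    and max: "\<And>\<rho>. \<rho> \<in> X \<Longrightarrow> \<tau> \<subseteq> \<rho> \<Longrightarrow> \<rho> = \<tau>"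
  shows "exact_at TYPE('f) (starred_at X \<tau> v) n"
  unfolding exact_at_def
proof (intro allI impI)
  fix \<phi> :: "'a set \<Rightarrow> 'f"
  assume z: "\<forall>\<sigma>\<in>starred_at X \<tau> v. card \<sigma> = Suc n \<longrightarrow> cobd \<phi> \<sigma> = 0"
  have ft: "finite \<tau>" using complexD[OF X] \<tau> by auto
  have v\<tau>: "v \<notin> \<tau>" using v \<tau> by auto
  have sub: "\<rho> \<in> X" if "\<rho> \<subseteq> \<tau>" for \<rho> using complexD[OF X] \<tau> that by auto
  have "\<tau> \<noteq> {}" using \<tau> by auto
  note cx = starred_at_complex[OF X \<tau>(1) this max]
  \<comment> \<open>make \<open>\<phi>\<close> vanish on the star of \<open>v\<close>\<close>
  define \<psi>1 where "\<psi>1 \<rho> = (if \<rho> \<subset> \<tau> then coning v \<phi> \<rho> else 0)" for \<rho>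
  define \<phi>1 where "\<phi>1 \<sigma> = \<phi> \<sigma> - cobd \<psi>1 \<sigma>" for \<sigma>
  have \<phi>1_star: "\<phi>1 \<sigma> = 0" if \<sigma>: "\<sigma> - {v} \<subset> \<tau>" "card \<sigma> = n" for \<sigma>
  proof -
    have fs: "finite \<sigma>" using ft \<sigma> finite_subset[of "\<sigma> - {v}" \<tau>] by auto
    have "cobd \<psi>1 \<sigma> = cobd (coning v \<phi>) \<sigma>"
    proof (rule cobd_cong)
      fix x assume "x \<in> \<sigma>"
      show "\<psi>1 (\<sigma> - {x}) = coning v \<phi> (\<sigma> - {x})"
        using v\<tau> \<sigma> by (auto simp: \<psi>1_def coning_def)
    qed
    moreover have "cobd \<phi> (insert v \<sigma>) = 0" if "v \<notin> \<sigma>"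
    proof -
      have "insert v \<sigma> \<in> starred_at X \<tau> v" using \<sigma> that by (auto simp: starred_at_def)
      then show ?thesis using z that fs \<sigma> by simp
    qed
    then have "coning v (cobd \<phi>) \<sigma> = 0"
      by (simp add: coning_def)
    ultimately show ?thesis using cone_homotopy[OF fs, of \<phi> v] by (simp add: \<phi>1_def)
  qed
  have "cobd \<phi>1 \<sigma> = 0" if \<sigma>: "\<sigma> \<in> X" "card \<sigma> = Suc n" for \<sigma>
  proof (cases "\<sigma> = \<tau>")
    case True
    then show ?thesis using \<tau> ft v\<tau> by (intro cobd_zero \<phi>1_star) auto
  next
    case False
    then show ?thesis using z \<sigma> complexD(3)[OF X]
      unfolding \<phi>1_def by (simp add: cobd_diff cobd_cobd starred_at_def)
  qed
  then obtain \<psi>2 where \<psi>2: "\<And>\<sigma>. \<sigma> \<in> X \<Longrightarrow> card \<sigma> = n \<Longrightarrow> cobd \<psi>2 \<sigma> = \<phi>1 \<sigma>"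
    using exact_atD[OF ex] by blast
  obtain w where w: "w \<in> \<tau>" using \<tau> by fastforce
  \<comment> \<open>make \<open>\<psi>2\<close> vanish on the faces of \<open>\<tau>\<close> with \<open>n - 1\<close> vertices\<close>
  define \<eta> where "\<eta> \<rho> = (if \<rho> \<subseteq> \<tau> then coning w \<psi>2 \<rho> else 0)" for \<rho>
  define \<psi>3 where "\<psi>3 \<rho> = (if v \<in> \<rho> then 0 else \<psi>2 \<rho> - cobd \<eta> \<rho>)" for \<rho>
  have \<psi>3_\<tau>: "\<psi>3 \<rho> = 0" if \<rho>: "\<rho> \<subseteq> \<tau>" "Suc (card \<rho>) = n" for \<rho>
  proof -
    have f\<rho>: "finite \<rho>" using \<rho> ft finite_subset by auto
    have "cobd \<eta> \<rho> = cobd (coning w \<psi>2) \<rho>"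
      using \<rho> by (intro cobd_cong) (auto simp: \<eta>_def)
    moreover have "cobd \<psi>2 (insert w \<rho>) = 0" if "w \<notin> \<rho>"
    proof -
      have c: "card (insert w \<rho>) = n" "insert w \<rho> \<subseteq> \<tau>" using \<rho> w that f\<rho> by auto
      then have "insert w \<rho> \<subset> \<tau>" using \<tau> by auto
      then have "\<phi>1 (insert w \<rho>) = 0" using \<phi>1_star[of "insert w \<rho>"] c v\<tau> by auto
      then show ?thesis using \<psi>2[OF sub] c by simp
    qed
    ultimately show ?thesis
      using cone_homotopy[OF f\<rho>, of \<psi>2 w] by (auto simp: \<psi>3_def coning_def)
  qed
  have \<psi>3: "cobd \<psi>3 \<sigma> = \<phi>1 \<sigma>" if \<sigma>: "\<sigma> \<in> starred_at X \<tau> v" "card \<sigma> = n" for \<sigma>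
  proof (cases "v \<in> \<sigma>")
    case False
    then have "\<sigma> \<in> X" using \<sigma> by (auto simp: starred_at_def)
    have "cobd \<psi>3 \<sigma> = cobd (\<lambda>\<rho>. \<psi>2 \<rho> - cobd \<eta> \<rho>) \<sigma>"
      using False by (intro cobd_cong) (auto simp: \<psi>3_def)
    then show ?thesis using \<psi>2[OF \<open>\<sigma> \<in> X\<close>] \<sigma> complexD(3)[OF X \<open>\<sigma> \<in> X\<close>] by (simp add: cobd_diff cobd_cobd)
  next
    case True
    then have *: "\<sigma> - {v} \<subset> \<tau>" using \<sigma> v by (auto simp: starred_at_def)
    have fs: "finite \<sigma>" using complexD(3)[OF cx] \<sigma> by blast
    have "cobd \<psi>3 \<sigma> = face_sign \<sigma> v * \<psi>3 (\<sigma> - {v})"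
      using True fs by (intro cobd_single) (auto simp: \<psi>3_def)
    also have "\<psi>3 (\<sigma> - {v}) = 0" using \<psi>3_\<tau>[of "\<sigma> - {v}"] * \<sigma> True fs by (simp add: psubset_eq card_Suc_Diff1 del: card_Diff_insert)
    finally show ?thesis using \<phi>1_star[OF *] \<sigma> by simp
  qed
  have "\<forall>\<sigma>\<in>starred_at X \<tau> v. card \<sigma> = n \<longrightarrow> cobd (\<lambda>\<rho>. \<psi>1 \<rho> + \<psi>3 \<rho>) \<sigma> = \<phi> \<sigma>"
    using \<psi>3 by (simp add: cobd_add \<phi>1_def)
  then show "\<exists>\<psi> :: 'a set \<Rightarrow> 'f. \<forall>\<sigma>\<in>starred_at X \<tau> v. card \<sigma> = n \<longrightarrow> cobd \<psi> \<sigma> = \<phi> \<sigma>" by blast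
qed

text \<open>
  Indexed by the number of vertices, so that no integer degrees occur.
\<close>

definition faces :: "'a set set \<Rightarrow> nat \<Rightarrow> 'a set set" where
  "faces X n = {\<sigma> \<in> X. card \<sigma> = n}"

lemma faces_iff: "\<sigma> \<in> faces X n \<longleftrightarrow> \<sigma> \<in> X \<and> card \<sigma> = n"
  by (simp add: faces_def)

abbreviation energy :: "'a set \<Rightarrow> ('a \<Rightarrow> real) \<Rightarrow> real" where
  "energy A f \<equiv> \<Sum>x\<in>A. (f x)\<^sup>2"

lemma finite_faces: "finite X \<Longrightarrow> finite (faces X n)"
  by (simp add: faces_def)

lemma inj_on_remove: "inj_on (\<lambda>x. \<tau> - {x}) \<tau>"
  by (auto simp: inj_on_def)

lemma facets_of_simplex:
  assumes "card \<tau> = Suc n"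
  shows "faces (Pow \<tau>) n = (\<lambda>x. \<tau> - {x}) ` \<tau>"
proof -
  have fin: "finite \<tau>" using assms by (intro card_ge_0_finite) simp
  show ?thesis
  proof (rule equalityI; rule subsetI)
    fix \<sigma> assume "\<sigma> \<in> faces (Pow \<tau>) n"
    then have \<sigma>: "\<sigma> \<subseteq> \<tau>" "card \<sigma> = n" by (auto simp: faces_def)
    then have "card (\<tau> - \<sigma>) = 1" using assms fin by (simp add: card_Diff_subset finite_subset)
    then obtain x where "\<tau> - \<sigma> = {x}" by (auto simp: card_1_singleton_iff)
    then have "\<sigma> = \<tau> - {x}" "x \<in> \<tau>" using \<sigma> by auto
    then show "\<sigma> \<in> (\<lambda>x. \<tau> - {x}) ` \<tau>" by blast
  next
    fix \<sigma> assume "\<sigma> \<in> (\<lambda>x. \<tau> - {x}) ` \<tau>"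
    then show "\<sigma> \<in> faces (Pow \<tau>) n" using assms fin by (auto simp: faces_def)
  qed
qed

lemma top_face_simplex: "faces (Pow {..m}) (Suc m) = {{..m}}"
proof -
  have "\<tau> = {..m}" if "\<tau> \<in> faces (Pow {..m}) (Suc m)" for \<tau>
    using that by (intro card_subset_eq) (auto simp: faces_iff)
  moreover have "{..m} \<in> faces (Pow {..m}) (Suc m)" by (simp add: faces_iff)
  ultimately show ?thesis by blast
qed

section \<open>Geometric realizations\<close>

definition realization_points :: "'a set set \<Rightarrow> ('a \<Rightarrow> real) set" where
  "realization_points X = {x. (\<forall>v. 0 \<le> x v) \<and> {v. x v \<noteq> 0} \<in> X \<and> (\<Sum>v | x v \<noteq> 0. x v) = 1}"

lemma geometric_realization_eq: "geometric_realization X = top_of_set (realization_points X)"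
  by (simp add: geometric_realization_def realization_points_def euclidean_product_topology)

lemma homeomorphic_space_top_of_set:
  assumes "S homeomorphic T"
  shows "top_of_set S homeomorphic_space top_of_set T"
proof -
  obtain f g where "homeomorphism S T f g" using assms by (auto simp: homeomorphic_def)
  then have "homeomorphic_maps (top_of_set S) (top_of_set T) f g"
    by (auto simp: homeomorphic_maps_def homeomorphism_def)
  then show ?thesis by (auto simp: homeomorphic_space_def)
qed

lemma mem_realization_points:
  assumes "finite V" "\<And>\<sigma>. \<sigma> \<in> X \<Longrightarrow> \<sigma> \<subseteq> V"
  shows "x \<in> realization_points X \<longleftrightarrow> (\<forall>u. 0 \<le> x u) \<and> {u. x u \<noteq> 0} \<in> X \<and> sum x V = 1"
proof -
  have "(\<Sum>u | x u \<noteq> 0. x u) = sum x V" if "{u. x u \<noteq> 0} \<in> X"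
    using assms that by (intro sum.mono_neutral_left) auto
  then show ?thesis by (auto simp: realization_points_def)
qed

lemma continuous_on_coordinate: "continuous_on S (\<lambda>x :: 'a \<Rightarrow> real. x i)"
  by (rule continuous_on_subset[OF continuous_on_product_coordinates]) auto

lemma continuous_on_if_const:
  "(P \<Longrightarrow> continuous_on S f) \<Longrightarrow> (\<not> P \<Longrightarrow> continuous_on S g) \<Longrightarrow> continuous_on S (\<lambda>x. if P then f x else g x)"
  by (cases P) auto

lemmas coordinatewise_intros =
  continuous_on_coordinatewise_then_product continuous_on_if_const continuous_on_coordinate
  continuous_on_const continuous_on_add continuous_on_diff continuous_on_minus continuous_on_mult
  continuous_on_divide continuous_on_sum continuous_on_power continuous_on_real_sqrt
  continuous_on_max continuous_on_min

lemma continuous_on_Max_image: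
  fixes h :: "'i \<Rightarrow> 'a::topological_space \<Rightarrow> real"
  assumes "finite I" "I \<noteq> {}" "\<And>i. i \<in> I \<Longrightarrow> continuous_on S (h i)"
  shows "continuous_on S (\<lambda>x. Max ((\<lambda>i. h i x) ` I))"
  using assms
proof (induction I rule: finite_ne_induct)
  case (insert i I)
  then show ?case by (simp add: continuous_on_max)
qed simp

lemma continuous_on_Min_image:
  fixes h :: "'i \<Rightarrow> 'a::topological_space \<Rightarrow> real"
  assumes "finite I" "I \<noteq> {}" "\<And>i. i \<in> I \<Longrightarrow> continuous_on S (h i)"
  shows "continuous_on S (\<lambda>x. Min ((\<lambda>i. h i x) ` I))"
  using assms
proof (induction I rule: finite_ne_induct)
  case (insert i I)
  then show ?case by (simp add: continuous_on_min)
qed simp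

lemma Min_image_add:
  fixes x :: "'a \<Rightarrow> real"
  assumes "finite I" "I \<noteq> {}"
  shows "Min ((\<lambda>i. x i + c) ` I) = Min (x ` I) + c"
  using Min_add_commute[OF assms, of x c] by (simp add: image_def)

text \<open>
  The subdivision homeomorphism: the weight of \<open>v\<close> is spread evenly over the vertices of \<open>\<tau>\<close>. In the
  other direction, the part \<open>Min (x ` \<tau>)\<close> that all vertices of \<open>\<tau>\<close> have in common is collected at \<open>v\<close>;
  it is nonzero only in the interior of \<open>\<tau>\<close>.
\<close>

lemma realization_starred:
  assumes X: "abstract_simplicial_complex X"
    and \<tau>: "\<tau> \<in> X" "\<tau> \<noteq> {}" and v: "v \<notin> \<Union>X"
    and max: "\<And>\<rho>. \<rho> \<in> X \<Longrightarrow> \<tau> \<subseteq> \<rho> \<Longrightarrow> \<rho> = \<tau>"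
  shows "geometric_realization (starred_at X \<tau> v) homeomorphic_space geometric_realization X"
proof -
  note fin = complexD(1,3)[OF X] and down = complexD(4)[OF X]
  define X' where "X' = (X - {\<tau>}) \<union> insert v ` {\<rho>. \<rho> \<subset> \<tau>}"
  define V where "V = \<Union>X"
  define n where "n = real (card \<tau>)"
  have f\<tau>: "finite \<tau>" and "\<tau> \<subseteq> V" using fin \<tau> by (auto simp: V_def)
  have npos: "n > 0" using f\<tau> \<tau> by (simp add: n_def card_gt_0_iff)
  have v\<tau>: "v \<notin> \<tau>" using v \<tau> by auto
  define f where "f x = (\<lambda>u. if u = v then 0 else if u \<in> \<tau> then x u + x v / n else x u)" for x :: "'a \<Rightarrow> real"
  define g where "g x = (\<lambda>u. if u = v then n * Min (x ` \<tau>) else if u \<in> \<tau> then x u - Min (x ` \<tau>) else x u)"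
    for x :: "'a \<Rightarrow> real"
  have "finite V" unfolding V_def using fin by auto
  then have finV: "finite (insert v V)" by simp
  have "finite (V - \<tau>)" using \<open>finite V\<close> by simp
  have split: "sum x (insert v V) = x v + (sum x \<tau> + sum x (V - \<tau>))" for x :: "'a \<Rightarrow> real"
  proof -
    have "V = \<tau> \<union> (V - \<tau>)" using \<open>\<tau> \<subseteq> V\<close> by auto
    moreover have "v \<notin> V" using v by (simp add: V_def)
    ultimately show ?thesis
      using \<open>finite V\<close> f\<tau> by (metis Diff_disjoint \<open>finite (V - \<tau>)\<close> sum.insert sum.union_disjoint)
  qed
  have mem: "x \<in> realization_points X \<longleftrightarrow> (\<forall>u. 0 \<le> x u) \<and> {u. x u \<noteq> 0} \<in> X \<and> sum x (insert v V) = 1" for x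
    by (rule mem_realization_points[OF finV]) (auto simp: V_def)
  have mem': "x \<in> realization_points X' \<longleftrightarrow> (\<forall>u. 0 \<le> x u) \<and> {u. x u \<noteq> 0} \<in> X' \<and> sum x (insert v V) = 1" for x
    by (rule mem_realization_points[OF finV]) (use \<open>\<tau> \<subseteq> V\<close> in \<open>auto simp: V_def X'_def\<close>)
  have Min_le: "Min (x ` \<tau>) \<le> x u" if "u \<in> \<tau>" for x :: "'a \<Rightarrow> real" and u
    using f\<tau> that by auto
  have sum_f: "sum (f x) (insert v V) = sum x (insert v V)" for x
  proof -
    have "sum (f x) \<tau> = (\<Sum>u\<in>\<tau>. x u + x v / n)" using v\<tau> by (intro sum.cong) (auto simp: f_def)
    moreover have "sum (f x) (V - \<tau>) = sum x (V - \<tau>)" using v by (intro sum.cong) (auto simp: f_def V_def)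
    ultimately show ?thesis using npos unfolding split by (simp add: f_def sum.distrib flip: n_def)
  qed
  have sum_g: "sum (g x) (insert v V) = sum x (insert v V)" if "x v = 0" for x
  proof -
    have "sum (g x) \<tau> = (\<Sum>u\<in>\<tau>. x u - Min (x ` \<tau>))" using v\<tau> by (intro sum.cong) (auto simp: g_def)
    moreover have "sum (g x) (V - \<tau>) = sum x (V - \<tau>)" using v by (intro sum.cong) (auto simp: g_def V_def)
    ultimately show ?thesis using that unfolding split by (simp add: g_def sum_subtractf flip: n_def)
  qed
  have "homeomorphism (realization_points X') (realization_points X) f g"
  proof (rule homeomorphismI)
    show "continuous_on (realization_points X') f"
      unfolding f_def by (intro coordinatewise_intros) (use npos in auto)
    show "continuous_on (realization_points X) g"
    proof -
      have "continuous_on (realization_points X) (\<lambda>x. Min (x ` \<tau>))"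
        using f\<tau> \<tau> by (intro continuous_on_Min_image continuous_on_coordinate) auto
      then show ?thesis unfolding g_def
        by (intro coordinatewise_intros)
    qed
    show "f ` realization_points X' \<subseteq> realization_points X"
    proof clarify
      fix x assume x: "x \<in> realization_points X'"
      let ?S = "{u. x u \<noteq> 0}"
      have nn: "\<And>u. 0 \<le> x u" and S: "?S \<in> X'" using x mem' by auto
      have "{u. f x u \<noteq> 0} \<in> X"
      proof (cases "x v = 0")
        case True
        then have "f x = x" by (auto simp: f_def)
        moreover have "?S \<in> X" using S True by (auto simp: X'_def)
        ultimately show ?thesis by simp
      next
        case False
        then obtain \<kappa> where "?S = insert v \<kappa>" "\<kappa> \<subset> \<tau>" using S v by (auto simp: X'_def)
        then have "{u. f x u \<noteq> 0} \<subseteq> \<tau>" by (auto simp: f_def)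
        then show ?thesis using down \<tau> by blast
      qed
      moreover have "0 \<le> f x u" for u using nn[of u] nn[of v] npos by (simp add: f_def)
      ultimately show "f x \<in> realization_points X" using x by (simp add: mem mem' sum_f)
    qed
    have xv: "x v = 0" if "x \<in> realization_points X" for x using that v by (auto simp: mem)
    show "g ` realization_points X \<subseteq> realization_points X'"
    proof clarify
      fix x assume x: "x \<in> realization_points X"
      let ?S = "{u. x u \<noteq> 0}" and ?s = "Min (x ` \<tau>)"
      have nn: "\<And>u. 0 \<le> x u" and S: "?S \<in> X" using x mem by auto
      have s0: "0 \<le> ?s" using f\<tau> \<tau> nn by simp
      have "{u. g x u \<noteq> 0} \<in> X'"
      proof (cases "?s = 0")
        case True
        then have "g x = x" using xv[OF x] by (auto simp: g_def)
        moreover have "?S \<noteq> \<tau>"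
        proof
          assume "?S = \<tau>"
          moreover have "?s \<in> x ` \<tau>" using f\<tau> \<tau> by (intro Min_in) auto
          ultimately show False using True by auto
        qed
        ultimately show ?thesis using S by (auto simp: X'_def)
      next
        case False
        have "?s \<in> x ` \<tau>" using f\<tau> \<tau> by (intro Min_in) auto
        then obtain t where t: "t \<in> \<tau>" "x t = ?s" by auto
        have "\<tau> \<subseteq> ?S" using Min_le[of _ x] s0 False by force
        then have S\<tau>: "?S = \<tau>" using max[OF S] by simp
        have "{u. g x u \<noteq> 0} = insert v ({u. g x u \<noteq> 0} - {v})" using False npos by (auto simp: g_def)
        moreover have "{u. g x u \<noteq> 0} - {v} \<subseteq> \<tau> - {t}" using t S\<tau> by (auto simp: g_def)
        ultimately show ?thesis using t unfolding X'_def by blast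
      qed
      moreover have "0 \<le> g x u" for u using nn[of u] Min_le[of u x] s0 npos by (simp add: g_def)
      ultimately show "g x \<in> realization_points X'" using x xv[OF x] by (simp add: mem mem' sum_g)
    qed
    show "f (g x) = x" if "x \<in> realization_points X" for x
      using xv[OF that] npos v\<tau> by (auto simp: f_def g_def)
    show "g (f x) = x" if x: "x \<in> realization_points X'" for x
    proof -
      have nn: "\<And>u. 0 \<le> x u" and S: "{u. x u \<noteq> 0} \<in> X'" using x mem' by auto
      have "\<not> \<tau> \<subseteq> {u. x u \<noteq> 0}" using S v\<tau> max by (auto simp: X'_def)
      then obtain t where "t \<in> \<tau>" "x t = 0" by auto
      then have "Min (x ` \<tau>) \<le> 0" using f\<tau> by (metis Min_le)
      moreover have "0 \<le> Min (x ` \<tau>)" using f\<tau> \<tau> nn by simp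
      ultimately have m0: "Min (x ` \<tau>) = 0" by simp
      have "f x ` \<tau> = (\<lambda>u. x u + x v / n) ` \<tau>" using v\<tau> by (intro image_cong) (auto simp: f_def)
      then have "Min (f x ` \<tau>) = x v / n" using Min_image_add[OF f\<tau> \<tau>(2), of x "x v / n"] m0 by simp
      then show ?thesis using npos by (auto simp: f_def g_def)
    qed
  qed
  then show ?thesis
    unfolding geometric_realization_eq starred_at_def X'_def by (intro homeomorphic_space_top_of_set) (auto simp: homeomorphic_def)
qed

text \<open>
  The union of \<open>w * F\<close> and \<open>v * F\<close> is a bipyramid over \<open>F\<close>, and it can be squeezed into the simplex
  \<open>w * F\<close> while the facets of \<open>w * F\<close> other than \<open>F\<close> stay fixed pointwise. Let \<open>b\<close> be the barycenter of
  \<open>F\<close>. For a fixed position in the boundary of \<open>F\<close>, the points of the bipyramid form a path from the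
  direction of \<open>w\<close> over that of \<open>b\<close> to that of \<open>v\<close>, with coordinates \<open>(p, s)\<close>, \<open>\<bar>p\<bar> + n s = r\<close>, where \<open>p > 0\<close>
  is weight at \<open>w\<close>, \<open>p < 0\<close> is weight at \<open>v\<close> and \<open>s\<close> is the common weight of the \<open>n\<close> vertices of \<open>F\<close>. The
  path is moved to its part from \<open>w\<close> to \<open>b\<close> by \<open>p \<mapsto> (p + r) / 2\<close>. As \<open>F\<close> lies in no other maximal simplex,
  all remaining points have \<open>s = 0\<close> and are fixed.
\<close>

lemma realization_stacked:
  assumes X: "abstract_simplicial_complex X"
    and F: "insert w F \<in> X" "w \<notin> F" "F \<noteq> {}" and v: "v \<notin> \<Union>X"
    and free: "\<And>\<rho>. \<rho> \<in> X \<Longrightarrow> F \<subseteq> \<rho> \<Longrightarrow> \<rho> \<subseteq> insert w F"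
  shows "geometric_realization (X \<union> Pow (insert v F)) homeomorphic_space geometric_realization X"
proof -
  note fin = complexD(1,3)[OF X] and down = complexD(4)[OF X]
  define X' where "X' = X \<union> Pow (insert v F)"
  define V where "V = \<Union>X"
  define n where "n = real (card F)"
  define s where "s x = Min (x ` F)" for x :: "'a \<Rightarrow> real"
  have fF: "finite F" using fin(2)[OF F(1)] by simp
  have FV: "insert w F \<subseteq> V" using F by (auto simp: V_def)
  have npos: "n > 0" using fF F by (simp add: n_def card_gt_0_iff)
  have vF: "v \<notin> F" "v \<noteq> w" "v \<notin> V" using v F by (auto simp: V_def)
  define f where "f x = (\<lambda>u. if u = v then 0 else if u = w then x w + n * s x / 2
      else if u \<in> F then x u - s x / 2 + x v / n else x u)" for x
  define g where "g x = (\<lambda>u. if u = v then max 0 (n * s x - x w) else if u = w then max 0 (x w - n * s x)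
      else if u \<in> F then x u - s x + min (2 * s x) (2 * x w / n) else x u)" for x
  have "finite V" unfolding V_def using fin by auto
  then have finV: "finite (insert v V)" by simp
  have split: "sum x (insert v V) = x v + (x w + (sum x F + sum x (V - insert w F)))" for x :: "'a \<Rightarrow> real"
  proof -
    have V: "V = insert w (F \<union> (V - insert w F))" using FV by auto
    have "sum x V = x w + (sum x F + sum x (V - insert w F))"
      using \<open>finite V\<close> fF F by (subst V, subst sum.insert, simp, simp, subst sum.union_disjoint) auto
    then show ?thesis using \<open>finite V\<close> vF by simp
  qed
  have mem: "x \<in> realization_points X \<longleftrightarrow> (\<forall>u. 0 \<le> x u) \<and> {u. x u \<noteq> 0} \<in> X \<and> sum x (insert v V) = 1" for x
    by (rule mem_realization_points[OF finV]) (auto simp: V_def)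
  have mem': "x \<in> realization_points X' \<longleftrightarrow> (\<forall>u. 0 \<le> x u) \<and> {u. x u \<noteq> 0} \<in> X' \<and> sum x (insert v V) = 1" for x
    by (rule mem_realization_points[OF finV]) (use FV in \<open>auto simp: V_def X'_def\<close>)
  have s_le: "s x \<le> x u" if "u \<in> F" for x u
    using fF that by (auto simp: s_def)
  have s_nn: "0 \<le> s x" if "\<And>u. 0 \<le> x u" for x
    using fF F that by (auto simp: s_def)
  have s_add: "s y = s x + c" if "\<And>u. u \<in> F \<Longrightarrow> y u = x u + c" for x y c
  proof -
    have "y ` F = (\<lambda>u. x u + c) ` F" using that by auto
    then show ?thesis using Min_image_add[OF fF F(3), of x c] by (simp add: s_def)
  qed
  have sum_f: "sum (f x) (insert v V) = sum x (insert v V)" for x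
  proof -
    have "sum (f x) F = (\<Sum>u\<in>F. x u + (x v / n - s x / 2))"
      using vF F by (intro sum.cong) (auto simp: f_def)
    moreover have "sum (f x) (V - insert w F) = sum x (V - insert w F)"
      using vF by (intro sum.cong) (auto simp: f_def)
    ultimately show ?thesis using npos vF unfolding split
      by (simp add: f_def sum.distrib right_diff_distrib flip: n_def)
  qed
  have sum_g: "sum (g x) (insert v V) = sum x (insert v V)" if "x v = 0" for x
  proof -
    have "sum (g x) F = (\<Sum>u\<in>F. x u + (min (2 * s x) (2 * x w / n) - s x))"
      using vF F by (intro sum.cong) (auto simp: g_def)
    then have "sum (g x) F = sum x F + n * (min (2 * s x) (2 * x w / n) - s x)"
      by (simp add: sum.distrib flip: n_def)
    also have "\<dots> = sum x F + (min (2 * n * s x) (2 * x w) - n * s x)"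
      using npos by (simp add: min_def field_simps)
    finally have "sum (g x) F = sum x F + (min (2 * n * s x) (2 * x w) - n * s x)" .
    moreover have "sum (g x) (V - insert w F) = sum x (V - insert w F)"
      using vF by (intro sum.cong) (auto simp: g_def)
    ultimately show ?thesis using vF that unfolding split
      by (simp add: g_def min_def max_def)
  qed
  have cs: "continuous_on A s" for A
    unfolding s_def using fF F
    by (intro continuous_on_Min_image continuous_on_coordinate) auto
  have nz: "n \<noteq> 0" using npos by simp
  have "homeomorphism (realization_points X') (realization_points X) f g"
  proof (rule homeomorphismI)
    show "continuous_on (realization_points X') f"
      unfolding f_def by (intro coordinatewise_intros cs) (use nz in auto)
    show "continuous_on (realization_points X) g"
      unfolding g_def by (intro coordinatewise_intros cs) (use nz in auto)
    show "f ` realization_points X' \<subseteq> realization_points X"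
    proof clarify
      fix x assume x: "x \<in> realization_points X'"
      let ?S = "{u. x u \<noteq> 0}"
      have nn: "\<And>u. 0 \<le> x u" and S: "?S \<in> X'" using x mem' by auto
      have "{u. f x u \<noteq> 0} \<in> X"
      proof (cases "x v = 0 \<and> s x = 0")
        case True
        then have "f x = x" by (auto simp: f_def)
        moreover have "?S \<in> X"
        proof (cases "?S \<in> X")
          case False
          then have "?S \<subseteq> insert w F" using S True by (auto simp: X'_def)
          then show ?thesis using down F by blast
        qed
        ultimately show ?thesis by simp
      next
        case False
        have "?S \<subseteq> insert v (insert w F)"
        proof (cases "?S \<in> X")
          case True
          then have "x v = 0" using v by auto
          then have "s x > 0" using False s_nn[of x] nn by auto
          then have "F \<subseteq> ?S" using s_le[of _ x] by force
          then show ?thesis using free[OF True] by auto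
        next
          case False
          then show ?thesis using S by (auto simp: X'_def)
        qed
        then have "{u. f x u \<noteq> 0} \<subseteq> insert w F" by (auto simp: f_def)
        then show ?thesis using down F by blast
      qed
      moreover have "0 \<le> f x u" for u
      proof -
        have "0 \<le> x v / n" "0 \<le> n * s x / 2" using nn[of v] npos s_nn[of x, OF nn] by auto
        moreover have "0 \<le> x u - s x / 2" if "u \<in> F" using s_nn[of x, OF nn] s_le[OF that, of x] by simp
        ultimately show ?thesis using nn by (simp add: f_def)
      qed
      ultimately show "f x \<in> realization_points X" using x by (simp add: mem mem' sum_f)
    qed
    have xv: "x v = 0" if "x \<in> realization_points X" for x using that v by (auto simp: mem)
    show "g ` realization_points X \<subseteq> realization_points X'"
    proof clarify
      fix x assume x: "x \<in> realization_points X"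
      let ?S = "{u. x u \<noteq> 0}"
      have nn: "\<And>u. 0 \<le> x u" and S: "?S \<in> X" using x mem by auto
      have s0: "0 \<le> s x" using s_nn nn by simp
      have "{u. g x u \<noteq> 0} \<in> X'"
      proof (cases "s x = 0")
        case True
        then have "g x = x" using xv[OF x] nn[of w] npos by (auto simp: g_def)
        then show ?thesis using S by (auto simp: X'_def)
      next
        case False
        have "F \<subseteq> ?S" using s_le[of _ x] s0 False by force
        then have S': "?S \<subseteq> insert w F" using free[OF S] by simp
        show ?thesis
        proof (cases "n * s x \<le> x w")
          case True
          then have "{u. g x u \<noteq> 0} \<subseteq> insert w F" using S' by (auto simp: g_def)
          then show ?thesis using down F unfolding X'_def by blast
        next
          case False
          then have "{u. g x u \<noteq> 0} \<subseteq> insert v F" using S' by (auto simp: g_def)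
          then show ?thesis unfolding X'_def by blast
        qed
      qed
      moreover have "0 \<le> g x u" for u using nn[of u] nn[of w] s_le[of u x] s0 npos by (simp add: g_def)
      ultimately show "g x \<in> realization_points X'" using x xv[OF x] by (simp add: mem mem' sum_g)
    qed
    show "f (g x) = x" if "x \<in> realization_points X" for x
    proof -
      have "s (g x) = s x + (min (2 * s x) (2 * x w / n) - s x)"
        using vF F by (intro s_add) (auto simp: g_def)
      then have sg: "s (g x) = min (2 * s x) (2 * x w / n)" by simp
      show ?thesis
      proof
        fix u
        consider "u = v" | "u = w" | "u \<in> F" "u \<noteq> w" "u \<noteq> v" | "u \<noteq> v" "u \<noteq> w" "u \<notin> F" by blast
        then show "f (g x) u = x u"
        proof cases
          case 2
          then show ?thesis using vF npos by (simp add: f_def sg) (simp add: g_def min_def max_def field_simps)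
        next
          case 3
          then show ?thesis using vF npos by (simp add: f_def sg) (simp add: g_def min_def max_def field_simps)
        qed (use xv[OF that] in \<open>simp_all add: f_def g_def\<close>)
      qed
    qed
    show "g (f x) = x" if x: "x \<in> realization_points X'" for x
    proof -
      have nn: "\<And>u. 0 \<le> x u" and S: "{u. x u \<noteq> 0} \<in> X'" using x mem' by auto
      have "s (f x) = s x + (x v / n - s x / 2)"
        using vF F by (intro s_add) (auto simp: f_def)
      then have sf: "s (f x) = s x / 2 + x v / n" by simp
      have "x v = 0 \<or> x w = 0" using S v F vF by (auto simp: X'_def)
      then show ?thesis
      proof
        assume 0: "x v = 0"
        show ?thesis
          by (rule ext, unfold g_def sf) (use 0 vF npos nn[of w] in \<open>auto simp: f_def min_def max_def field_simps\<close>)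
      next
        assume 0: "x w = 0"
        show ?thesis
          by (rule ext, unfold g_def sf) (use 0 vF npos nn[of v] in \<open>auto simp: f_def min_def max_def field_simps\<close>)
      qed
    qed
  qed
  then show ?thesis
    unfolding geometric_realization_eq X'_def by (intro homeomorphic_space_top_of_set) (auto simp: homeomorphic_def)
qed

text \<open>
  The radial map that carries the ball of the gauge \<open>p\<close> to the ball of the gauge \<open>q\<close>. At the origin
  \<open>0 / 0 = 0\<close> gives the right value.
\<close>

definition rescale :: "((nat \<Rightarrow> real) \<Rightarrow> real) \<Rightarrow> ((nat \<Rightarrow> real) \<Rightarrow> real) \<Rightarrow> (nat \<Rightarrow> real) \<Rightarrow> nat \<Rightarrow> real" where
  "rescale p q x = (\<lambda>i. p x / q x * x i)"

text \<open>
  A positively homogeneous continuous function, positive away from the origin. The last condition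
  gives the continuity of radial rescaling at the origin.
\<close>

definition gauge_on :: "(nat \<Rightarrow> real) set \<Rightarrow> ((nat \<Rightarrow> real) \<Rightarrow> real) \<Rightarrow> bool" where
  "gauge_on E p \<longleftrightarrow> continuous_on E p \<and>
     (\<forall>x\<in>E. \<forall>t\<ge>0. p (\<lambda>i. t * x i) = t * p x) \<and>
     (\<forall>x\<in>E. x \<noteq> (\<lambda>_. 0) \<longrightarrow> 0 < p x) \<and>
     (\<exists>C. \<forall>x\<in>E. \<forall>i. \<bar>x i\<bar> \<le> C * p x)"

lemma gauge_on_scale: "gauge_on E p \<Longrightarrow> x \<in> E \<Longrightarrow> 0 \<le> t \<Longrightarrow> p (\<lambda>i. t * x i) = t * p x"
  by (simp add: gauge_on_def)

lemma gauge_on_zero: "gauge_on E p \<Longrightarrow> (\<lambda>_. 0) \<in> E \<Longrightarrow> p (\<lambda>_. 0) = 0"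
  using gauge_on_scale[of E p "\<lambda>_. 0" 0] by simp

lemma continuous_on_rescale:
  assumes p: "gauge_on E p" and q: "gauge_on E q" and z: "(\<lambda>_. 0) \<in> E"
  shows "continuous_on E (rescale p q)"
proof (rule continuous_on_coordinatewise_then_product)
  fix i
  have cp: "continuous_on E p" and cq: "continuous_on E q" using p q by (auto simp: gauge_on_def)
  have ci: "continuous_on E (\<lambda>x. x i)" by (rule continuous_on_coordinate)
  have "\<exists>C. \<forall>x\<in>E. \<forall>i. \<bar>x i\<bar> \<le> C * q x" using q by (simp add: gauge_on_def)
  then obtain C where C: "\<And>x i. x \<in> E \<Longrightarrow> \<bar>x i\<bar> \<le> C * q x" by blast
  have p0: "p (\<lambda>_. 0) = 0" using gauge_on_zero[OF p z] .
  have pnn: "0 \<le> p x" if "x \<in> E" for x using p that p0 unfolding gauge_on_def by (cases "x = (\<lambda>_. 0)") force+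
  have qpos: "0 < q x" if "x \<in> E" "x \<noteq> (\<lambda>_. 0)" for x using q that unfolding gauge_on_def by blast
  show "continuous_on E (\<lambda>x. rescale p q x i)"
    unfolding continuous_on_def
  proof
    fix x assume x: "x \<in> E"
    have tp: "(p \<longlongrightarrow> p x) (at x within E)" and tq: "(q \<longlongrightarrow> q x) (at x within E)"
      and ti: "((\<lambda>x. x i) \<longlongrightarrow> x i) (at x within E)"
      using cp cq ci x by (auto simp: continuous_on_def)
    show "((\<lambda>x. rescale p q x i) \<longlongrightarrow> rescale p q x i) (at x within E)"
    proof (cases "x = (\<lambda>_. 0)")
      case False
      then have "q x \<noteq> 0" using qpos[OF x] by simp
      then show ?thesis unfolding rescale_def by (intro tendsto_intros tp tq ti)
    next
      case True
      have bound: "\<bar>rescale p q y i\<bar> \<le> C * p y" if "y \<in> E" for y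
      proof (cases "y = (\<lambda>_. 0)")
        case True
        then show ?thesis by (simp add: rescale_def p0)
      next
        case False
        have "\<bar>rescale p q y i\<bar> = p y / q y * \<bar>y i\<bar>"
          using pnn[OF that] qpos[OF that False] by (simp add: rescale_def abs_mult)
        also have "\<dots> \<le> p y / q y * (C * q y)"
          using pnn[OF that] qpos[OF that False] C[OF that] by (intro mult_left_mono) auto
        finally show ?thesis using qpos[OF that False] by (simp add: mult.commute)
      qed
      have "((\<lambda>y. C * p y) \<longlongrightarrow> 0) (at x within E)"
        using tendsto_mult_left[OF tp, of C] True p0 by simp
      then have "((\<lambda>y. rescale p q y i) \<longlongrightarrow> 0) (at x within E)"
        by (rule Lim_null_comparison[rotated]) (use bound in \<open>auto simp: eventually_at_filter\<close>)
      then show ?thesis using True by (simp add: rescale_def)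
    qed
  qed
qed

lemma rescale_gauge:
  assumes p: "gauge_on E p" and q: "gauge_on E q" and x: "x \<in> E" and z: "(\<lambda>_. 0) \<in> E"
  shows "q (rescale p q x) = p x" "p x \<ge> 0" "rescale q p (rescale p q x) = x"
proof -
  have p0: "p (\<lambda>_. 0) = 0" "q (\<lambda>_. 0) = 0" using gauge_on_zero[OF _ z] p q by auto
  have *: "q (rescale p q x) = p x \<and> p x \<ge> 0 \<and> rescale q p (rescale p q x) = x"
  proof (cases "x = (\<lambda>_. 0)")
    case True
    then show ?thesis by (simp add: rescale_def p0)
  next
    case False
    have px: "p x > 0" "q x > 0" using False x p q by (auto simp: gauge_on_def)
    then have "q (rescale p q x) = p x / q x * q x" "p (rescale p q x) = p x / q x * p x"
      unfolding rescale_def using px gauge_on_scale[OF p x, of "p x / q x"] gauge_on_scale[OF q x, of "p x / q x"] by auto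
    then have "q (rescale p q x) = p x" "p (rescale p q x) = p x / q x * p x" using px by auto
    then show ?thesis using px by (auto simp: rescale_def[of q p] rescale_def)
  qed
  then show "q (rescale p q x) = p x" "p x \<ge> 0" "rescale q p (rescale p q x) = x" by auto
qed

lemma gauge_balls_homeomorphic:
  assumes p: "gauge_on E p" and q: "gauge_on E q" and z: "(\<lambda>_. 0) \<in> E"
    and E: "\<And>x t. x \<in> E \<Longrightarrow> (\<lambda>i. t * x i) \<in> E"
  shows "{x \<in> E. p x \<le> 1} homeomorphic {x \<in> E. q x \<le> 1}"
proof -
  have mem: "rescale p q x \<in> E" if "x \<in> E" for p q x unfolding rescale_def by (rule E[OF that])
  have "homeomorphism {x \<in> E. p x \<le> 1} {x \<in> E. q x \<le> 1} (rescale p q) (rescale q p)"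
  proof (rule homeomorphismI)
    show "continuous_on {x \<in> E. p x \<le> 1} (rescale p q)"
      by (rule continuous_on_subset[OF continuous_on_rescale[OF p q z]]) auto
    show "continuous_on {x \<in> E. q x \<le> 1} (rescale q p)"
      by (rule continuous_on_subset[OF continuous_on_rescale[OF q p z]]) auto
    show "rescale p q ` {x \<in> E. p x \<le> 1} \<subseteq> {x \<in> E. q x \<le> 1}"
      using rescale_gauge[OF p q _ z] mem by auto
    show "rescale q p ` {x \<in> E. q x \<le> 1} \<subseteq> {x \<in> E. p x \<le> 1}"
      using rescale_gauge[OF q p _ z] mem by auto
  qed (use rescale_gauge[OF q p _ z] rescale_gauge[OF p q _ z] in auto)
  then show ?thesis by (auto simp: homeomorphic_def)
qed

lemma gauge_on_euclidean:
  "gauge_on {x. \<forall>i\<ge>m. x i = 0} (\<lambda>x. sqrt (\<Sum>i<m. (x i)\<^sup>2))"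
  unfolding gauge_on_def
proof (intro conjI ballI allI impI exI)
  show "continuous_on {x. \<forall>i\<ge>m. x i = 0} (\<lambda>x::nat\<Rightarrow>real. sqrt (\<Sum>i<m. (x i)\<^sup>2))"
    by (intro coordinatewise_intros)
  show "sqrt (\<Sum>i<m. (t * x i)\<^sup>2) = t * sqrt (\<Sum>i<m. (x i)\<^sup>2)" if "0 \<le> t" for t :: real and x :: "nat \<Rightarrow> real"
  proof -
    have "(\<Sum>i<m. (t * x i)\<^sup>2) = t\<^sup>2 * (\<Sum>i<m. (x i)\<^sup>2)" by (simp add: power_mult_distrib sum_distrib_left)
    then show ?thesis using that by (simp add: real_sqrt_mult)
  qed
  show "0 < sqrt (\<Sum>i<m. (x i)\<^sup>2)" if x: "x \<in> {x. \<forall>i\<ge>m. x i = 0}" "x \<noteq> (\<lambda>_. 0)" for x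
  proof -
    obtain j where "x j \<noteq> 0" using x(2) by (auto simp: fun_eq_iff)
    then have "j < m" using x(1) by (cases "j < m") auto
    then have "0 < (\<Sum>i<m. (x i)\<^sup>2)" using \<open>x j \<noteq> 0\<close> by (intro sum_pos2[of _ j]) auto
    then show ?thesis by simp
  qed
  show "\<bar>x i\<bar> \<le> 1 * sqrt (\<Sum>i<m. (x i)\<^sup>2)" if "x \<in> {x. \<forall>i\<ge>m. x i = 0}" for x i
  proof (cases "i < m")
    case True
    then have "(x i)\<^sup>2 \<le> (\<Sum>i<m. (x i)\<^sup>2)" by (intro member_le_sum) auto
    then have "sqrt ((x i)\<^sup>2) \<le> sqrt (\<Sum>i<m. (x i)\<^sup>2)" by (rule real_sqrt_le_mono)
    then show ?thesis by (simp only: real_sqrt_abs mult_1)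
  next
    case False
    then have "x i = 0" using that by simp
    then show ?thesis by (simp add: sum_nonneg)
  qed
qed

text \<open>
  The simplex in \<open>\<real>\<^sup>m\<close> with barycenter at the origin cut out by \<open>x i \<ge> -1\<close> for \<open>i < m\<close> and
  \<open>\<Sum>j<m. x j \<le> 1\<close>. Its facets lie where one of these \<open>m + 1\<close> functionals takes the value \<open>1\<close>.
\<close>

definition facet_functional :: "nat \<Rightarrow> nat \<Rightarrow> (nat \<Rightarrow> real) \<Rightarrow> real" where
  "facet_functional m i x = (if i < m then - x i else \<Sum>j<m. x j)"

definition simplex_gauge :: "nat \<Rightarrow> (nat \<Rightarrow> real) \<Rightarrow> real" where
  "simplex_gauge m x = Max ((\<lambda>i. facet_functional m i x) ` {..m})"

lemma simplex_gauge_le_iff: "simplex_gauge m x \<le> c \<longleftrightarrow> (\<forall>i<m. - x i \<le> c) \<and> (\<Sum>j<m. x j) \<le> c"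
proof -
  have "simplex_gauge m x \<le> c \<longleftrightarrow> (\<forall>i\<in>{..m}. facet_functional m i x \<le> c)"
    by (simp add: simplex_gauge_def)
  also have "{..m} = insert m {..<m}" by auto
  finally show ?thesis by (auto simp: facet_functional_def)
qed

lemma simplex_gauge_ge:
  "i < m \<Longrightarrow> - x i \<le> simplex_gauge m x" "(\<Sum>j<m. x j) \<le> simplex_gauge m x"
  using simplex_gauge_le_iff[of m x "simplex_gauge m x"] by auto

lemma gauge_on_simplex: "gauge_on {x. \<forall>i\<ge>m. x i = 0} (simplex_gauge m)"
  unfolding gauge_on_def
proof (intro conjI ballI allI impI exI)
  show "continuous_on {x. \<forall>i\<ge>m. x i = 0} (simplex_gauge m)"
    unfolding simplex_gauge_def
    by (intro continuous_on_Max_image) (auto simp: facet_functional_def intro!: coordinatewise_intros)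
  show "simplex_gauge m (\<lambda>i. t * x i) = t * simplex_gauge m x" if "0 \<le> t" for t x
  proof -
    have "mono (\<lambda>y::real. t * y)" using that by (auto intro: monoI mult_left_mono)
    from mono_Max_commute[OF this, of "(\<lambda>i. facet_functional m i x) ` {..m}"]
    have "t * simplex_gauge m x = Max ((\<lambda>i. t * facet_functional m i x) ` {..m})"
      by (simp add: simplex_gauge_def image_image)
    moreover have "t * facet_functional m i x = facet_functional m i (\<lambda>i. t * x i)" for i
      by (simp add: facet_functional_def sum_distrib_left)
    ultimately show ?thesis by (simp add: simplex_gauge_def)
  qed
  show pos: "0 < simplex_gauge m x" if "x \<in> {x. \<forall>i\<ge>m. x i = 0}" "x \<noteq> (\<lambda>_. 0)" for x
  proof (rule ccontr)
    assume "\<not> 0 < simplex_gauge m x"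
    then have *: "(\<forall>i<m. 0 \<le> x i) \<and> (\<Sum>j<m. x j) \<le> 0"
      using simplex_gauge_le_iff[of m x 0] by auto
    then have "(\<Sum>j<m. x j) = 0" by (meson order_antisym sum_nonneg lessThan_iff)
    then have "\<forall>i<m. x i = 0" using * by (subst (asm) sum_nonneg_eq_0_iff) auto
    then have "x i = 0" for i using that(1) by (cases "i < m") auto
    then have "x = (\<lambda>_. 0)" by (simp add: fun_eq_iff)
    then show False using that by simp
  qed
  show "\<bar>x i\<bar> \<le> real (m + 1) * simplex_gauge m x" if x: "x \<in> {x. \<forall>i\<ge>m. x i = 0}" for x i
  proof -
    let ?p = "simplex_gauge m x"
    have p0: "0 \<le> ?p"
    proof (cases "x = (\<lambda>_. 0)")
      case True
      then show ?thesis using simplex_gauge_ge(2)[of x m] by simp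
    next
      case False
      then show ?thesis using pos[OF x] by simp
    qed
    show ?thesis
    proof (cases "i < m")
      case True
      have "(\<Sum>j<m. x j) = x i + (\<Sum>j\<in>{..<m} - {i}. x j)" using True sum.remove[of "{..<m}" i x] by simp
      moreover have "(\<Sum>j\<in>{..<m} - {i}. - x j) \<le> (\<Sum>j\<in>{..<m} - {i}. ?p)"
        by (rule sum_mono) (simp add: simplex_gauge_ge(1))
      moreover have "(\<Sum>j\<in>{..<m} - {i}. ?p) = real (m - 1) * ?p"
        using True by simp
      moreover have "real (m - 1) * ?p \<le> real m * ?p"
        by (rule mult_right_mono) (use p0 in auto)
      ultimately have "x i \<le> ?p + real m * ?p"
        using simplex_gauge_ge(2)[of x m] unfolding sum_negf by linarith
      moreover have "0 \<le> real m * ?p" using p0 by simp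
      then have "- x i \<le> ?p + real m * ?p"
        using simplex_gauge_ge(1)[OF True, of x] by linarith
      ultimately have "\<bar>x i\<bar> \<le> ?p + real m * ?p" by linarith
      then show ?thesis by (simp only: of_nat_add of_nat_1 distrib_right mult_1 add.commute)
    next
      case False
      then have "x i = 0" using x by simp
      then show ?thesis using p0 by simp
    qed
  qed
qed

lemma Euclidean_ball_eq:
  "Euclidean_ball m = top_of_set {x \<in> {x. \<forall>i\<ge>m. x i = 0}. sqrt (\<Sum>i<m. (x i)\<^sup>2) \<le> 1}"
proof -
  have "{x. \<forall>i\<ge>m. x i = 0} \<inter> {x. (\<Sum>i<m. (x i)\<^sup>2) \<le> 1} =
      {x \<in> {x. \<forall>i\<ge>m. x i = 0}. sqrt (\<Sum>i<m. (x i :: real)\<^sup>2) \<le> 1}" by auto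
  then show ?thesis
    by (simp add: Euclidean_ball_def Euclidean_space_def euclidean_product_topology subtopology_subtopology)
qed

lemma simplex_homeomorphic_gauge_ball:
  "realization_points (Pow {..m}) homeomorphic {x \<in> {x. \<forall>i\<ge>m. x i = 0}. simplex_gauge m x \<le> 1}"
    (is "?R homeomorphic ?B")
proof -
  let ?n = "real m + 1"
  \<comment> \<open>drop the last barycentric coordinate and move the barycenter to the origin\<close>
  define f where "f x = (\<lambda>i. if i < m then ?n * x i - 1 else 0)" for x :: "nat \<Rightarrow> real"
  define g where "g y = (\<lambda>i. if i < m then (y i + 1) / ?n else
      if i = m then (1 - (\<Sum>j<m. y j)) / ?n else 0)" for y :: "nat \<Rightarrow> real"
  have mem: "x \<in> ?R \<longleftrightarrow> (\<forall>u. 0 \<le> x u) \<and> (\<forall>i>m. x i = 0) \<and> (\<Sum>j<m. x j) + x m = 1" for x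
  proof -
    have "sum x {..m} = (\<Sum>j<m. x j) + x m" by (simp flip: lessThan_Suc_atMost)
    moreover have "{u. x u \<noteq> 0} \<in> Pow {..m} \<longleftrightarrow> (\<forall>i>m. x i = 0)"
      using not_le by (auto simp: subset_iff)
    ultimately show ?thesis by (subst mem_realization_points[of "{..m}"]) auto
  qed
  have sum_f: "(\<Sum>j<m. f x j) = ?n * (\<Sum>j<m. x j) - m" for x
    by (simp add: f_def sum_subtractf sum_distrib_left)
  have sum_g: "(\<Sum>j<m. g y j) = ((\<Sum>j<m. y j) + m) / ?n" for y
    by (simp add: g_def sum.distrib flip: sum_divide_distrib)
  have "homeomorphism ?R ?B f g"
  proof (rule homeomorphismI)
    show "continuous_on ?R f"
      unfolding f_def by (intro coordinatewise_intros)
    show "continuous_on ?B g"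
      unfolding g_def by (intro coordinatewise_intros) auto
    show "f ` ?R \<subseteq> ?B"
    proof (rule image_subsetI)
      fix x assume "x \<in> ?R"
      then have *: "\<And>u. 0 \<le> x u" "(\<Sum>j<m. x j) = 1 - x m" by (auto simp: mem)
      have "(\<Sum>j<m. f x j) \<le> 1" using *(1)[of m] unfolding sum_f *(2) by (simp add: right_diff_distrib)
      moreover have "f x i = 0" if "i \<ge> m" for i using that by (simp add: f_def)
      moreover have "- f x i \<le> 1" if "i < m" for i using that *(1)[of i] by (simp add: f_def)
      ultimately show "f x \<in> ?B" by (simp add: simplex_gauge_le_iff)
    qed
    show "g ` ?B \<subseteq> ?R"
    proof (rule image_subsetI)
      fix y :: "nat \<Rightarrow> real" assume "y \<in> ?B"
      then have *: "\<And>i. i < m \<Longrightarrow> 0 \<le> y i + 1" "(\<Sum>j<m. y j) \<le> 1"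
        by (force simp: simplex_gauge_le_iff)+
      have "(\<Sum>j<m. g y j) + g y m = 1" unfolding sum_g by (simp add: g_def flip: add_divide_distrib)
      moreover have "0 \<le> g y u" for u using * by (simp add: g_def)
      ultimately show "g y \<in> ?R" by (auto simp: mem) (simp add: g_def)
    qed
    show "g (f x) = x" if "x \<in> ?R" for x
    proof
      fix i
      have S: "(\<Sum>j<m. x j) = 1 - x m" and 0: "i > m \<Longrightarrow> x i = 0" using that by (auto simp: mem)
      have "1 - (?n * (1 - x m) - real m) = ?n * x m" by (simp add: algebra_simps)
      then show "g (f x) i = x i"
        unfolding g_def sum_f S using 0 by (simp add: f_def)
    qed
    show "f (g y) = y" if "y \<in> ?B" for y
      using that by (auto simp: f_def g_def fun_eq_iff)
  qed
  then show ?thesis by (auto simp: homeomorphic_def)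
qed

lemma simplicial_ball_simplex: "simplicial_ball m (Pow {..m})"
proof -
  have "realization_points (Pow {..m}) homeomorphic
      {x \<in> {x. \<forall>i\<ge>m. x i = 0}. sqrt (\<Sum>i<m. (x i)\<^sup>2) \<le> 1}"
    using gauge_balls_homeomorphic[OF gauge_on_simplex[of m] gauge_on_euclidean[of m]]
    by (intro homeomorphic_trans[OF simplex_homeomorphic_gauge_ball]) auto
  then show ?thesis
    using homeomorphic_space_top_of_set
    by (auto simp: simplicial_ball_def geometric_realization_eq Euclidean_ball_eq
        abstract_simplicial_complex_def intro: finite_subset)
qed

section \<open>Stacked balls\<close>

text \<open>
  The boundary facets of an \<open>m\<close>-dimensional pseudomanifold \<open>X\<close>.
\<close>

definition free_facets :: "nat \<Rightarrow> 'a set set \<Rightarrow> 'a set set" where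
  "free_facets m X = {F \<in> faces X m. \<exists>!\<tau>. \<tau> \<in> faces X (Suc m) \<and> F \<subseteq> \<tau>}"

lemma free_facets_simplex: "free_facets m (Pow {..m}) = faces (Pow {..m}) m"
  unfolding free_facets_def top_face_simplex by (auto simp: faces_iff)

inductive stacked :: "nat \<Rightarrow> nat set set \<Rightarrow> bool" for m where
  simplex: "stacked m (Pow {..m})"
| stack: "stacked m X \<Longrightarrow> F \<in> free_facets m X \<Longrightarrow> v \<notin> \<Union>X \<Longrightarrow> stacked m (X \<union> Pow (insert v F))"

locale stacking =
  fixes m :: nat and X :: "'a::linorder set set" and F :: "'a set" and v :: 'a
  assumes complex: "abstract_simplicial_complex X"
    and dim: "\<And>\<sigma>. \<sigma> \<in> X \<Longrightarrow> card \<sigma> \<le> Suc m"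
    and free: "F \<in> free_facets m X"
    and fresh: "v \<notin> \<Union>X"
begin

abbreviation "\<tau>' \<equiv> insert v F"
abbreviation "X' \<equiv> X \<union> Pow \<tau>'"
abbreviation "new_facets \<equiv> (\<lambda>x. \<tau>' - {x}) ` F"

lemma F_mem: "F \<in> X" "card F = m" "finite F" "v \<notin> F"
  using free fresh complexD(3)[OF complex] by (auto simp: free_facets_def faces_iff)

lemma card_new: "card \<tau>' = Suc m"
  using F_mem by simp

lemma fresh_face: "\<sigma> \<in> X \<Longrightarrow> v \<notin> \<sigma>"
  using fresh by auto

lemma new_facet_mem: "\<sigma> \<in> new_facets \<Longrightarrow> v \<in> \<sigma>"
  using F_mem by auto

lemma finite_X: "finite X" "finite new_facets"
  using complexD(1)[OF complex] F_mem by auto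

lemma complex': "abstract_simplicial_complex X'"
  using complex F_mem by (intro complex_Un complex_Pow) auto

lemma dim': "\<sigma> \<in> X' \<Longrightarrow> card \<sigma> \<le> Suc m"
  using dim card_new card_mono[of \<tau>' \<sigma>] F_mem by auto

lemma top_faces: "faces X' (Suc m) = insert \<tau>' (faces X (Suc m))"
proof -
  have eq: "\<sigma> = \<tau>'" if "\<sigma> \<subseteq> \<tau>'" "card \<sigma> = Suc m" for \<sigma>
    using that card_new F_mem by (intro card_subset_eq) auto
  show ?thesis using card_new by (auto simp: faces_iff dest: eq)
qed

lemma new_not_old: "\<tau>' \<notin> faces X n" "new_facets \<inter> X = {}"
  using fresh_face F_mem by (auto simp: faces_iff)

lemma facets: "faces X' m = faces X m \<union> new_facets"
proof -
  have "faces X' m = faces X m \<union> faces (Pow \<tau>') m" by (auto simp: faces_iff)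
  also have "faces (Pow \<tau>') m = insert (\<tau>' - {v}) new_facets"
    using facets_of_simplex[OF card_new] by auto
  also have "\<tau>' - {v} = F" using F_mem by auto
  finally show ?thesis using F_mem by (auto simp: faces_iff)
qed

lemma free_facets': "free_facets m X' = free_facets m X - {F} \<union> new_facets"
proof -
  have old: "(\<exists>!\<tau>. \<tau> \<in> faces X' (Suc m) \<and> \<sigma> \<subseteq> \<tau>) \<longleftrightarrow> (\<exists>!\<tau>. \<tau> \<in> faces X (Suc m) \<and> \<sigma> \<subseteq> \<tau>)"
    if "\<sigma> \<in> faces X m" "\<sigma> \<noteq> F" for \<sigma>
  proof -
    have "\<not> \<sigma> \<subseteq> \<tau>'"
    proof
      assume "\<sigma> \<subseteq> \<tau>'"
      then have "\<sigma> \<subseteq> F" using fresh_face that by (auto simp: faces_iff)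
      then have "\<sigma> = F" using F_mem that by (intro card_subset_eq) (auto simp: faces_iff)
      then show False using that by simp
    qed
    then have "(\<tau> \<in> faces X' (Suc m) \<and> \<sigma> \<subseteq> \<tau>) \<longleftrightarrow> (\<tau> \<in> faces X (Suc m) \<and> \<sigma> \<subseteq> \<tau>)" for \<tau>
      unfolding top_faces by blast
    then show ?thesis by (simp only:)
  qed
  have gone: "\<not> (\<exists>!\<tau>. \<tau> \<in> faces X' (Suc m) \<and> F \<subseteq> \<tau>)"
  proof -
    obtain \<tau> where "\<tau> \<in> faces X (Suc m)" "F \<subseteq> \<tau>" using free by (auto simp: free_facets_def)
    moreover have "\<tau> \<noteq> \<tau>'" using new_not_old(1)[of "Suc m"] calculation(1) by metis
    moreover have "\<tau> \<in> faces X' (Suc m)" "\<tau>' \<in> faces X' (Suc m)" "F \<subseteq> \<tau>'"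
      using calculation(1) top_faces by blast+
    ultimately show ?thesis by blast
  qed
  have new: "\<exists>!\<tau>. \<tau> \<in> faces X' (Suc m) \<and> \<sigma> \<subseteq> \<tau>" if "\<sigma> \<in> new_facets" for \<sigma>
  proof (rule ex1I[of _ \<tau>'])
    show "\<tau>' \<in> faces X' (Suc m) \<and> \<sigma> \<subseteq> \<tau>'" using that top_faces by auto
    show "\<tau> = \<tau>'" if "\<tau> \<in> faces X' (Suc m) \<and> \<sigma> \<subseteq> \<tau>" for \<tau>
      using that new_facet_mem[OF \<open>\<sigma> \<in> new_facets\<close>] fresh_face unfolding top_faces by (auto simp: faces_iff)
  qed
  have F_new: "F \<notin> new_facets" using F_mem new_facet_mem by auto
  show ?thesis
  proof (rule set_eqI)
    fix \<sigma>
    have mem': "\<sigma> \<in> free_facets m X' \<longleftrightarrow>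
        (\<sigma> \<in> faces X m \<or> \<sigma> \<in> new_facets) \<and> (\<exists>!\<tau>. \<tau> \<in> faces X' (Suc m) \<and> \<sigma> \<subseteq> \<tau>)"
      by (simp only: free_facets_def facets mem_Collect_eq Un_iff)
    have mem: "\<sigma> \<in> free_facets m X \<longleftrightarrow>
        \<sigma> \<in> faces X m \<and> (\<exists>!\<tau>. \<tau> \<in> faces X (Suc m) \<and> \<sigma> \<subseteq> \<tau>)"
      by (simp only: free_facets_def mem_Collect_eq)
    show "\<sigma> \<in> free_facets m X' \<longleftrightarrow> \<sigma> \<in> free_facets m X - {F} \<union> new_facets"
    proof (cases "\<sigma> \<in> new_facets")
      case True
      then show ?thesis unfolding mem' using new[OF True] by blast
    next
      case not_new: False
      show ?thesis
      proof (cases "\<sigma> = F \<or> \<sigma> \<notin> faces X m")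
        case True
        then have "\<sigma> \<notin> free_facets m X'" unfolding mem' using gone not_new by metis
        moreover have "\<sigma> \<notin> free_facets m X - {F}" unfolding free_facets_def using True by blast
        ultimately show ?thesis using not_new by blast
      next
        case False
        then have \<sigma>: "\<sigma> \<in> faces X m" "\<sigma> \<noteq> F" by auto
        have "\<sigma> \<in> free_facets m X' \<longleftrightarrow> \<sigma> \<in> free_facets m X"
          unfolding mem mem' old[OF \<sigma>] using \<sigma>(1) by (simp only: simp_thms)
        then show ?thesis using not_new False by blast
      qed
    qed
  qed
qed

text \<open>
  Extends a cochain to the facets of the new simplex. With the incidence number as a factor,
  \<open>c\<close> is the amount of flow leaving through each new facet (\<open>cobd_extend_new\<close>).
\<close>

definition extend :: "('a set \<Rightarrow> 'f::field) \<Rightarrow> ('a set \<Rightarrow> 'f) \<Rightarrow> 'a set \<Rightarrow> 'f" where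
  "extend f c \<rho> = (if v \<in> \<rho> then boundary_coeff \<tau>' \<rho> * c \<rho> else f \<rho>)"

lemma cobd_extend_old: "\<tau> \<in> X \<Longrightarrow> cobd (extend f c) \<tau> = cobd f \<tau>"
  using fresh_face by (intro cobd_cong) (auto simp: extend_def)

lemma cobd_extend_new:
  "cobd (extend f c) \<tau>' = face_sign \<tau>' v * f F + (\<Sum>x\<in>F. c (\<tau>' - {x}))"
proof -
  have "cobd (extend f c) \<tau>' = face_sign \<tau>' v * extend f c (\<tau>' - {v}) +
      (\<Sum>x\<in>F. face_sign \<tau>' x * extend f c (\<tau>' - {x}))"
    unfolding cobd_def using F_mem by simp
  moreover have "extend f c (\<tau>' - {v}) = f F" using F_mem by (simp add: extend_def)
  moreover have "face_sign \<tau>' x * extend f c (\<tau>' - {x}) = c (\<tau>' - {x})" if "x \<in> F" for x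
  proof -
    have "v \<in> \<tau>' - {x}" using that F_mem by auto
    then show ?thesis using that boundary_coeff_face[of x \<tau>', where ?'b = 'b] by (simp add: extend_def del: Diff_iff)
  qed
  ultimately show ?thesis by simp
qed

end

lemma stacked_complex:
  assumes "stacked m X"
  shows "abstract_simplicial_complex X" "\<sigma> \<in> X \<Longrightarrow> card \<sigma> \<le> Suc m" "{..m} \<in> X"
proof -
  have "abstract_simplicial_complex X \<and> (\<forall>\<sigma>\<in>X. card \<sigma> \<le> Suc m) \<and> {..m} \<in> X"
    using assms
  proof induction
    case simplex
    have "card \<sigma> \<le> Suc m" if "\<sigma> \<subseteq> {..m}" for \<sigma> using card_mono[OF _ that] by simp
    then show ?case using complex_Pow[of "{..m}"] by auto
  next
    case (stack X F v)
    then interpret stacking m X F v by unfold_locales auto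
    show ?case using stack complex' dim' by auto
  qed
  then show "abstract_simplicial_complex X" "\<sigma> \<in> X \<Longrightarrow> card \<sigma> \<le> Suc m" "{..m} \<in> X" by auto
qed

lemma stacked_stacking:
  assumes "stacked m X" "F \<in> free_facets m X" "v \<notin> \<Union>X"
  shows "stacking m X F v"
  using assms stacked_complex by unfold_locales auto

lemma stacked_exact:
  assumes "stacked m X" "m \<ge> 1"
  shows "exact_at TYPE('f::field) X n"
  using assms(1)
proof induction
  case simplex
  show ?case by (rule exact_at_simplex[of _ 0]) auto
next
  case (stack X F v)
  then interpret stacking m X F v by (intro stacked_stacking)
  have "F \<noteq> {}" using F_mem assms by auto
  then obtain w where w: "w \<in> F" by auto
  show ?case
  proof (rule exact_at_attach[OF complex stack.IH, of _ w])
    fix \<rho> assume "\<rho> \<in> X" "\<rho> \<subseteq> \<tau>'"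
    then have "insert w \<rho> \<subseteq> F" using w fresh_face by auto
    then show "insert w \<rho> \<in> X" using complexD(4)[OF complex] F_mem by blast
  qed (use w F_mem in auto)
qed

text \<open>
  All of the surplus of a new simplex leaves through a single one of its new facets.
\<close>

lemma stacked_filling:
  assumes "stacked m X" "m \<ge> 1"
  shows "\<exists>f :: nat set \<Rightarrow> 'f::field. \<forall>\<tau>\<in>faces X (Suc m). cobd f \<tau> = w \<tau>"
  using assms(1)
proof induction
  case simplex
  let ?T = "{..m}"
  define f :: "nat set \<Rightarrow> 'f" where "f \<rho> = (if \<rho> = ?T - {0} then face_sign ?T 0 * w ?T else 0)" for \<rho>
  have "cobd f ?T = face_sign ?T 0 * f (?T - {0})"
    by (intro cobd_single) (auto simp: f_def)
  then have "cobd f ?T = w ?T" by (simp add: f_def)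
  then show ?case unfolding top_face_simplex by blast
next
  case (stack X F v)
  then interpret stacking m X F v by (intro stacked_stacking)
  obtain f :: "nat set \<Rightarrow> 'f" where f: "\<And>\<tau>. \<tau> \<in> faces X (Suc m) \<Longrightarrow> cobd f \<tau> = w \<tau>"
    using stack.IH by auto
  have "F \<noteq> {}" using F_mem assms by auto
  then obtain y where y: "y \<in> F" by auto
  define c where "c \<rho> = (if \<rho> = \<tau>' - {y} then w \<tau>' - face_sign \<tau>' v * f F else 0)" for \<rho>
  have "(\<Sum>x\<in>F. c (\<tau>' - {x})) = (\<Sum>x\<in>F. if x = y then w \<tau>' - face_sign \<tau>' v * f F else 0)"
    using y by (intro sum.cong) (auto simp: c_def)
  also have "\<dots> = w \<tau>' - face_sign \<tau>' v * f F" using y F_mem by simp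
  finally have "cobd (extend f c) \<tau>' = w \<tau>'" by (simp add: cobd_extend_new)
  moreover have "cobd (extend f c) \<tau> = w \<tau>" if "\<tau> \<in> faces X (Suc m)" for \<tau>
    using f[OF that] that by (simp add: cobd_extend_old faces_iff)
  ultimately show ?case unfolding top_faces by blast
qed

lemma square_diff_weighted:
  fixes a b s :: real
  assumes "s > 0"
  shows "(a - b)\<^sup>2 \<le> (1 + 1 / s) * a\<^sup>2 + (1 + s) * b\<^sup>2"
proof -
  have "0 \<le> (a + s * b)\<^sup>2 / s" using assms by simp
  also have "(a + s * b)\<^sup>2 / s = a\<^sup>2 / s + 2 * a * b + s * b\<^sup>2"
    using assms by (simp add: power2_eq_square field_simps)
  finally show ?thesis using assms by (simp add: power2_eq_square algebra_simps)
qed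

text \<open>
  Each simplex passes its own source \<open>w \<tau>\<close> and the flow \<open>b\<close> that it receives through \<open>F\<close> on to its \<open>m\<close> new
  facets in equal parts, at the cost of \<open>(w \<tau> - b)\<^sup>2 / m\<close>. When \<open>F\<close> stops being a boundary facet, the
  weight \<open>2 m\<close> of its energy drops to \<open>m - 1\<close>, and the \<open>(m + 1) b\<^sup>2\<close> gained in this way pays for the part of
  the new energy \<open>2 (w \<tau> - b)\<^sup>2\<close> that is caused by \<open>b\<close>. Hence the bound survives every stacking.
\<close>

lemma stacked_filling_energy:
  fixes w :: "nat set \<Rightarrow> real"
  assumes "stacked m X" "m > 1"
  shows "\<exists>f. (\<forall>\<tau>\<in>faces X (Suc m). cobd f \<tau> = w \<tau>) \<and>
    (real m - 1) * energy (faces X m) f + (real m + 1) * energy (free_facets m X) f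
    \<le> 2 * (real m + 1) / (real m - 1) * energy (faces X (Suc m)) w"
  using assms(1)
proof induction
  case simplex
  let ?T = "{..m}"
  have T: "card ?T = Suc m" by simp
  note top = top_face_simplex[of m] and free = free_facets_simplex[of m]
  define c where "c = w ?T / (real m + 1)"
  define f where "f \<rho> = boundary_coeff ?T \<rho> * c" for \<rho>
  have fT: "f (?T - {x}) = face_sign ?T x * c" if "x \<in> ?T" for x
    using that by (simp add: f_def boundary_coeff_face)
  have "cobd f ?T = (\<Sum>x\<in>?T. c)" unfolding cobd_def using fT by (intro sum.cong) auto
  also have "\<dots> = w ?T" unfolding c_def by (simp add: field_simps)
  finally have cob: "cobd f ?T = w ?T" .
  have "energy (faces (Pow ?T) m) f = (\<Sum>x\<in>?T. (f (?T - {x}))\<^sup>2)"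
    unfolding facets_of_simplex[OF T] by (simp only: sum.reindex[OF inj_on_remove] o_def)
  also have "\<dots> = (\<Sum>x\<in>?T. c\<^sup>2)" using fT by (intro sum.cong) (auto simp: power_mult_distrib)
  finally have S: "energy (faces (Pow ?T) m) f = (real m + 1) * c\<^sup>2" by simp
  have "(real m - 1) * ((real m + 1) * c\<^sup>2) + (real m + 1) * ((real m + 1) * c\<^sup>2) =
      2 * real m / (real m + 1) * (w ?T)\<^sup>2"
  proof -
    define n where "n = real m + 1"
    have n: "real m = n - 1" "n > 0" by (simp_all add: n_def)
    have w: "w ?T = n * c" using n by (simp add: c_def flip: n_def)
    have "2 * (n - 1) / n * (n * c)\<^sup>2 = 2 * (n - 1) * (n * c\<^sup>2)"
      using n(2) by (simp add: power2_eq_square)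
    then show ?thesis unfolding w n by (simp add: algebra_simps)
  qed
  also have "\<dots> \<le> 2 * (real m + 1) / (real m - 1) * (w ?T)\<^sup>2"
  proof (rule mult_right_mono)
    show "2 * real m / (real m + 1) \<le> 2 * (real m + 1) / (real m - 1)"
      using assms by (intro frac_le) auto
  qed simp
  finally show ?case using cob unfolding free top S by (intro exI[of _ f]) (simp add: S)
next
  case (stack X F v)
  then interpret stacking m X F v by (intro stacked_stacking)
  obtain f where f: "\<And>\<tau>. \<tau> \<in> faces X (Suc m) \<Longrightarrow> cobd f \<tau> = w \<tau>"
    and energy: "(real m - 1) * energy (faces X m) f + (real m + 1) * energy (free_facets m X) f
      \<le> 2 * (real m + 1) / (real m - 1) * energy (faces X (Suc m)) w"
    using stack.IH by auto
  define b where "b = face_sign \<tau>' v * f F"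
  define c where "c = (w \<tau>' - b) / real m"
  define g where "g = extend f (\<lambda>_. c)"
  have m0: "real m > 1" using assms by simp
  have cob': "cobd g \<tau>' = w \<tau>'"
    using F_mem m0 by (simp add: g_def cobd_extend_new b_def c_def)
  have cob: "cobd g \<tau> = w \<tau>" if "\<tau> \<in> faces X (Suc m)" for \<tau>
    using f[OF that] that by (simp add: g_def cobd_extend_old faces_iff)
  have g_old: "g \<sigma> = f \<sigma>" if "\<sigma> \<in> X" for \<sigma> using fresh_face[OF that] by (simp add: g_def extend_def)
  have g_new: "(g (\<tau>' - {x}))\<^sup>2 = c\<^sup>2" if "x \<in> F" for x
  proof -
    have "v \<in> \<tau>' - {x}" "x \<in> \<tau>'" using that F_mem by auto
    then have "g (\<tau>' - {x}) = face_sign \<tau>' x * c"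
      by (simp add: g_def extend_def boundary_coeff_face del: Diff_iff insert_iff)
    then show ?thesis by (simp add: power_mult_distrib)
  qed
  have "inj_on (\<lambda>x. \<tau>' - {x}) F" by (rule inj_on_subset[OF inj_on_remove]) auto
  then have N: "energy new_facets g = real m * c\<^sup>2"
    using g_new F_mem by (simp add: sum.reindex)
  have E: "energy (faces X' m) g = energy (faces X m) f + real m * c\<^sup>2"
  proof -
    have "energy (faces X' m) g = energy (faces X m) g + energy new_facets g"
    proof -
      have "faces X m \<inter> new_facets = {}" using new_not_old(2) unfolding faces_def by blast
      then show ?thesis unfolding facets using finite_X by (intro sum.union_disjoint) (simp_all add: finite_faces)
    qed
    moreover have "energy (faces X m) g = energy (faces X m) f"
      by (intro sum.cong) (auto simp: g_old faces_iff)
    ultimately show ?thesis using N by simp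
  qed
  have E': "energy (free_facets m X') g = energy (free_facets m X) f - b\<^sup>2 + real m * c\<^sup>2"
  proof -
    have sub: "free_facets m X \<subseteq> X" by (auto simp: free_facets_def faces_iff)
    then have fin: "finite (free_facets m X)" using finite_X finite_subset by blast
    have "energy (free_facets m X') g = energy (free_facets m X - {F}) g + energy new_facets g"
      unfolding free_facets' using finite_X new_not_old fin sub
      by (intro sum.union_disjoint) auto
    moreover have "energy (free_facets m X - {F}) g = energy (free_facets m X - {F}) f"
      using sub by (intro sum.cong) (auto simp: g_old)
    moreover have "energy (free_facets m X) f = (f F)\<^sup>2 + energy (free_facets m X - {F}) f"
      using fin stack.hyps by (intro sum.remove)
    moreover have "b\<^sup>2 = (f F)\<^sup>2" by (simp add: b_def power_mult_distrib)
    ultimately show ?thesis using N by simp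
  qed
  have W: "energy (faces X' (Suc m)) w = (w \<tau>')\<^sup>2 + energy (faces X (Suc m)) w"
    unfolding top_faces using finite_X new_not_old by (simp add: finite_faces)
  have mc: "2 * real m * (real m * c\<^sup>2) = 2 * (w \<tau>' - b)\<^sup>2"
    using m0 by (simp add: c_def power2_eq_square field_simps)
  \<comment> \<open>the choice \<open>s = (m - 1) / 2\<close> makes the coefficient of \<open>b\<^sup>2\<close> equal to half the credit \<open>m + 1\<close>\<close>
  have "(w \<tau>' - b)\<^sup>2 \<le> (1 + 1 / ((real m - 1) / 2)) * (w \<tau>')\<^sup>2 + (1 + (real m - 1) / 2) * b\<^sup>2"
    using m0 by (intro square_diff_weighted) simp
  also have "1 + 1 / ((real m - 1) / 2) = (real m + 1) / (real m - 1)" using m0 by (simp add: field_simps)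
  also have "1 + (real m - 1) / 2 = (real m + 1) / 2" by (simp add: field_simps)
  finally have "(w \<tau>' - b)\<^sup>2 \<le> (real m + 1) / (real m - 1) * (w \<tau>')\<^sup>2 + (real m + 1) / 2 * b\<^sup>2" .
  moreover have "2 * (real m + 1) / (real m - 1) * (w \<tau>')\<^sup>2 = 2 * ((real m + 1) / (real m - 1) * (w \<tau>')\<^sup>2)"
    "(real m + 1) * b\<^sup>2 = 2 * ((real m + 1) / 2 * b\<^sup>2)" by simp_all
  ultimately have "2 * (w \<tau>' - b)\<^sup>2 \<le> 2 * (real m + 1) / (real m - 1) * (w \<tau>')\<^sup>2 + (real m + 1) * b\<^sup>2"
    by linarith
  then have "(real m - 1) * (real m * c\<^sup>2) + (real m + 1) * (real m * c\<^sup>2 - b\<^sup>2)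
      \<le> 2 * (real m + 1) / (real m - 1) * (w \<tau>')\<^sup>2"
    unfolding mc[symmetric] by (simp add: algebra_simps)
  with energy have "(real m - 1) * energy (faces X' m) g + (real m + 1) * energy (free_facets m X') g
      \<le> 2 * (real m + 1) / (real m - 1) * energy (faces X' (Suc m)) w"
    unfolding E E' W by (simp add: algebra_simps)
  moreover have "\<forall>\<tau>\<in>faces X' (Suc m). cobd g \<tau> = w \<tau>" unfolding top_faces using cob cob' by blast
  ultimately show ?case by blast
qed

lemma face_sign_bit: "face_sign \<tau> x = (1 :: bit)"
  by (metis bit_not_zero_iff face_sign_nonzero)

text \<open>
  Modulo 2, interior facets cancel as each of them lies in two \<open>m\<close>-simplexes: the sources inside a
  stacked ball are matched by the flow through its boundary.
\<close>

lemma stacked_boundary_mod2: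
  fixes \<phi> :: "nat set \<Rightarrow> bit"
  assumes "stacked m X"
  shows "(\<Sum>\<tau>\<in>faces X (Suc m). cobd \<phi> \<tau>) = (\<Sum>\<sigma>\<in>free_facets m X. \<phi> \<sigma>)"
  using assms
proof induction
  case simplex
  let ?T = "{..m}"
  have T: "card ?T = Suc m" by simp
  note top = top_face_simplex[of m] and free = free_facets_simplex[of m]
  show ?case
    unfolding free unfolding top facets_of_simplex[OF T]
    by (simp only: sum.reindex[OF inj_on_remove] o_def sum.insert sum.empty finite.emptyI empty_iff
      not_False_eq_True cobd_def face_sign_bit mult_1 add_0_right)
next
  case (stack X F v)
  then interpret stacking m X F v by (intro stacked_stacking)
  have sub: "free_facets m X \<subseteq> X" by (auto simp: free_facets_def faces_iff)
  then have fin: "finite (free_facets m X)" using finite_X finite_subset by blast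
  have inj: "inj_on (\<lambda>x. \<tau>' - {x}) F" by (rule inj_on_subset[OF inj_on_remove]) auto
  have "cobd \<phi> \<tau>' = (\<Sum>x\<in>\<tau>'. \<phi> (\<tau>' - {x}))" by (simp only: cobd_def face_sign_bit mult_1)
  also have "\<dots> = \<phi> (\<tau>' - {v}) + (\<Sum>x\<in>F. \<phi> (\<tau>' - {x}))"
    using F_mem by (intro sum.insert)
  also have "\<tau>' - {v} = F" using F_mem by auto
  also have "(\<Sum>x\<in>F. \<phi> (\<tau>' - {x})) = (\<Sum>\<sigma>\<in>new_facets. \<phi> \<sigma>)" by (simp only: sum.reindex[OF inj] o_def)
  finally have "(\<Sum>\<tau>\<in>faces X' (Suc m). cobd \<phi> \<tau>) =
      (\<phi> F + (\<Sum>\<sigma>\<in>new_facets. \<phi> \<sigma>)) + (\<Sum>\<sigma>\<in>free_facets m X. \<phi> \<sigma>)"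
    unfolding top_faces using finite_X new_not_old stack.IH by (simp add: finite_faces)
  also have "(\<Sum>\<sigma>\<in>free_facets m X. \<phi> \<sigma>) = \<phi> F + (\<Sum>\<sigma>\<in>free_facets m X - {F}. \<phi> \<sigma>)"
    using fin stack.hyps by (intro sum.remove)
  also have "(\<phi> F + (\<Sum>\<sigma>\<in>new_facets. \<phi> \<sigma>)) + (\<phi> F + (\<Sum>\<sigma>\<in>free_facets m X - {F}. \<phi> \<sigma>)) =
      (\<Sum>\<sigma>\<in>free_facets m X - {F}. \<phi> \<sigma>) + (\<Sum>\<sigma>\<in>new_facets. \<phi> \<sigma>)"
  proof -
    have "(a + b) + (a + c) = c + b" for a b c :: bit by (cases a; cases b; cases c) simp_all
    then show ?thesis .
  qed
  also have "\<dots> = (\<Sum>\<sigma>\<in>free_facets m X'. \<phi> \<sigma>)"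
    unfolding free_facets' using finite_X new_not_old fin sub
    by (intro sum.union_disjoint[symmetric]) auto
  finally show ?case .
qed

lemma stack_all_free_facets:
  assumes "stacked m X"
  shows "\<exists>X'. stacked m X' \<and> X \<subseteq> X' \<and> free_facets m X' \<inter> X = {}"
proof -
  have "\<exists>X'. stacked m X' \<and> X \<subseteq> X' \<and> free_facets m X' \<inter> X = {}" if "stacked m Z" "X \<subseteq> Z" for Z
    using that
  proof (induction "card (free_facets m Z \<inter> X)" arbitrary: Z rule: less_induct)
    case less
    show ?case
    proof (cases "free_facets m Z \<inter> X = {}")
      case True
      then show ?thesis using less.prems by blast
    next
      case False
      then obtain F where F: "F \<in> free_facets m Z" "F \<in> X" by blast
      have "finite (\<Union>Z)" using complexD[OF stacked_complex(1)[OF less.prems(1)]] by auto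
      then obtain v where v: "v \<notin> \<Union>Z" using ex_new_if_finite[OF infinite_UNIV_nat] by blast
      interpret stacking m Z F v using stacked_stacking[OF less.prems(1) F(1) v] .
      have "free_facets m X' \<inter> X = free_facets m Z \<inter> X - {F}"
        unfolding free_facets' using new_not_old less.prems(2) by blast
      moreover have "finite (free_facets m Z \<inter> X)"
        using finite_X(1) less.prems(2) finite_subset by blast
      ultimately have "card (free_facets m X' \<inter> X) < card (free_facets m Z \<inter> X)"
        using F by (metis IntI card_Diff1_less)
      moreover have "stacked m X'" using stacked.stack[OF less.prems(1) F(1) v] .
      ultimately show ?thesis using less.hyps[of X'] less.prems(2) by blast
    qed
  qed
  then show ?thesis using assms by blast
qed

text \<open>
  After each round of stacking, the boundary of the ball built so far separates the first simplex
  from the outside. So any flow discharging it uses a facet of each of these boundaries, and they are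
  pairwise disjoint because each of them consists of facets outside the previous ball.
\<close>

lemma stacked_deep:
  "\<exists>X. stacked m X \<and> (\<forall>\<phi> :: nat set \<Rightarrow> bit.
     (\<forall>\<tau>\<in>faces X (Suc m). cobd \<phi> \<tau> = of_bool (\<tau> = {..m})) \<longrightarrow>
     k \<le> card {\<sigma> \<in> faces X m. \<phi> \<sigma> = 1})"
proof (induction k)
  case 0
  then show ?case using stacked.simplex by auto
next
  case (Suc k)
  then obtain X where X: "stacked m X" and deep: "\<And>\<phi> :: nat set \<Rightarrow> bit.
     (\<forall>\<tau>\<in>faces X (Suc m). cobd \<phi> \<tau> = of_bool (\<tau> = {..m})) \<Longrightarrow> k \<le> card {\<sigma> \<in> faces X m. \<phi> \<sigma> = 1}"
    by blast
  obtain X' where X': "stacked m X'" "X \<subseteq> X'" "free_facets m X' \<inter> X = {}"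
    using stack_all_free_facets[OF X] by blast
  have "Suc k \<le> card {\<sigma> \<in> faces X' m. \<phi> \<sigma> = 1}"
    if \<phi>: "\<forall>\<tau>\<in>faces X' (Suc m). cobd \<phi> \<tau> = of_bool (\<tau> = {..m})" for \<phi> :: "nat set \<Rightarrow> bit"
  proof -
    have fin: "finite X'" using complexD[OF stacked_complex(1)[OF X'(1)]] by auto
    have T: "{..m} \<in> faces X' (Suc m)" using stacked_complex(3)[OF X'(1)] by (simp add: faces_iff)
    have "(\<Sum>\<sigma>\<in>free_facets m X'. \<phi> \<sigma>) = (\<Sum>\<tau>\<in>faces X' (Suc m). cobd \<phi> \<tau>)"
      by (rule stacked_boundary_mod2[OF X'(1), symmetric])
    also have "\<dots> = (\<Sum>\<tau>\<in>faces X' (Suc m). if \<tau> = {..m} then 1 else 0)"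
      using \<phi> by (intro sum.cong) auto
    also have "\<dots> = 1" using T fin by (simp add: finite_faces)
    finally obtain F where F: "F \<in> free_facets m X'" "\<phi> F \<noteq> 0"
      by (metis sum.neutral zero_neq_one)
    have "k \<le> card {\<sigma> \<in> faces X m. \<phi> \<sigma> = 1}"
      using \<phi> X'(2) by (intro deep) (auto simp: faces_iff)
    moreover have "card (insert F {\<sigma> \<in> faces X m. \<phi> \<sigma> = 1}) \<le> card {\<sigma> \<in> faces X' m. \<phi> \<sigma> = 1}"
      using fin F X'(2) by (intro card_mono) (auto simp: finite_faces faces_iff free_facets_def)
    moreover have "F \<notin> {\<sigma> \<in> faces X m. \<phi> \<sigma> = 1}" using F X'(3) by (auto simp: faces_iff)
    moreover have "finite {\<sigma> \<in> faces X m. \<phi> \<sigma> = 1}"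
      using finite_subset[OF X'(2) fin] by (simp add: finite_faces)
    ultimately show ?thesis by simp
  qed
  then show ?case using X' by blast
qed

section \<open>Starring and orientations\<close>

definition bdry :: "'a::linorder set set \<Rightarrow> nat \<Rightarrow> ('a set \<Rightarrow> 'f::field) \<Rightarrow> 'a set \<Rightarrow> 'f" where
  "bdry X n u \<sigma> = (\<Sum>\<tau>\<in>faces X (Suc n). boundary_coeff \<tau> \<sigma> * u \<tau>)"

text \<open>
  There is a chain with coefficients \<open>\<plusminus>1\<close> on all \<open>m\<close>-simplexes whose boundary has coefficients \<open>\<plusminus>1\<close> on a
  set \<open>B\<close> of at most \<open>m + 1\<close> facets and \<open>0\<close> elsewhere, as for the fundamental chain of a ball
  whose boundary is that of an \<open>m\<close>-simplex.
\<close>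

definition oriented_with_boundary :: "nat \<Rightarrow> 'a::linorder set set \<Rightarrow> bool" where
  "oriented_with_boundary m X \<longleftrightarrow> (\<exists>(u :: 'a set \<Rightarrow> real) B.
     (\<forall>\<tau>\<in>faces X (Suc m). (u \<tau>)\<^sup>2 = 1) \<and> B \<subseteq> faces X m \<and> card B \<le> Suc m \<and>
     (\<forall>\<sigma>\<in>faces X m. (bdry X m u \<sigma>)\<^sup>2 = of_bool (\<sigma> \<in> B)))"

locale starring =
  fixes m :: nat and X :: "'a::linorder set set" and \<tau> :: "'a set" and v :: 'a
  assumes complex: "abstract_simplicial_complex X"
    and dim: "\<And>\<sigma>. \<sigma> \<in> X \<Longrightarrow> card \<sigma> \<le> Suc m"
    and top: "\<tau> \<in> faces X (Suc m)"
    and fresh: "v \<notin> \<Union>X"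
begin

abbreviation "X' \<equiv> starred_at X \<tau> v"

definition child :: "'a \<Rightarrow> 'a set" where
  "child x = insert v (\<tau> - {x})"

lemma \<tau>_mem: "\<tau> \<in> X" "card \<tau> = Suc m" "finite \<tau>" "v \<notin> \<tau>" "\<tau> \<noteq> {}"
  using top fresh complexD(3)[OF complex] by (auto simp: faces_iff)

lemma fresh_face: "\<sigma> \<in> X \<Longrightarrow> v \<notin> \<sigma>"
  using fresh by auto

lemma maximal: "\<rho> \<in> X \<Longrightarrow> \<tau> \<subseteq> \<rho> \<Longrightarrow> \<rho> = \<tau>"
  using dim[of \<rho>] \<tau>_mem complexD(3)[OF complex, of \<rho>] by (intro card_seteq[symmetric]) auto

lemma mem_iff: "\<sigma> \<in> X' \<longleftrightarrow> (if v \<in> \<sigma> then \<sigma> - {v} \<subset> \<tau> else \<sigma> \<in> X \<and> \<sigma> \<noteq> \<tau>)"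
proof (cases "v \<in> \<sigma>")
  case True
  have "\<sigma> - {v} \<subset> \<tau>" if "\<sigma> \<in> X'" using that True fresh_face \<tau>_mem by (auto simp: starred_at_def)
  moreover have "\<sigma> \<in> X'" if "\<sigma> - {v} \<subset> \<tau>"
  proof -
    have "insert v (\<sigma> - {v}) \<in> X'" using that unfolding starred_at_def by blast
    then show ?thesis using True by (simp add: insert_absorb)
  qed
  ultimately show ?thesis using True by auto
next
  case False
  then show ?thesis by (auto simp: starred_at_def)
qed

lemma complex': "abstract_simplicial_complex X'"
  using starred_at_complex[OF complex _ _ maximal] \<tau>_mem by blast

lemma child_mem: "x \<in> \<tau> \<Longrightarrow> card (child x) = Suc m" "finite (child x)" "v \<in> child x" "child x - {v} = \<tau> - {x}"
  using \<tau>_mem by (auto simp: child_def)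

lemma child_not_old: "child x \<notin> X"
  using child_mem(3) fresh_face by blast

lemma inj_child: "inj_on child \<tau>"
proof (rule inj_onI)
  fix x y assume "x \<in> \<tau>" "y \<in> \<tau>" "child x = child y"
  then have "\<tau> - {x} = \<tau> - {y}" using child_mem(4)[of x] child_mem(4)[of y] by simp
  then show "x = y" using \<open>x \<in> \<tau>\<close> \<open>y \<in> \<tau>\<close> by auto
qed

lemma dim': "\<sigma> \<in> X' \<Longrightarrow> card \<sigma> \<le> Suc m"
proof (cases "v \<in> \<sigma>")
  case True
  assume "\<sigma> \<in> X'"
  then have "\<sigma> - {v} \<subset> \<tau>" using True by (simp add: mem_iff)
  then have "card (\<sigma> - {v}) < Suc m" using \<tau>_mem psubset_card_mono by metis
  moreover have "finite \<sigma>" using complexD(3)[OF complex' \<open>\<sigma> \<in> X'\<close>] .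
  ultimately show ?thesis using card_Suc_Diff1[OF _ True] by simp
next
  case False
  assume "\<sigma> \<in> X'"
  then show ?thesis using False dim by (simp add: mem_iff)
qed

lemma top_faces: "faces X' (Suc m) = (faces X (Suc m) - {\<tau>}) \<union> child ` \<tau>"
proof (rule set_eqI)
  fix \<sigma>
  show "\<sigma> \<in> faces X' (Suc m) \<longleftrightarrow> \<sigma> \<in> (faces X (Suc m) - {\<tau>}) \<union> child ` \<tau>"
  proof (cases "v \<in> \<sigma>")
    case False
    moreover from this have "\<sigma> \<notin> child ` \<tau>" using child_mem(3) by auto
    ultimately show ?thesis by (simp add: faces_iff mem_iff conj_ac)
  next
    case True
    then have old: "\<sigma> \<notin> faces X (Suc m)" using fresh_face by (auto simp: faces_iff)
    have "\<sigma> \<in> child ` \<tau>" if \<sigma>: "\<sigma> \<in> faces X' (Suc m)"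
    proof -
      have "\<sigma> - {v} \<subset> \<tau>" "card \<sigma> = Suc m" using \<sigma> True by (auto simp: faces_iff mem_iff)
      then have "\<sigma> - {v} \<in> faces (Pow \<tau>) m" using True by (simp add: faces_iff psubset_imp_subset)
      then obtain x where "x \<in> \<tau>" "\<sigma> - {v} = \<tau> - {x}" using facets_of_simplex[OF \<tau>_mem(2)] by auto
      moreover from this have "\<sigma> = child x" using True unfolding child_def by blast
      ultimately show ?thesis by blast
    qed
    moreover have "\<sigma> \<in> faces X' (Suc m)" if "\<sigma> \<in> child ` \<tau>"
    proof -
      obtain x where "x \<in> \<tau>" "\<sigma> = child x" using \<open>\<sigma> \<in> child ` \<tau>\<close> by blast
      then show ?thesis using child_mem by (auto simp: faces_iff mem_iff)
    qed
    ultimately show ?thesis using old by blast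
  qed
qed

lemma facets_old: "faces X m \<subseteq> faces X' m" "\<sigma> \<in> faces X' m \<Longrightarrow> v \<notin> \<sigma> \<Longrightarrow> \<sigma> \<in> faces X m"
  using \<tau>_mem fresh_face by (auto simp: faces_iff mem_iff)

lemma sum_top_faces:
  "(\<Sum>\<rho>\<in>faces X' (Suc m). g \<rho>) = (\<Sum>\<rho>\<in>faces X (Suc m) - {\<tau>}. g \<rho>) + (\<Sum>x\<in>\<tau>. g (child x))"
proof -
  have "(faces X (Suc m) - {\<tau>}) \<inter> child ` \<tau> = {}"
    using child_not_old unfolding faces_def by blast
  moreover have "finite (faces X (Suc m))" using complexD(1)[OF complex] by (rule finite_faces)
  ultimately have "(\<Sum>\<rho>\<in>faces X' (Suc m). g \<rho>) = (\<Sum>\<rho>\<in>faces X (Suc m) - {\<tau>}. g \<rho>) + (\<Sum>\<rho>\<in>child ` \<tau>. g \<rho>)"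
    unfolding top_faces using \<tau>_mem by (intro sum.union_disjoint) auto
  then show ?thesis by (simp only: sum.reindex[OF inj_child] o_def)
qed

lemma exact': "exact_at TYPE('f::field) X m \<Longrightarrow> exact_at TYPE('f) X' m"
  using exact_at_starred[OF complex _ _ _ fresh maximal] \<tau>_mem by blast

text \<open>
  The boundary of \<open>v * \<tau>\<close>, with the sign for which \<open>\<tau>\<close> cancels, is added to the chain. So the
  boundary of the chain does not change.
\<close>

definition subdivide :: "('a set \<Rightarrow> 'f::field) \<Rightarrow> 'a set \<Rightarrow> 'f" where
  "subdivide u \<rho> = (if v \<in> \<rho> then u \<tau> * boundary_coeff \<tau> (\<rho> - {v}) * face_sign \<rho> v else u \<rho>)"

lemma subdivide_child: "x \<in> \<tau> \<Longrightarrow> subdivide u (child x) = u \<tau> * face_sign \<tau> x * face_sign (child x) v"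
  using child_mem(3,4)[of x] by (simp add: subdivide_def boundary_coeff_face)

lemma bdry_subdivide_old:
  fixes u :: "'a set \<Rightarrow> 'f::field"
  assumes \<sigma>: "v \<notin> \<sigma>"
  shows "bdry X' m (subdivide u) \<sigma> = bdry X m u \<sigma>"
proof -
  have zero: "boundary_coeff (child x) \<sigma> = (0 :: 'f)" if "\<sigma> \<noteq> \<tau> - {x}" for x
  proof (rule boundary_coeff_eq_0)
    fix z assume z: "z \<in> child x"
    show "\<sigma> \<noteq> child x - {z}"
    proof
      assume eq: "\<sigma> = child x - {z}"
      then have "z = v" using \<sigma> child_mem(3)[of x] by blast
      then show False using eq that child_mem(4) by simp
    qed
  qed
  have "(\<Sum>x\<in>\<tau>. boundary_coeff (child x) \<sigma> * subdivide u (child x)) = boundary_coeff \<tau> \<sigma> * u \<tau>"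
  proof (cases "\<exists>y\<in>\<tau>. \<sigma> = \<tau> - {y}")
    case True
    then obtain y where y: "y \<in> \<tau>" "\<sigma> = \<tau> - {y}" by blast
    have "(\<Sum>x\<in>\<tau>. boundary_coeff (child x) \<sigma> * subdivide u (child x)) =
        boundary_coeff (child y) \<sigma> * subdivide u (child y) +
        (\<Sum>x\<in>\<tau> - {y}. boundary_coeff (child x) \<sigma> * subdivide u (child x))"
      using \<tau>_mem y by (intro sum.remove)
    also have "(\<Sum>x\<in>\<tau> - {y}. boundary_coeff (child x) \<sigma> * subdivide u (child x)) = 0"
    proof (rule sum.neutral, rule ballI)
      fix x assume "x \<in> \<tau> - {y}"
      then have "\<sigma> \<noteq> \<tau> - {x}" using y by auto
      then show "boundary_coeff (child x) \<sigma> * subdivide u (child x) = 0" by (simp add: zero)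
    qed
    also have "boundary_coeff (child y) \<sigma> = (face_sign (child y) v :: 'f)"
      using boundary_coeff_face[OF child_mem(3), of y] child_mem(4) y by simp
    finally show ?thesis using y by (simp add: subdivide_child boundary_coeff_face mult.commute mult.left_commute)
  next
    case False
    then have "boundary_coeff \<tau> \<sigma> = (0::'f)" by (intro boundary_coeff_eq_0) blast
    moreover have "boundary_coeff (child x) \<sigma> * subdivide u (child x) = 0" if "x \<in> \<tau>" for x
      using False that by (subst zero) auto
    ultimately show ?thesis by (simp add: sum.neutral)
  qed
  moreover have "(\<Sum>\<rho>\<in>faces X (Suc m) - {\<tau>}. boundary_coeff \<rho> \<sigma> * subdivide u \<rho>) =
      (\<Sum>\<rho>\<in>faces X (Suc m) - {\<tau>}. boundary_coeff \<rho> \<sigma> * u \<rho>)"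
    using fresh_face by (intro sum.cong) (auto simp: subdivide_def faces_iff)
  moreover have "(\<Sum>\<rho>\<in>faces X (Suc m). boundary_coeff \<rho> \<sigma> * u \<rho>) =
      boundary_coeff \<tau> \<sigma> * u \<tau> + (\<Sum>\<rho>\<in>faces X (Suc m) - {\<tau>}. boundary_coeff \<rho> \<sigma> * u \<rho>)"
    using top finite_faces[OF complexD(1)[OF complex]] by (intro sum.remove)
  ultimately show ?thesis unfolding bdry_def sum_top_faces by (simp add: add.commute)
qed

text \<open>
  A facet containing \<open>v\<close> lies in exactly two children \<open>child a\<close> and \<open>child b\<close>; their contributions
  cancel because removing \<open>a\<close> and \<open>b\<close> from \<open>\<tau>\<close> in the two orders gives opposite signs.
\<close>

lemma bdry_subdivide_new:
  fixes u :: "'a set \<Rightarrow> 'f::field"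
  assumes \<sigma>: "\<sigma> \<in> faces X' m" "v \<in> \<sigma>"
  shows "bdry X' m (subdivide u) \<sigma> = 0"
proof -
  have sub: "\<sigma> - {v} \<subset> \<tau>" and card: "card \<sigma> = m" and fin: "finite \<sigma>"
    using \<sigma> complexD(3)[OF complex'] by (auto simp: faces_iff mem_iff)
  have "Suc (card (\<sigma> - {v})) = m" using card_Suc_Diff1[OF fin \<sigma>(2)] card by simp
  moreover have "card (\<tau> - (\<sigma> - {v})) = Suc m - card (\<sigma> - {v})"
    using sub \<tau>_mem fin by (subst card_Diff_subset) auto
  ultimately have "card (\<tau> - (\<sigma> - {v})) = 2" by simp
  then obtain a b where ab: "\<tau> - (\<sigma> - {v}) = {a, b}" "a \<noteq> b" by (auto simp: card_2_iff)
  then have mem: "a \<in> \<tau>" "b \<in> \<tau>" "a \<noteq> v" "b \<noteq> v" and \<sigma>_eq: "\<sigma> = insert v (\<tau> - {a, b})"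
    using sub \<sigma> \<tau>_mem by auto
  have faces: "child a - {b} = \<sigma>" "child b - {a} = \<sigma>" "b \<in> child a" "a \<in> child b"
    using mem ab(2) \<sigma>_eq by (auto simp: child_def)
  have old: "boundary_coeff \<rho> \<sigma> = (0::'f)" if "\<rho> \<in> faces X (Suc m)" for \<rho>
  proof (rule boundary_coeff_eq_0)
    fix z assume "z \<in> \<rho>"
    have "v \<notin> \<rho>" using that fresh_face by (auto simp: faces_iff)
    then show "\<sigma> \<noteq> \<rho> - {z}" using \<sigma>(2) by blast
  qed
  have other: "boundary_coeff (child x) \<sigma> = (0::'f)" if "x \<in> \<tau>" "x \<noteq> a" "x \<noteq> b" for x
  proof (rule boundary_coeff_eq_0)
    fix z assume "z \<in> child x"
    have "x \<in> \<sigma>" "x \<notin> child x" using that \<sigma>_eq \<tau>_mem by (auto simp: child_def)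
    then show "\<sigma> \<noteq> child x - {z}" by blast
  qed
  have half: "boundary_coeff (child p) \<sigma> * subdivide u (child p) =
      - (u \<tau> * face_sign \<sigma> v * (face_sign \<tau> p * face_sign (\<tau> - {p}) q))"
    if "p \<in> \<tau>" "q \<in> child p" "child p - {q} = \<sigma>" for p q
  proof -
    have "q \<noteq> v" using that \<sigma>(2) by blast
    then have "face_sign (child p) q * face_sign \<sigma> v = - (face_sign (child p) v * face_sign (\<tau> - {p}) q :: 'f)"
      using face_sign_swap[of "child p" q v, where ?'f = 'f] child_mem[of p] that by simp
    then have "face_sign (child p) q * face_sign \<sigma> v * face_sign \<sigma> v * face_sign (child p) v =
       - (face_sign (child p) v * face_sign (\<tau> - {p}) q :: 'f) * face_sign \<sigma> v * face_sign (child p) v"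
      by (simp only:)
    then have *: "face_sign (child p) q * face_sign (child p) v = - (face_sign \<sigma> v * face_sign (\<tau> - {p}) q :: 'f)"
      by (simp add: mult.assoc mult.commute mult.left_commute)
    have "boundary_coeff (child p) \<sigma> = (face_sign (child p) q :: 'f)"
      using boundary_coeff_face[OF that(2)] that(3) by simp
    then have "boundary_coeff (child p) \<sigma> * subdivide u (child p) =
        u \<tau> * face_sign \<tau> p * (face_sign (child p) q * face_sign (child p) v)"
      using that by (simp add: subdivide_child mult.commute mult.left_commute)
    then show ?thesis unfolding * by (simp add: mult.commute mult.left_commute)
  qed
  have "bdry X' m (subdivide u) \<sigma> = (\<Sum>x\<in>\<tau>. boundary_coeff (child x) \<sigma> * subdivide u (child x))"
    unfolding bdry_def sum_top_faces using old by (simp add: sum.neutral)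
  also have "\<dots> = (\<Sum>x\<in>{a, b}. boundary_coeff (child x) \<sigma> * subdivide u (child x))"
    using \<tau>_mem mem other by (intro sum.mono_neutral_right) auto
  also have "\<dots> = boundary_coeff (child a) \<sigma> * subdivide u (child a) + boundary_coeff (child b) \<sigma> * subdivide u (child b)"
    using ab(2) by simp
  also have "\<dots> = - (u \<tau> * face_sign \<sigma> v * (face_sign \<tau> a * face_sign (\<tau> - {a}) b + face_sign \<tau> b * face_sign (\<tau> - {b}) a))"
    unfolding half[OF mem(1) faces(3) faces(1)] half[OF mem(2) faces(4) faces(2)] by (simp add: distrib_left)
  also have "face_sign \<tau> a * face_sign (\<tau> - {a}) b + face_sign \<tau> b * face_sign (\<tau> - {b}) a = (0::'f)"
    using face_sign_swap[of \<tau> a b, where ?'f = 'f] \<tau>_mem mem ab(2) by simp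
  finally show ?thesis by simp
qed

lemma oriented': "oriented_with_boundary m X \<Longrightarrow> oriented_with_boundary m X'"
proof -
  assume "oriented_with_boundary m X"
  then obtain u :: "'a set \<Rightarrow> real" and B where u: "\<And>\<rho>. \<rho> \<in> faces X (Suc m) \<Longrightarrow> (u \<rho>)\<^sup>2 = 1"
    and B: "B \<subseteq> faces X m" "card B \<le> Suc m"
    and bd: "\<And>\<sigma>. \<sigma> \<in> faces X m \<Longrightarrow> (bdry X m u \<sigma>)\<^sup>2 = of_bool (\<sigma> \<in> B)"
    unfolding oriented_with_boundary_def by blast
  show ?thesis
    unfolding oriented_with_boundary_def
  proof (intro exI[of _ "subdivide u"] exI[of _ B] conjI ballI)
    fix \<rho> assume "\<rho> \<in> faces X' (Suc m)"
    then consider "\<rho> \<in> faces X (Suc m)" | x where "x \<in> \<tau>" "\<rho> = child x" unfolding top_faces by blast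
    then show "(subdivide u \<rho>)\<^sup>2 = 1"
    proof cases
      case 1
      then have "v \<notin> \<rho>" using fresh_face by (auto simp: faces_iff)
      then show ?thesis using u[OF 1] by (simp add: subdivide_def)
    next
      case 2
      then show ?thesis using u[OF top] by (simp add: subdivide_child power_mult_distrib)
    qed
  next
    show "B \<subseteq> faces X' m" using B facets_old by blast
    show "card B \<le> Suc m" using B by simp
    fix \<sigma> assume \<sigma>: "\<sigma> \<in> faces X' m"
    show "(bdry X' m (subdivide u) \<sigma>)\<^sup>2 = of_bool (\<sigma> \<in> B)"
    proof (cases "v \<in> \<sigma>")
      case True
      then have "\<sigma> \<notin> B" using B fresh_face by (auto simp: faces_iff)
      then show ?thesis using bdry_subdivide_new[OF \<sigma> True] by simp
    next
      case False
      show ?thesis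
        unfolding bdry_subdivide_old[OF False] by (rule bd[OF facets_old(2)[OF \<sigma> False]])
    qed
  qed
qed

end

lemma starring_simplex: "m < w \<Longrightarrow> starring m (Pow {..m}) {..m} w"
proof unfold_locales
  show "card \<sigma> \<le> Suc m" if "\<sigma> \<in> Pow {..m}" for \<sigma> using card_mono[of "{..m}" \<sigma>] that by simp
qed (auto intro: complex_Pow simp: faces_iff)

lemma oriented_simplex: "oriented_with_boundary m (Pow {..m})"
  unfolding oriented_with_boundary_def
proof (intro exI[of _ "\<lambda>_. 1"] exI[of _ "faces (Pow {..m}) m"] conjI ballI)
  have c: "card {..m} = Suc m" by simp
  show "card (faces (Pow {..m}) m) \<le> Suc m"
    unfolding facets_of_simplex[OF c] using card_image_le[of "{..m}"] by fastforce
  fix \<sigma> assume \<sigma>: "\<sigma> \<in> faces (Pow {..m}) m"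
  then obtain x where x: "x \<in> {..m}" "\<sigma> = {..m} - {x}" unfolding facets_of_simplex[OF c] by blast
  have "boundary_coeff {..m} \<sigma> = (face_sign {..m} x :: real)"
    unfolding x(2) by (rule boundary_coeff_face[OF x(1)])
  then have "bdry (Pow {..m}) m (\<lambda>_. 1 :: real) \<sigma> = face_sign {..m} x"
    by (simp add: bdry_def top_face_simplex)
  then show "(bdry (Pow {..m}) m (\<lambda>_. 1 :: real) \<sigma>)\<^sup>2 = of_bool (\<sigma> \<in> faces (Pow {..m}) m)"
    using \<sigma> by simp
qed auto

section \<open>Layered balls\<close>

text \<open>
  Complexes obtained from the cone with apex \<open>w\<close> over the boundary of a simplex by starring
  \<open>m\<close>-simplexes that contain \<open>w\<close>. The function \<open>D\<close> bounds the depth of the \<open>m\<close>-simplexes: the child of \<open>\<tau>\<close> avoiding \<open>w\<close> takes over the position of \<open>\<tau>\<close>, and the other children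
  lie behind it.
\<close>

inductive layered :: "nat \<Rightarrow> nat \<Rightarrow> nat set set \<Rightarrow> (nat set \<Rightarrow> nat) \<Rightarrow> bool" for m w where
  base: "m < w \<Longrightarrow> layered m w (starred_at (Pow {..m}) {..m} w) (\<lambda>_. 1)"
| star: "layered m w X D \<Longrightarrow> \<tau> \<in> faces X (Suc m) \<Longrightarrow> w \<in> \<tau> \<Longrightarrow> v \<notin> \<Union>X \<Longrightarrow>
    layered m w (starred_at X \<tau> v) (\<lambda>\<rho>. if v \<notin> \<rho> then D \<rho> else if w \<in> \<rho> then Suc (D \<tau>) else D \<tau>)"

lemma layered_complex:
  assumes "layered m w X D"
  shows "abstract_simplicial_complex X" "\<sigma> \<in> X \<Longrightarrow> card \<sigma> \<le> Suc m"
    "exact_at TYPE('f::field) X m" "oriented_with_boundary m X"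
proof -
  have "abstract_simplicial_complex X \<and> (\<forall>\<sigma>\<in>X. card \<sigma> \<le> Suc m) \<and> exact_at TYPE('f) X m \<and>
      oriented_with_boundary m X"
    using assms
  proof induction
    case base
    then interpret starring m "Pow {..m}" "{..m}" w by (rule starring_simplex)
    show ?case
      using complex' dim' exact'[OF exact_at_simplex[of _ 0]] oriented'[OF oriented_simplex] by auto
  next
    case (star X D \<tau> v)
    then interpret starring m X \<tau> v by unfold_locales auto
    show ?case using star.IH complex' dim' exact' oriented' by auto
  qed
  then show "abstract_simplicial_complex X" "\<sigma> \<in> X \<Longrightarrow> card \<sigma> \<le> Suc m"
    "exact_at TYPE('f::field) X m" "oriented_with_boundary m X" by auto
qed

lemma layered_starring:
  assumes "layered m w X D" "\<tau> \<in> faces X (Suc m)" "v \<notin> \<Union>X"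
  shows "starring m X \<tau> v"
  using assms layered_complex by unfold_locales auto

text \<open>
  \<open>\<phi>\<close> discharges the single simplex \<open>\<tau>\<close>. Avoiding the facets that contain \<open>w\<close> makes this condition
  stable under starring: the only facet of a simplex \<open>\<tau> \<ni> w\<close> that \<open>\<phi>\<close> may use is \<open>\<tau> - {w}\<close>.
\<close>

definition fills :: "nat \<Rightarrow> nat \<Rightarrow> nat set set \<Rightarrow> nat set \<Rightarrow> (nat set \<Rightarrow> 'f::field) \<Rightarrow> bool" where
  "fills m w X \<tau> \<phi> \<longleftrightarrow> (\<forall>\<rho>. \<phi> \<rho> \<noteq> 0 \<longrightarrow> \<rho> \<in> faces X m \<and> w \<notin> \<rho>) \<and>
     (\<forall>\<tau>'\<in>faces X (Suc m). cobd \<phi> \<tau>' = of_bool (\<tau>' = \<tau>))"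

context starring
begin

text \<open>
  A cochain that uses only old facets avoiding \<open>w\<close> meets \<open>\<tau>\<close> and its children in the facet \<open>\<tau> - {w}\<close>
  only, so the source at \<open>\<tau>\<close> moves to \<open>child w\<close>.
\<close>

lemma cobd_old_child:
  fixes \<phi> :: "'a set \<Rightarrow> 'f::field"
  assumes w: "w \<in> \<tau>" and supp: "\<And>\<rho>. \<phi> \<rho> \<noteq> 0 \<Longrightarrow> \<rho> \<in> X \<and> w \<notin> \<rho>"
  shows "x \<in> \<tau> - {w} \<Longrightarrow> cobd \<phi> (child x) = 0"
    and "cobd \<phi> (child w) = face_sign (child w) v * face_sign \<tau> w * cobd \<phi> \<tau>"
proof -
  have 0: "\<phi> \<rho> = 0" if "v \<in> \<rho> \<or> w \<in> \<rho>" for \<rho>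
    using supp[of \<rho>] fresh_face[of \<rho>] that by blast
  show "cobd \<phi> (child x) = 0" if x: "x \<in> \<tau> - {w}"
  proof (rule cobd_zero, rule 0)
    fix z assume "z \<in> child x"
    have "w \<in> child x" "v \<noteq> w" using w x \<tau>_mem by (auto simp: child_def)
    then show "v \<in> child x - {z} \<or> w \<in> child x - {z}" using child_mem(3)[of x] by blast
  qed
  have "cobd \<phi> \<tau> = face_sign \<tau> w * \<phi> (\<tau> - {w})"
    using w \<tau>_mem by (intro cobd_single 0) auto
  moreover have "cobd \<phi> (child w) = face_sign (child w) v * \<phi> (child w - {v})"
    using child_mem(2,3)[of w] by (intro cobd_single 0) auto
  ultimately show "cobd \<phi> (child w) = face_sign (child w) v * face_sign \<tau> w * cobd \<phi> \<tau>"
    using child_mem(4)[of w] by (simp add: mult.assoc)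
qed

end

text \<open>
  A child of \<open>\<tau>\<close> containing \<open>w\<close> is discharged through its facet opposite to \<open>w\<close> into \<open>child w\<close>, at the
  cost of one more facet, and \<open>child w\<close> is discharged as \<open>\<tau>\<close> was.
\<close>

lemma layered_fills:
  assumes "layered m w X D" "\<tau> \<in> faces X (Suc m)"
  shows "\<exists>\<phi> :: nat set \<Rightarrow> 'f::field. fills m w X \<tau> \<phi> \<and> card {\<rho>. \<phi> \<rho> \<noteq> 0} \<le> D \<tau>"
  using assms
proof (induction arbitrary: \<tau>)
  case (base \<tau>)
  then interpret starring m "Pow {..m}" "{..m}" w by (intro starring_simplex)
  have tops: "faces X' (Suc m) = child ` {..m}" using top_faces top_face_simplex by auto
  then obtain x where x: "x \<in> {..m}" "\<tau> = child x" using base by auto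
  define \<phi> :: "nat set \<Rightarrow> 'f" where "\<phi> \<rho> = (if \<rho> = {..m} - {x} then face_sign \<tau> w else 0)" for \<rho>
  have "cobd \<phi> (child y) = of_bool (child y = \<tau>)" if y: "y \<in> {..m}" for y
  proof -
    have "cobd \<phi> (child y) = face_sign (child y) w * \<phi> (child y - {w})"
    proof (rule cobd_single)
      fix z assume "z \<in> child y" "z \<noteq> w"
      then have "child y - {z} \<noteq> {..m} - {x}" using child_mem(3)[of y] \<tau>_mem by blast
      then show "\<phi> (child y - {z}) = 0" by (simp add: \<phi>_def)
    qed (use child_mem in auto)
    moreover have "child y - {w} = {..m} - {x} \<longleftrightarrow> y = x" using child_mem(4)[of y] x y by auto
    moreover have "child y = \<tau> \<longleftrightarrow> y = x" using inj_child x y by (auto simp: inj_on_def)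
    ultimately show ?thesis using x by (simp add: \<phi>_def)
  qed
  moreover have "{..m} - {x} \<in> faces X' m" "w \<notin> {..m} - {x}"
    using x \<tau>_mem by (auto simp: faces_iff mem_iff)
  ultimately have "fills m w X' \<tau> \<phi>" unfolding fills_def tops by (auto simp: \<phi>_def split: if_splits)
  moreover have "{\<rho>. \<phi> \<rho> \<noteq> 0} = {{..m} - {x}}" by (auto simp: \<phi>_def)
  ultimately show ?case by (intro exI[of _ \<phi>]) simp
next
  case (star X D \<tau> v \<tau>')
  interpret starring m X \<tau> v using star.hyps layered_starring by blast
  have w: "w \<in> \<tau>" "v \<noteq> w" using star.hyps \<tau>_mem by auto
  have supp: "\<phi> \<rho> \<noteq> 0 \<Longrightarrow> \<rho> \<in> X \<and> w \<notin> \<rho>" if "fills m w X \<kappa> \<phi>" for \<phi> :: "nat set \<Rightarrow> 'f" and \<kappa> \<rho>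
    using that by (auto simp: fills_def faces_iff)
  have cobd_child: "x \<in> \<tau> - {w} \<Longrightarrow> cobd \<phi> (child x) = 0"
      "cobd \<phi> (child w) = face_sign (child w) v * face_sign \<tau> w * cobd \<phi> \<tau>"
    if "fills m w X \<kappa> \<phi>" for \<phi> :: "nat set \<Rightarrow> 'f" and \<kappa> x
    using cobd_old_child[OF w(1), of \<phi>] supp[OF that] by blast+
  have supp': "\<phi> \<rho> \<noteq> 0 \<Longrightarrow> \<rho> \<in> faces X' m \<and> w \<notin> \<rho>" if "fills m w X \<kappa> \<phi>" for \<phi> :: "nat set \<Rightarrow> 'f" and \<kappa> \<rho>
    using that facets_old(1) by (auto simp: fills_def)
  let ?D = "\<lambda>\<rho>. if v \<notin> \<rho> then D \<rho> else if w \<in> \<rho> then Suc (D \<tau>) else D \<tau>"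
  have child_w: "v \<in> child w" "w \<notin> child w" "child w \<in> faces X' (Suc m)"
    using child_mem w top_faces by (auto simp: child_def)
  have child_ne: "child x \<noteq> child w" if "x \<in> \<tau> - {w}" for x
    using that w inj_child by (auto simp: inj_on_def)
  have ev: "fills m w X' \<kappa> \<phi>"
    if "\<And>\<rho>. \<phi> \<rho> \<noteq> 0 \<Longrightarrow> \<rho> \<in> faces X' m \<and> w \<notin> \<rho>"
      "\<And>\<rho>. \<rho> \<in> faces X (Suc m) - {\<tau>} \<Longrightarrow> cobd \<phi> \<rho> = of_bool (\<rho> = \<kappa>)"
      "cobd \<phi> (child w) = of_bool (child w = \<kappa>)"
      "\<And>x. x \<in> \<tau> - {w} \<Longrightarrow> cobd \<phi> (child x) = of_bool (child x = \<kappa>)" for \<phi> :: "nat set \<Rightarrow> 'f" and \<kappa>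
    unfolding fills_def
  proof (intro conjI allI impI ballI)
    fix \<rho> assume "\<rho> \<in> faces X' (Suc m)"
    then consider "\<rho> \<in> faces X (Suc m) - {\<tau>}" | "\<rho> = child w" | x where "x \<in> \<tau> - {w}" "\<rho> = child x"
      unfolding top_faces by blast
    then show "cobd \<phi> \<rho> = of_bool (\<rho> = \<kappa>)"
      using that(2)[of \<rho>] that(3) that(4) by cases simp_all
  qed (use that(1) in blast)+
  obtain \<phi>\<tau> :: "nat set \<Rightarrow> 'f" where \<phi>\<tau>: "fills m w X \<tau> \<phi>\<tau>" "card {\<rho>. \<phi>\<tau> \<rho> \<noteq> 0} \<le> D \<tau>"
    using star.IH[OF star.hyps(2)] by blast
  define c :: 'f where "c = face_sign (child w) v * face_sign \<tau> w"
  define \<phi>w where "\<phi>w \<rho> = c * \<phi>\<tau> \<rho>" for \<rho>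
  have c0: "c \<noteq> 0" by (simp add: c_def)
  have cobd_\<phi>w: "cobd \<phi>w \<rho> = c * cobd \<phi>\<tau> \<rho>" for \<rho> unfolding \<phi>w_def by (rule cobd_scale)
  have old_ne: "\<rho> \<noteq> child x" if "\<rho> \<in> faces X (Suc m)" for \<rho> x
    using that child_not_old by (auto simp: faces_iff)
  have c\<tau>: "cobd \<phi>\<tau> \<rho> = of_bool (\<rho> = \<tau>)" if "\<rho> \<in> faces X (Suc m)" for \<rho>
    using \<phi>\<tau>(1) that by (simp add: fills_def)
  have \<phi>w: "fills m w X' (child w) \<phi>w"
  proof (rule ev)
    show "\<rho> \<in> faces X' m \<and> w \<notin> \<rho>" if "\<phi>w \<rho> \<noteq> 0" for \<rho>
      using that supp'[OF \<phi>\<tau>(1)] by (auto simp: \<phi>w_def)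
    show "cobd \<phi>w \<rho> = of_bool (\<rho> = child w)" if "\<rho> \<in> faces X (Suc m) - {\<tau>}" for \<rho>
      using that c\<tau>[of \<rho>] old_ne[of \<rho> w] by (simp add: cobd_\<phi>w)
    show "cobd \<phi>w (child w) = of_bool (child w = child w)"
    proof -
      have "cobd \<phi>\<tau> (child w) = c" using cobd_child(2)[OF \<phi>\<tau>(1)] c\<tau>[OF star.hyps(2)] by (simp add: c_def)
      moreover have "c * c = 1" unfolding c_def by (simp add: mult.assoc mult.left_commute)
      ultimately show ?thesis by (simp add: cobd_\<phi>w)
    qed
    show "cobd \<phi>w (child x) = of_bool (child x = child w)" if "x \<in> \<tau> - {w}" for x
      using cobd_child(1)[OF \<phi>\<tau>(1) that] child_ne[OF that] by (simp add: cobd_\<phi>w)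
  qed
  have card_w: "card {\<rho>. \<phi>w \<rho> \<noteq> 0} \<le> D \<tau>" using \<phi>\<tau>(2) c0 by (simp add: \<phi>w_def)
  consider "\<tau>' \<in> faces X (Suc m) - {\<tau>}" | "\<tau>' = child w" | x where "x \<in> \<tau> - {w}" "\<tau>' = child x"
    using star.prems unfolding top_faces by blast
  then show ?case
  proof cases
    case 1
    then obtain \<phi> :: "nat set \<Rightarrow> 'f" where \<phi>: "fills m w X \<tau>' \<phi>" "card {\<rho>. \<phi> \<rho> \<noteq> 0} \<le> D \<tau>'"
      using star.IH[of \<tau>'] by blast
    have c: "cobd \<phi> \<rho> = of_bool (\<rho> = \<tau>')" if "\<rho> \<in> faces X (Suc m)" for \<rho>
      using \<phi>(1) that by (simp add: fills_def)
    have "fills m w X' \<tau>' \<phi>"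
    proof (rule ev)
      show "cobd \<phi> (child w) = of_bool (child w = \<tau>')"
        using cobd_child(2)[OF \<phi>(1)] c[OF star.hyps(2)] 1 old_ne[of \<tau>' w] by auto
      show "cobd \<phi> (child x) = of_bool (child x = \<tau>')" if "x \<in> \<tau> - {w}" for x
        using cobd_child(1)[OF \<phi>(1) that] 1 old_ne[of \<tau>' x] by auto
    qed (use supp'[OF \<phi>(1)] c in auto)
    moreover have "?D \<tau>' = D \<tau>'" using 1 fresh_face by (auto simp: faces_iff)
    ultimately show ?thesis using \<phi>(2) by (intro exI[of _ \<phi>]) (simp del: if_not_P)
  next
    case 2
    have "?D \<tau>' = D \<tau>" using child_w 2 by simp
    then show ?thesis using \<phi>w card_w 2 by (intro exI[of _ \<phi>w]) simp
  next
    case 3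
    define G where "G = child x - {w}"
    define \<psi> :: "nat set \<Rightarrow> 'f" where "\<psi> \<rho> = (if \<rho> = G then face_sign (child x) w else 0)" for \<rho>
    have wx: "w \<in> child y" if "y \<in> \<tau> - {w}" for y using that w by (auto simp: child_def)
    have G: "v \<in> G" "w \<notin> G" "G \<in> faces X' m"
    proof -
      show "v \<in> G" "w \<notin> G" using child_mem(3)[of x] w by (auto simp: G_def)
      have "child x \<in> faces X' (Suc m)" unfolding top_faces using 3(1) by blast
      then have "child x \<in> X'" by (simp only: faces_iff)
      then have "G \<in> X'" unfolding G_def by (rule complexD(4)[OF complex']) auto
      then show "G \<in> faces X' m"
        using child_mem(1,2)[of x] wx[OF 3(1)] 3 by (simp add: faces_iff G_def)
    qed
    have \<psi>_old: "cobd \<psi> \<rho> = 0" if "\<rho> \<in> faces X (Suc m)" for \<rho>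
    proof (rule cobd_zero)
      fix z have "v \<notin> \<rho>" using that fresh_face by (auto simp: faces_iff)
      then have "\<rho> - {z} \<noteq> G" using G by blast
      then show "\<psi> (\<rho> - {z}) = 0" by (simp add: \<psi>_def)
    qed
    have \<psi>_child: "cobd \<psi> (child y) = of_bool (child y = child x)" if y: "y \<in> \<tau> - {w}" for y
    proof -
      have "cobd \<psi> (child y) = face_sign (child y) w * \<psi> (child y - {w})"
      proof (rule cobd_single)
        fix z assume "z \<in> child y" "z \<noteq> w"
        then have "child y - {z} \<noteq> G" using wx[OF y] G by blast
        then show "\<psi> (child y - {z}) = 0" by (simp add: \<psi>_def)
      qed (use child_mem wx[OF y] in auto)
      moreover have "child y - {w} = G \<longleftrightarrow> child y = child x"
        using wx[OF y] wx[OF 3(1)] unfolding G_def by blast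
      ultimately show ?thesis by (auto simp: \<psi>_def)
    qed
    define b where "b = cobd \<psi> (child w)"
    define \<phi> where "\<phi> \<rho> = \<psi> \<rho> - b * \<phi>w \<rho>" for \<rho>
    have cw: "cobd \<phi>w \<rho> = of_bool (\<rho> = child w)" if "\<rho> \<in> faces X' (Suc m)" for \<rho>
      using \<phi>w that by (simp add: fills_def)
    have "fills m w X' \<tau>' \<phi>"
    proof (rule ev)
      show "\<rho> \<in> faces X' m \<and> w \<notin> \<rho>" if "\<phi> \<rho> \<noteq> 0" for \<rho>
      proof -
        have "\<rho> = G \<or> \<phi>w \<rho> \<noteq> 0" using that by (auto simp: \<phi>_def \<psi>_def split: if_splits)
        then show ?thesis using G \<phi>w by (auto simp: fills_def)
      qed
      show "cobd \<phi> \<rho> = of_bool (\<rho> = \<tau>')" if "\<rho> \<in> faces X (Suc m) - {\<tau>}" for \<rho>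
        using that cw[of \<rho>] \<psi>_old[of \<rho>] old_ne[of \<rho>] 3(2)
        unfolding \<phi>_def by (simp add: cobd_diff cobd_scale top_faces)
      show "cobd \<phi> (child w) = of_bool (child w = \<tau>')"
        using cw[OF child_w(3)] child_ne[OF 3(1)] 3(2)
        unfolding \<phi>_def by (simp add: cobd_diff cobd_scale b_def)
      show "cobd \<phi> (child y) = of_bool (child y = \<tau>')" if "y \<in> \<tau> - {w}" for y
        using that cw[of "child y"] \<psi>_child[OF that] child_ne[OF that] 3(2)
        unfolding \<phi>_def by (simp add: cobd_diff cobd_scale top_faces)
    qed
    moreover have "card {\<rho>. \<phi> \<rho> \<noteq> 0} \<le> ?D \<tau>'"
    proof -
      have "{\<rho>. \<phi>w \<rho> \<noteq> 0} \<subseteq> faces X' m" using \<phi>w by (auto simp: fills_def)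
      then have fin: "finite {\<rho>. \<phi>w \<rho> \<noteq> 0}"
        using finite_faces[OF complexD(1)[OF complex']] finite_subset by blast
      have "card {\<rho>. \<phi> \<rho> \<noteq> 0} \<le> card (insert G {\<rho>. \<phi>w \<rho> \<noteq> 0})"
        using fin by (intro card_mono) (auto simp: \<phi>_def \<psi>_def)
      also have "\<dots> \<le> Suc (D \<tau>)" using card_w fin card_insert_le_m1[of "Suc (D \<tau>)"] by (simp add: card_insert_if)
      also have "\<dots> = ?D \<tau>'" using child_mem(3)[of x] wx[OF 3(1)] 3(2) by simp
      finally show ?thesis .
    qed
    ultimately show ?thesis by blast
  qed
qed

text \<open>
  The \<open>m\<close>-simplexes around the apex, which are the candidates for starring.
\<close>

abbreviation core_faces :: "nat \<Rightarrow> nat \<Rightarrow> nat set set \<Rightarrow> nat set set" where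
  "core_faces m w X \<equiv> {\<tau> \<in> faces X (Suc m). w \<in> \<tau>}"

text \<open>
  One round, starring the core simplexes of depth \<open>k\<close> one at a time. Each of them is replaced by \<open>m\<close>
  core simplexes of depth \<open>k + 1\<close>. The equation is the resulting count, written without subtraction.
\<close>

lemma layered_round:
  assumes "layered m w X D" "\<And>\<tau>. \<tau> \<in> faces X (Suc m) \<Longrightarrow> D \<tau> \<le> Suc k"
    and "\<And>\<tau>. \<tau> \<in> core_faces m w X \<Longrightarrow> k \<le> D \<tau>"
  shows "\<exists>X' D'. layered m w X' D' \<and> (\<forall>\<tau>\<in>faces X' (Suc m). D' \<tau> \<le> Suc k) \<and>
     (\<forall>\<tau>\<in>core_faces m w X'. D' \<tau> = Suc k) \<and>
     card (core_faces m w X') + card {\<tau> \<in> core_faces m w X. D \<tau> = k} = card (core_faces m w X) + m * card {\<tau> \<in> core_faces m w X. D \<tau> = k}"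
  using assms
proof (induction "card {\<tau> \<in> core_faces m w X. D \<tau> = k}" arbitrary: X D)
  case 0
  have "finite (core_faces m w X)" using finite_faces[OF complexD(1)[OF layered_complex(1)[OF 0(2)]]] by simp
  then have "finite {\<tau> \<in> core_faces m w X. D \<tau> = k}" by (rule finite_subset[rotated]) blast
  then have emp: "{\<tau> \<in> core_faces m w X. D \<tau> = k} = {}" using 0(1) by (metis card_0_eq)
  have "D \<tau> = Suc k" if "\<tau> \<in> core_faces m w X" for \<tau>
  proof -
    have "D \<tau> \<noteq> k" using emp that by blast
    then show ?thesis using 0(3)[of \<tau>] 0(4)[OF that] that by simp
  qed
  then show ?case unfolding 0(1)[symmetric] using 0(2,3) by (intro exI[of _ X] exI[of _ D]) simp
next
  case (Suc n)
  define A where "A = {\<tau> \<in> core_faces m w X. D \<tau> = k}"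
  have cardA: "card A = Suc n" using Suc(2) by (simp add: A_def)
  then obtain \<tau> where \<tau>: "\<tau> \<in> A" by fastforce
  then have \<tau>': "\<tau> \<in> faces X (Suc m)" "w \<in> \<tau>" "D \<tau> = k" by (auto simp: A_def)
  have finX: "finite X" "finite (\<Union>X)" using complexD(1,3)[OF layered_complex(1)[OF Suc(3)]] by auto
  then obtain v where v: "v \<notin> \<Union>X" using ex_new_if_finite[OF infinite_UNIV_nat] by blast
  interpret starring m X \<tau> v using layered_starring[OF Suc(3) \<tau>'(1) v] .
  define D' where "D' = (\<lambda>\<rho>. if v \<notin> \<rho> then D \<rho> else if w \<in> \<rho> then Suc (D \<tau>) else D \<tau>)"
  have lay: "layered m w X' D'" unfolding D'_def using layered.star[OF Suc(3) \<tau>'(1,2) v] .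
  have wv: "w \<noteq> v" using \<tau>' \<tau>_mem by auto
  have D'_old: "D' \<rho> = D \<rho>" if "\<rho> \<in> faces X (Suc m)" for \<rho>
    using that fresh_face by (auto simp: D'_def faces_iff)
  have D'_child: "D' (child x) = (if w \<in> child x then Suc k else k)" for x
    using child_mem(3)[of x] \<tau>'(3) by (simp add: D'_def)
  have w_child: "w \<in> child x \<longleftrightarrow> x \<noteq> w" for x using \<tau>'(2) wv by (auto simp: child_def)
  have core_faces': "core_faces m w X' = (core_faces m w X - {\<tau>}) \<union> child ` (\<tau> - {w})"
    unfolding top_faces using w_child by blast
  have A': "{\<rho> \<in> core_faces m w X'. D' \<rho> = k} = A - {\<tau>}"
  proof (rule set_eqI)
    fix \<rho>
    have f: "\<rho> \<notin> faces X (Suc m)" if "\<rho> \<in> child ` (\<tau> - {w})"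
      using that child_not_old unfolding faces_def by blast
    have D: "D' \<rho> = Suc k" if \<rho>: "\<rho> \<in> child ` (\<tau> - {w})"
    proof -
      obtain x where "x \<noteq> w" "\<rho> = child x" using \<rho> by blast
      then show ?thesis using D'_child[of x] w_child[of x] by simp
    qed
    have "\<rho> \<in> {\<rho> \<in> core_faces m w X'. D' \<rho> = k} \<longleftrightarrow>
        (\<rho> \<in> faces X (Suc m) \<and> w \<in> \<rho> \<and> \<rho> \<noteq> \<tau> \<or> \<rho> \<in> child ` (\<tau> - {w})) \<and> D' \<rho> = k"
      unfolding core_faces' by (simp only: mem_Collect_eq Un_iff Diff_iff singleton_iff conj_assoc)
    also have "\<dots> \<longleftrightarrow> \<rho> \<in> faces X (Suc m) \<and> w \<in> \<rho> \<and> D \<rho> = k \<and> \<rho> \<noteq> \<tau>"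
    proof (cases "\<rho> \<in> child ` (\<tau> - {w})")
      case True
      then show ?thesis using f[OF True] D[OF True] by (simp only: simp_thms n_not_Suc_n)
    next
      case False
      show ?thesis
      proof (cases "\<rho> \<in> faces X (Suc m)")
        case True
        show ?thesis using False D'_old[OF True] by (simp only: simp_thms conj_ac)
      qed (use False in \<open>simp only: simp_thms\<close>)
    qed
    also have "\<dots> \<longleftrightarrow> \<rho> \<in> A - {\<tau>}"
      unfolding A_def by (simp only: mem_Collect_eq Diff_iff singleton_iff conj_assoc)
    finally show "\<rho> \<in> {\<rho> \<in> core_faces m w X'. D' \<rho> = k} \<longleftrightarrow> \<rho> \<in> A - {\<tau>}" .
  qed
  have finA: "finite A" and finI: "finite (core_faces m w X)" using finite_faces[OF finX(1)] by (auto simp: A_def)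
  then have cardA': "card {\<rho> \<in> core_faces m w X'. D' \<rho> = k} = n" unfolding A' using \<tau> cardA by simp
  have "card (core_faces m w X') = card (core_faces m w X - {\<tau>}) + card (child ` (\<tau> - {w}))"
  proof -
    have "(core_faces m w X - {\<tau>}) \<inter> child ` (\<tau> - {w}) = {}" using child_not_old unfolding faces_def by blast
    then show ?thesis unfolding core_faces' using finI \<tau>_mem by (intro card_Un_disjoint) simp_all
  qed
  also have "card (child ` (\<tau> - {w})) = m"
    using card_image[OF inj_on_subset[OF inj_child, of "\<tau> - {w}"]] \<tau>_mem \<tau>' by auto
  finally have cardI: "card (core_faces m w X') + 1 = card (core_faces m w X) + m"
    using card_Suc_Diff1[OF finI, of \<tau>] \<tau>' by simp
  have le: "D' \<rho> \<le> Suc k" if mem: "\<rho> \<in> faces X' (Suc m)" for \<rho>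
  proof -
    consider "\<rho> \<in> faces X (Suc m)" | x where "\<rho> = child x" using mem unfolding top_faces by blast
    then show ?thesis
    proof cases
      case 1
      then show ?thesis using D'_old[OF 1] Suc(4)[OF 1] by simp
    next
      case 2
      then show ?thesis using D'_child[of x] by simp
    qed
  qed
  have ge: "k \<le> D' \<rho>" if mem: "\<rho> \<in> core_faces m w X'" for \<rho>
  proof -
    consider "\<rho> \<in> core_faces m w X" | x where "\<rho> = child x" using mem unfolding core_faces' by blast
    then show ?thesis
    proof cases
      case 1
      then show ?thesis using D'_old[of \<rho>] Suc(5)[OF 1] by simp
    next
      case 2
      then show ?thesis using D'_child[of x] by simp
    qed
  qed
  obtain Z E where Z: "layered m w Z E" "\<forall>\<tau>\<in>faces Z (Suc m). E \<tau> \<le> Suc k" "\<forall>\<tau>\<in>core_faces m w Z. E \<tau> = Suc k"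
    "card (core_faces m w Z) + n = card (core_faces m w X') + m * n"
    using Suc(1)[OF cardA'[symmetric] lay le ge] unfolding cardA' by blast
  have "card (core_faces m w Z) + card A = card (core_faces m w X) + m * card A"
    using Z(4) cardI unfolding cardA by simp
  then show ?case using Z unfolding A_def by blast
qed

lemma layered_exists:
  assumes "k \<ge> 1"
  shows "\<exists>X D. layered m (Suc m) X D \<and> (\<forall>\<tau>\<in>faces X (Suc m). D \<tau> \<le> k) \<and>
     (\<forall>\<tau>\<in>core_faces m (Suc m) X. D \<tau> = k) \<and> card (core_faces m (Suc m) X) = Suc m * m ^ (k - 1)"
  using assms
proof (induction k rule: dec_induct)
  case base
  interpret starring m "Pow {..m}" "{..m}" "Suc m" by (rule starring_simplex) simp
  have "core_faces m (Suc m) X' = child ` {..m}"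
    unfolding top_faces top_face_simplex using child_mem(3) by auto
  then have "card (core_faces m (Suc m) X') = Suc m" using card_image[OF inj_child] by simp
  then show ?case using layered.base[of m "Suc m"] by (intro exI[of _ X'] exI[of _ "\<lambda>_. 1"]) simp
next
  case (step k)
  then obtain X D where X: "layered m (Suc m) X D" "\<forall>\<tau>\<in>faces X (Suc m). D \<tau> \<le> k"
    "\<forall>\<tau>\<in>core_faces m (Suc m) X. D \<tau> = k" and card: "card (core_faces m (Suc m) X) = Suc m * m ^ (k - 1)"
    by blast
  have all: "{\<tau> \<in> core_faces m (Suc m) X. D \<tau> = k} = core_faces m (Suc m) X" using X(3) by auto
  have "\<exists>X' D'. layered m (Suc m) X' D' \<and> (\<forall>\<tau>\<in>faces X' (Suc m). D' \<tau> \<le> Suc k) \<and>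
     (\<forall>\<tau>\<in>core_faces m (Suc m) X'. D' \<tau> = Suc k) \<and>
     card (core_faces m (Suc m) X') + card {\<tau> \<in> core_faces m (Suc m) X. D \<tau> = k} =
     card (core_faces m (Suc m) X) + m * card {\<tau> \<in> core_faces m (Suc m) X. D \<tau> = k}"
    using X by (intro layered_round[OF X(1)]) (auto intro: le_SucI)
  then obtain X' D' where X': "layered m (Suc m) X' D'" "\<forall>\<tau>\<in>faces X' (Suc m). D' \<tau> \<le> Suc k"
     "\<forall>\<tau>\<in>core_faces m (Suc m) X'. D' \<tau> = Suc k"
     "card (core_faces m (Suc m) X') = m * card (core_faces m (Suc m) X)"
    unfolding all by auto
  have "m * (Suc m * m ^ (k - 1)) = Suc m * m ^ (Suc k - 1)"
    using step.hyps by (cases k) (auto simp: algebra_simps)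
  then have card': "card (core_faces m (Suc m) X') = Suc m * m ^ (Suc k - 1)"
    unfolding X'(4) card .
  show ?case using X'(1-3) card' by blast
qed

section \<open>Both families consist of balls\<close>

lemma simplicial_ball_stack:
  fixes X :: "'a::linorder set set"
  assumes ball: "simplicial_ball m X" and dim: "\<And>\<sigma>. \<sigma> \<in> X \<Longrightarrow> card \<sigma> \<le> Suc m"
    and F: "F \<in> free_facets m X" and v: "v \<notin> \<Union>X" and m: "m \<ge> 1"
  shows "simplicial_ball m (X \<union> Pow (insert v F))"
proof -
  have X: "abstract_simplicial_complex X"
    and homeo: "geometric_realization X homeomorphic_space Euclidean_ball m"
    using ball by (auto simp: simplicial_ball_def)
  interpret stacking m X F v using X dim F v by unfold_locales
  obtain \<tau> where \<tau>: "\<tau> \<in> faces X (Suc m)" "F \<subseteq> \<tau>"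
    and uniq: "\<And>\<rho>. \<rho> \<in> faces X (Suc m) \<Longrightarrow> F \<subseteq> \<rho> \<Longrightarrow> \<rho> = \<tau>"
    using F unfolding free_facets_def by blast
  have f\<tau>: "finite \<tau>" "card \<tau> = Suc m" "\<tau> \<in> X" using \<tau> complexD(3)[OF X] by (auto simp: faces_iff)
  have "card (\<tau> - F) = 1" using \<tau>(2) F_mem f\<tau> by (simp add: card_Diff_subset)
  then obtain w where "\<tau> - F = {w}" by (auto simp: card_1_singleton_iff)
  then have w: "\<tau> = insert w F" "w \<notin> F" using \<tau>(2) by auto
  have sub: "\<rho> \<subseteq> insert w F" if "\<rho> \<in> X" "F \<subseteq> \<rho>" for \<rho>
  proof (cases "card \<rho> = Suc m")
    case True
    then show ?thesis using uniq[of \<rho>] that w by (simp add: faces_iff)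
  next
    case False
    then have "card \<rho> \<le> card F" using dim[OF that(1)] F_mem by simp
    then have "F = \<rho>" using that complexD(3)[OF X that(1)] by (intro card_seteq) auto
    then show ?thesis by auto
  qed
  have "F \<noteq> {}" using F_mem m by auto
  moreover have "insert w F \<in> X" using f\<tau>(3) unfolding w(1) .
  ultimately have "geometric_realization X' homeomorphic_space geometric_realization X"
    using X w(2) v sub by (intro realization_stacked)
  then show ?thesis
    unfolding simplicial_ball_def using complex' homeomorphic_space_trans[OF _ homeo] by blast
qed

lemma simplicial_ball_starred:
  assumes ball: "simplicial_ball m X" and "starring m X \<tau> v"
  shows "simplicial_ball m (starred_at X \<tau> v)"
proof -
  interpret starring m X \<tau> v by fact
  have homeo: "geometric_realization X homeomorphic_space Euclidean_ball m"
    using ball by (auto simp: simplicial_ball_def)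
  have "geometric_realization X' homeomorphic_space geometric_realization X"
    using complex \<tau>_mem(1,5) fresh maximal by (intro realization_starred)
  then show ?thesis
    unfolding simplicial_ball_def using complex' homeomorphic_space_trans[OF _ homeo] by blast
qed

lemma stacked_ball:
  assumes "stacked m X" "m \<ge> 1"
  shows "simplicial_ball m X"
  using assms(1)
proof induction
  case simplex
  show ?case by (rule simplicial_ball_simplex)
next
  case (stack X F v)
  then show ?case using stacked_complex(2)[OF stack.hyps(1)] assms(2) by (intro simplicial_ball_stack)
qed

lemma layered_ball:
  assumes "layered m w X D"
  shows "simplicial_ball m X"
  using assms
proof induction
  case base
  then show ?case by (intro simplicial_ball_starred simplicial_ball_simplex starring_simplex)
next
  case (star X D \<tau> v)
  then show ?case using layered_starring by (intro simplicial_ball_starred)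
qed

section \<open>Estimates of the coboundary Cheeger number and of the spectral gap\<close>

lemma simplexes_eq_faces:
  "simplexes X (int m - 1) = faces X m" "simplexes X (int m - 1 + 1) = faces X (Suc m)"
  by (auto simp: simplexes_def faces_def)

lemma coboundary_faces:
  assumes "abstract_simplicial_complex X"
  shows "coboundary X (int m - 1) \<phi> \<tau> = (if \<tau> \<in> faces X (Suc m) then cobd \<phi> \<tau> else 0)"
proof (cases "\<tau> \<in> faces X (Suc m)")
  case True
  then show ?thesis using coboundary_eq_cobd[OF assms, of \<tau> "int m - 1" \<phi>] simplexes_eq_faces(2) by metis
next
  case False
  then show ?thesis unfolding coboundary_def simplexes_eq_faces by simp
qed

lemma cobd_eq_sum:
  assumes X: "abstract_simplicial_complex X" and \<tau>: "\<tau> \<in> faces X (Suc m)"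
  shows "cobd \<phi> \<tau> = (\<Sum>\<sigma>\<in>faces X m. boundary_coeff \<tau> \<sigma> * \<phi> \<sigma>)"
  using coboundary_eq_cobd[OF X, of \<tau> "int m - 1" \<phi>] \<tau>
  unfolding coboundary_def simplexes_eq_faces by simp

lemma cochains_iff: "\<phi> \<in> cochains X (int m - 1) \<longleftrightarrow> (\<forall>\<sigma>. \<sigma> \<notin> faces X m \<longrightarrow> \<phi> \<sigma> = 0)"
  by (simp only: cochains_def simplexes_eq_faces mem_Collect_eq)

lemma coboundariesD:
  fixes g :: "'a::linorder set \<Rightarrow> 'f::field"
  assumes X: "abstract_simplicial_complex X" and g: "g \<in> coboundaries X (int m - 1)"
  shows "g \<in> cochains X (int m - 1)" "\<tau> \<in> faces X (Suc m) \<Longrightarrow> cobd g \<tau> = 0"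
proof -
  obtain \<psi> where \<psi>: "g = coboundary X (int m - 1 - 1) \<psi>" using g by (auto simp: coboundaries_def)
  have s: "simplexes X (int m - 1 - 1 + 1) = faces X m" by (auto simp: simplexes_def faces_def)
  have g_eq: "g \<sigma> = cobd \<psi> \<sigma>" if "\<sigma> \<in> faces X m" for \<sigma>
    unfolding \<psi> using that by (intro coboundary_eq_cobd[OF X]) (simp only: s)
  show "g \<in> cochains X (int m - 1)"
    unfolding cochains_iff \<psi> coboundary_def s by simp
  show "cobd g \<tau> = 0" if \<tau>: "\<tau> \<in> faces X (Suc m)"
  proof -
    have fin: "finite \<tau>" "\<tau> \<in> X" "card \<tau> = Suc m" using \<tau> complexD(3)[OF X] by (auto simp: faces_iff)
    have "cobd g \<tau> = cobd (cobd \<psi>) \<tau>"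
    proof (rule cobd_cong, rule g_eq)
      fix x assume "x \<in> \<tau>"
      then show "\<tau> - {x} \<in> faces X m" using fin complexD(4)[OF X fin(2)] by (auto simp: faces_iff)
    qed
    then show ?thesis using cobd_cobd[OF fin(1)] by simp
  qed
qed

lemma coboundariesI:
  fixes \<phi> :: "'a::linorder set \<Rightarrow> 'f::field"
  assumes X: "abstract_simplicial_complex X" and ex: "exact_at TYPE('f) X m"
    and \<phi>: "\<phi> \<in> cochains X (int m - 1)" and z: "\<And>\<tau>. \<tau> \<in> faces X (Suc m) \<Longrightarrow> cobd \<phi> \<tau> = 0"
  shows "\<phi> \<in> coboundaries X (int m - 1)"
proof -
  have s: "simplexes X (int m - 1 - 1 + 1) = faces X m" by (auto simp: simplexes_def faces_def)
  obtain \<psi> where \<psi>: "\<And>\<sigma>. \<sigma> \<in> X \<Longrightarrow> card \<sigma> = m \<Longrightarrow> cobd \<psi> \<sigma> = \<phi> \<sigma>"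
    using exact_atD[OF ex] z by (metis faces_iff)
  define \<psi>0 where "\<psi>0 \<rho> = (if \<rho> \<in> simplexes X (int m - 1 - 1) then \<psi> \<rho> else 0)" for \<rho>
  have "coboundary X (int m - 1 - 1) \<psi>0 \<sigma> = \<phi> \<sigma>" for \<sigma>
  proof (cases "\<sigma> \<in> faces X m")
    case True
    then have \<sigma>: "finite \<sigma>" "\<sigma> \<in> X" "card \<sigma> = m" using complexD(3)[OF X] by (auto simp: faces_iff)
    have "coboundary X (int m - 1 - 1) \<psi>0 \<sigma> = cobd \<psi>0 \<sigma>"
      using True by (intro coboundary_eq_cobd[OF X]) (simp only: s)
    also have "\<dots> = cobd \<psi> \<sigma>"
    proof (rule cobd_cong)
      fix x assume "x \<in> \<sigma>"
      then have "Suc (card (\<sigma> - {x})) = m" using \<sigma> card_Suc_Diff1 by metis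
      moreover have "\<sigma> - {x} \<in> X" using complexD(4)[OF X \<sigma>(2)] by auto
      ultimately show "\<psi>0 (\<sigma> - {x}) = \<psi> (\<sigma> - {x})"
        by (auto simp: \<psi>0_def simplexes_def)
    qed
    finally show ?thesis using \<psi> \<sigma> by simp
  next
    case False
    then show ?thesis using \<phi> unfolding cochains_iff coboundary_def s by simp
  qed
  then have "\<phi> = coboundary X (int m - 1 - 1) \<psi>0" by auto
  moreover have "\<psi>0 \<in> cochains X (int m - 1 - 1)" by (auto simp: cochains_def \<psi>0_def)
  ultimately show ?thesis unfolding coboundaries_def by blast
qed

lemma zero_mem_coboundaries: "(\<lambda>_. 0) \<in> coboundaries X k"
proof -
  have "(\<lambda>_. 0) = coboundary X (k - 1) (\<lambda>_. 0)" by (auto simp: coboundary_def)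
  moreover have "(\<lambda>_. 0) \<in> cochains X (k - 1)" by (simp add: cochains_def)
  ultimately show ?thesis unfolding coboundaries_def by blast
qed

lemma restrict_cochain:
  fixes f :: "'a::linorder set \<Rightarrow> 'f::field"
  assumes X: "abstract_simplicial_complex X"
  obtains f0 where "f0 \<in> cochains X (int m - 1)" "\<And>\<sigma>. \<sigma> \<in> faces X m \<Longrightarrow> f0 \<sigma> = f \<sigma>"
    "\<And>\<tau>. \<tau> \<in> faces X (Suc m) \<Longrightarrow> cobd f0 \<tau> = cobd f \<tau>"
proof
  define f0 where "f0 \<sigma> = (if \<sigma> \<in> faces X m then f \<sigma> else 0)" for \<sigma>
  show "f0 \<in> cochains X (int m - 1)" by (simp add: cochains_iff f0_def)
  show eq: "f0 \<sigma> = f \<sigma>" if "\<sigma> \<in> faces X m" for \<sigma> using that by (simp add: f0_def)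
  show "cobd f0 \<tau> = cobd f \<tau>" if "\<tau> \<in> faces X (Suc m)" for \<tau>
    unfolding cobd_eq_sum[OF X that] using eq by simp
qed

lemma hamming_faces:
  "hamming_norm X (int m - 1) \<phi> = card {\<sigma> \<in> faces X m. \<phi> \<sigma> = 1}"
  "hamming_norm X (int m - 1 + 1) \<phi> = card {\<sigma> \<in> faces X (Suc m). \<phi> \<sigma> = 1}"
  unfolding hamming_norm_def simplexes_eq_faces by simp_all

lemma finite_cochains_bit:
  assumes "finite X"
  shows "finite (cochains X k :: ('a set \<Rightarrow> bit) set)"
proof -
  have "cochains X k \<subseteq> (\<lambda>A \<sigma>. of_bool (\<sigma> \<in> A) :: bit) ` Pow (simplexes X k)"
  proof
    fix \<phi> :: "'a set \<Rightarrow> bit" assume "\<phi> \<in> cochains X k"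
    then have "\<phi> = (\<lambda>\<sigma>. of_bool (\<sigma> \<in> {\<sigma> \<in> simplexes X k. \<phi> \<sigma> = 1}))"
      unfolding cochains_def by (auto simp: fun_eq_iff)
    then show "\<phi> \<in> (\<lambda>A \<sigma>. of_bool (\<sigma> \<in> A) :: bit) ` Pow (simplexes X k)" by blast
  qed
  moreover have "finite (simplexes X k)" using assms by (simp add: simplexes_def)
  ultimately show ?thesis using finite_subset by blast
qed

text \<open>
  The denominator in the definition of the Cheeger number.
\<close>

definition coset_weight :: "nat \<Rightarrow> 'a::linorder set set \<Rightarrow> ('a set \<Rightarrow> bit) \<Rightarrow> nat" where
  "coset_weight m X \<phi> =
     (MIN \<psi> \<in> coboundaries X (int m - 1). hamming_norm X (int m - 1) (\<lambda>\<sigma>. \<phi> \<sigma> + \<psi> \<sigma>))"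

definition cheeger_ratio :: "nat \<Rightarrow> 'a::linorder set set \<Rightarrow> ('a set \<Rightarrow> bit) \<Rightarrow> real" where
  "cheeger_ratio m X \<phi> =
     real (hamming_norm X (int m - 1 + 1) (coboundary X (int m - 1) \<phi>)) / real (coset_weight m X \<phi>)"

lemma cheeger_number_eq:
  "cheeger_number (int m - 1) X =
     Min (cheeger_ratio m X ` (cochains X (int m - 1) - coboundaries X (int m - 1)))"
  by (simp add: cheeger_number_def cheeger_ratio_def[abs_def] coset_weight_def)

context
  fixes X :: "'a::linorder set set" and m :: nat
  assumes X: "abstract_simplicial_complex X"
begin

lemma finite_coboundaries_bit: "finite (coboundaries X (int m - 1) :: ('a set \<Rightarrow> bit) set)"
proof (rule finite_subset)
  show "(coboundaries X (int m - 1) :: ('a set \<Rightarrow> bit) set) \<subseteq> cochains X (int m - 1)"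
    using coboundariesD(1)[OF X] by blast
  show "finite (cochains X (int m - 1) :: ('a set \<Rightarrow> bit) set)"
    by (rule finite_cochains_bit[OF complexD(1)[OF X]])
qed

lemma coset_weight_le:
  "\<psi> \<in> coboundaries X (int m - 1) \<Longrightarrow> coset_weight m X \<phi> \<le> card {\<sigma> \<in> faces X m. \<phi> \<sigma> + \<psi> \<sigma> = 1}"
  unfolding coset_weight_def hamming_faces using finite_coboundaries_bit by (intro Min_le) auto

lemma coset_weight_attained:
  obtains \<psi> where "\<psi> \<in> coboundaries X (int m - 1)"
    "coset_weight m X \<phi> = card {\<sigma> \<in> faces X m. \<phi> \<sigma> + \<psi> \<sigma> = 1}"
proof -
  have "coset_weight m X \<phi> \<in>
      (\<lambda>\<psi>. card {\<sigma> \<in> faces X m. \<phi> \<sigma> + \<psi> \<sigma> = 1}) ` coboundaries X (int m - 1)"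
    unfolding coset_weight_def hamming_faces
    using finite_coboundaries_bit zero_mem_coboundaries by (intro Min_in) blast+
  then show ?thesis using that by blast
qed

lemma hamming_coboundary:
  "hamming_norm X (int m - 1 + 1) (coboundary X (int m - 1) \<phi>) = card {\<tau> \<in> faces X (Suc m). cobd \<phi> \<tau> = 1}"
  unfolding hamming_faces coboundary_faces[OF X] by (intro arg_cong[of _ _ card]) auto

lemma finite_ratio_domain:
  "finite (cochains X (int m - 1) - coboundaries X (int m - 1) :: ('a set \<Rightarrow> bit) set)"
  using finite_cochains_bit[OF complexD(1)[OF X]] by blast

lemma not_coboundary:
  fixes \<phi> :: "'a set \<Rightarrow> 'f::field"
  assumes "\<tau> \<in> faces X (Suc m)" "cobd \<phi> \<tau> \<noteq> 0"
  shows "\<phi> \<notin> coboundaries X (int m - 1)"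
  using coboundariesD(2)[OF X _ assms(1)] assms(2) by blast

text \<open>
  Adding up the fillings of the simplexes in \<open>\<delta> \<phi>\<close> gives a cochain \<open>\<phi>'\<close> with \<open>\<delta> \<phi>' = \<delta> \<phi>\<close> and at most
  \<open>k\<close> times as many facets. By exactness it represents the class of \<open>\<phi>\<close>.
\<close>

lemma cheeger_number_ge:
  assumes ex: "exact_at TYPE(bit) X m" and ne: "faces X (Suc m) \<noteq> {}" and k: "k \<ge> 1"
    and fill: "\<And>\<tau>. \<tau> \<in> faces X (Suc m) \<Longrightarrow> \<exists>\<phi> :: 'a set \<Rightarrow> bit.
      (\<forall>\<sigma>. \<phi> \<sigma> \<noteq> 0 \<longrightarrow> \<sigma> \<in> faces X m) \<and>
      (\<forall>\<tau>'\<in>faces X (Suc m). cobd \<phi> \<tau>' = of_bool (\<tau>' = \<tau>)) \<and> card {\<sigma>. \<phi> \<sigma> \<noteq> 0} \<le> k"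
  shows "cheeger_number (int m - 1) X \<ge> 1 / real k"
proof -
  let ?A = "cochains X (int m - 1) - coboundaries X (int m - 1) :: ('a set \<Rightarrow> bit) set"
  obtain \<Phi> :: "'a set \<Rightarrow> 'a set \<Rightarrow> bit" where supp: "\<And>\<tau> \<sigma>. \<tau> \<in> faces X (Suc m) \<Longrightarrow> \<Phi> \<tau> \<sigma> \<noteq> 0 \<Longrightarrow> \<sigma> \<in> faces X m"
    and cob: "\<And>\<tau> \<tau>'. \<tau> \<in> faces X (Suc m) \<Longrightarrow> \<tau>' \<in> faces X (Suc m) \<Longrightarrow> cobd (\<Phi> \<tau>) \<tau>' = of_bool (\<tau>' = \<tau>)"
    and size: "\<And>\<tau>. \<tau> \<in> faces X (Suc m) \<Longrightarrow> card {\<sigma>. \<Phi> \<tau> \<sigma> \<noteq> 0} \<le> k"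
    using fill by metis
  have fin: "finite (faces X m)" "finite (faces X (Suc m))" using complexD(1)[OF X] by (auto intro: finite_faces)
  obtain \<tau> where \<tau>: "\<tau> \<in> faces X (Suc m)" using ne by blast
  have "\<Phi> \<tau> \<in> cochains X (int m - 1)" using supp[OF \<tau>] unfolding cochains_iff by blast
  moreover have "\<Phi> \<tau> \<notin> coboundaries X (int m - 1)"
    using not_coboundary[OF \<tau>, of "\<Phi> \<tau>"] cob[OF \<tau> \<tau>] by simp
  ultimately have A: "?A \<noteq> {}" by blast
  have "1 / real k \<le> cheeger_ratio m X \<phi>" if \<phi>: "\<phi> \<in> ?A" for \<phi>
  proof -
    define T where "T = {\<tau> \<in> faces X (Suc m). cobd \<phi> \<tau> = 1}"
    have T: "finite T" "T \<subseteq> faces X (Suc m)" using fin by (auto simp: T_def)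
    define \<phi>' where "\<phi>' = (\<lambda>\<sigma>. \<Sum>\<tau>\<in>T. \<Phi> \<tau> \<sigma>)"
    have "cobd \<phi>' \<tau>' = cobd \<phi> \<tau>'" if \<tau>': "\<tau>' \<in> faces X (Suc m)" for \<tau>'
    proof -
      have "cobd \<phi>' \<tau>' = (\<Sum>\<tau>\<in>T. cobd (\<Phi> \<tau>) \<tau>')" unfolding \<phi>'_def by (rule cobd_sum)
      also have "\<dots> = (\<Sum>\<tau>\<in>T. if \<tau>' = \<tau> then 1 else 0)"
        using T cob[OF _ \<tau>'] by (intro sum.cong) auto
      also have "\<dots> = of_bool (\<tau>' \<in> T)" using T by simp
      also have "\<dots> = cobd \<phi> \<tau>'" using \<tau>' by (cases "cobd \<phi> \<tau>'") (auto simp: T_def)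
      finally show ?thesis .
    qed
    then have diff: "cobd (\<lambda>\<sigma>. \<phi>' \<sigma> - \<phi> \<sigma>) \<tau>' = 0" if "\<tau>' \<in> faces X (Suc m)" for \<tau>'
      unfolding cobd_diff using that by simp
    have "\<phi>' \<in> cochains X (int m - 1)"
      unfolding cochains_iff \<phi>'_def using supp T by (intro allI impI sum.neutral) blast
    then have "(\<lambda>\<sigma>. \<phi>' \<sigma> - \<phi> \<sigma>) \<in> cochains X (int m - 1)" using \<phi> by (simp add: cochains_iff)
    then have "(\<lambda>\<sigma>. \<phi>' \<sigma> - \<phi> \<sigma>) \<in> coboundaries X (int m - 1)" using diff by (rule coboundariesI[OF X ex])
    from coset_weight_le[OF this, of \<phi>]
    have "coset_weight m X \<phi> \<le> card {\<sigma> \<in> faces X m. \<phi> \<sigma> + (\<phi>' \<sigma> - \<phi> \<sigma>) = 1}" .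
    also have "\<dots> \<le> card (\<Union>\<tau>\<in>T. {\<sigma>. \<Phi> \<tau> \<sigma> \<noteq> 0})"
    proof (rule card_mono)
      show "finite (\<Union>\<tau>\<in>T. {\<sigma>. \<Phi> \<tau> \<sigma> \<noteq> 0})"
        using supp T by (intro finite_subset[OF _ fin(1)]) blast
      show "{\<sigma> \<in> faces X m. \<phi> \<sigma> + (\<phi>' \<sigma> - \<phi> \<sigma>) = 1} \<subseteq> (\<Union>\<tau>\<in>T. {\<sigma>. \<Phi> \<tau> \<sigma> \<noteq> 0})"
      proof
        fix \<sigma> assume "\<sigma> \<in> {\<sigma> \<in> faces X m. \<phi> \<sigma> + (\<phi>' \<sigma> - \<phi> \<sigma>) = 1}"
        moreover have "\<phi> \<sigma> + (\<phi>' \<sigma> - \<phi> \<sigma>) = \<phi>' \<sigma>" by (cases "\<phi> \<sigma>"; cases "\<phi>' \<sigma>") simp_all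
        ultimately have "\<phi>' \<sigma> \<noteq> 0" by simp
        then show "\<sigma> \<in> (\<Union>\<tau>\<in>T. {\<sigma>. \<Phi> \<tau> \<sigma> \<noteq> 0})"
          unfolding \<phi>'_def by (meson UN_I mem_Collect_eq sum.neutral)
      qed
    qed
    also have "\<dots> \<le> (\<Sum>\<tau>\<in>T. card {\<sigma>. \<Phi> \<tau> \<sigma> \<noteq> 0})" using T by (intro card_UN_le)
    also have "\<dots> \<le> (\<Sum>\<tau>\<in>T. k)" using T size by (intro sum_mono) blast
    finally have le: "coset_weight m X \<phi> \<le> card T * k" by simp
    have "coset_weight m X \<phi> \<noteq> 0"
    proof
      assume 0: "coset_weight m X \<phi> = 0"
      obtain \<psi> where \<psi>: "\<psi> \<in> coboundaries X (int m - 1)"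
        "coset_weight m X \<phi> = card {\<sigma> \<in> faces X m. \<phi> \<sigma> + \<psi> \<sigma> = 1}"
        using coset_weight_attained .
      then have emp: "{\<sigma> \<in> faces X m. \<phi> \<sigma> + \<psi> \<sigma> = 1} = {}" using 0 fin(1) by simp
      have "\<phi> \<sigma> = \<psi> \<sigma>" for \<sigma>
      proof (cases "\<sigma> \<in> faces X m")
        case True
        then have "\<phi> \<sigma> + \<psi> \<sigma> \<noteq> 1" using emp by blast
        then show ?thesis by (cases "\<phi> \<sigma>"; cases "\<psi> \<sigma>") simp_all
      next
        case False
        then show ?thesis using \<phi> coboundariesD(1)[OF X \<psi>(1)] by (simp add: cochains_iff)
      qed
      then have "\<phi> = \<psi>" by (rule ext)
      then show False using \<phi> \<psi>(1) by simp
    qed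
    then have pos: "real (coset_weight m X \<phi>) > 0" by simp
    have "real (coset_weight m X \<phi>) \<le> real (card T) * real k"
      using le by (metis of_nat_le_iff of_nat_mult)
    then show ?thesis
      unfolding cheeger_ratio_def hamming_coboundary T_def[symmetric]
      using pos k by (simp add: field_simps)
  qed
  then show ?thesis
    unfolding cheeger_number_eq using A finite_ratio_domain by (subst Min_ge_iff) auto
qed

text \<open>
  All elements of the class of a filling \<open>\<phi>\<close> of \<open>\<tau>\<close> are fillings of \<open>\<tau>\<close>, hence of weight at least \<open>k\<close>.
\<close>

lemma cheeger_number_le:
  fixes \<phi> :: "'a set \<Rightarrow> bit"
  assumes k: "k \<ge> 1" and \<tau>: "\<tau> \<in> faces X (Suc m)"
    and \<phi>: "\<And>\<tau>'. \<tau>' \<in> faces X (Suc m) \<Longrightarrow> cobd \<phi> \<tau>' = of_bool (\<tau>' = \<tau>)"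
    and deep: "\<And>\<phi> :: 'a set \<Rightarrow> bit. (\<forall>\<tau>'\<in>faces X (Suc m). cobd \<phi> \<tau>' = of_bool (\<tau>' = \<tau>)) \<Longrightarrow>
      k \<le> card {\<sigma> \<in> faces X m. \<phi> \<sigma> = 1}"
  shows "0 \<le> cheeger_number (int m - 1) X" "cheeger_number (int m - 1) X \<le> 1 / real k"
proof -
  let ?A = "cochains X (int m - 1) - coboundaries X (int m - 1) :: ('a set \<Rightarrow> bit) set"
  obtain \<phi>0 where \<phi>0: "\<phi>0 \<in> cochains X (int m - 1)"
    "\<And>\<tau>. \<tau> \<in> faces X (Suc m) \<Longrightarrow> cobd \<phi>0 \<tau> = cobd \<phi> \<tau>"
    using restrict_cochain[OF X, of m \<phi>] by metis
  have "\<phi>0 \<notin> coboundaries X (int m - 1)"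
    using not_coboundary[OF \<tau>, of \<phi>0] \<phi>0(2)[OF \<tau>] \<phi>[OF \<tau>] by simp
  then have A: "\<phi>0 \<in> ?A" using \<phi>0(1) by blast
  obtain \<psi> where \<psi>: "\<psi> \<in> coboundaries X (int m - 1)"
    "coset_weight m X \<phi>0 = card {\<sigma> \<in> faces X m. \<phi>0 \<sigma> + \<psi> \<sigma> = 1}"
    using coset_weight_attained .
  have "k \<le> coset_weight m X \<phi>0"
    unfolding \<psi>(2)
  proof (rule deep, rule ballI)
    fix \<tau>' assume "\<tau>' \<in> faces X (Suc m)"
    then show "cobd (\<lambda>\<sigma>. \<phi>0 \<sigma> + \<psi> \<sigma>) \<tau>' = of_bool (\<tau>' = \<tau>)"
      unfolding cobd_add using \<phi>0(2) \<phi> coboundariesD(2)[OF X \<psi>(1)] by simp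
  qed
  moreover have "{\<tau>' \<in> faces X (Suc m). cobd \<phi>0 \<tau>' = 1} = {\<tau>}"
    using \<phi>0(2) \<phi> \<tau> by auto
  ultimately have "cheeger_ratio m X \<phi>0 \<le> 1 / real k"
    unfolding cheeger_ratio_def hamming_coboundary using k by (simp add: frac_le)
  moreover have "cheeger_number (int m - 1) X \<le> cheeger_ratio m X \<phi>0"
    unfolding cheeger_number_eq using A finite_ratio_domain by (intro Min_le) auto
  ultimately show "cheeger_number (int m - 1) X \<le> 1 / real k" by simp
  have "\<forall>\<phi>\<in>?A. 0 \<le> cheeger_ratio m X \<phi>" by (simp add: cheeger_ratio_def)
  then show "0 \<le> cheeger_number (int m - 1) X"
    unfolding cheeger_number_eq using A finite_ratio_domain by (subst Min_ge_iff) auto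
qed

lemma l2_faces:
  "(l2_norm X (int m - 1) f)\<^sup>2 = energy (faces X m) f"
  "(l2_norm X (int m - 1 + 1) (coboundary X (int m - 1) f))\<^sup>2 = energy (faces X (Suc m)) (cobd f)"
  unfolding l2_norm_def simplexes_eq_faces coboundary_faces[OF X] by (simp_all add: sum_nonneg)

definition coset_energy :: "('a set \<Rightarrow> real) \<Rightarrow> real" where
  "coset_energy f = (INF g \<in> coboundaries X (int m - 1). \<Sum>\<sigma>\<in>faces X m. (f \<sigma> + g \<sigma>)\<^sup>2)"

lemma coset_energy_ge:
  assumes "\<And>g. g \<in> coboundaries X (int m - 1) \<Longrightarrow> c \<le> energy (faces X m) (\<lambda>\<sigma>. f \<sigma> + g \<sigma>)"
  shows "c \<le> coset_energy f"
  unfolding coset_energy_def using zero_mem_coboundaries assms by (intro cINF_greatest) blast+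

lemma coset_energy_le:
  assumes "g \<in> coboundaries X (int m - 1)"
  shows "coset_energy f \<le> energy (faces X m) (\<lambda>\<sigma>. f \<sigma> + g \<sigma>)"
  unfolding coset_energy_def using assms
  by (intro cINF_lower bdd_belowI2[of _ 0]) (auto intro: sum_nonneg)

lemma lambda_number_eq:
  "lambda_number (int m - 1) X = (INF f \<in> cochains X (int m - 1) - coboundaries X (int m - 1).
     energy (faces X (Suc m)) (cobd f) / coset_energy f)"
  unfolding lambda_number_def l2_faces coset_energy_def ..

text \<open>
  A crude bound on the norm of the coboundary operator. It serves to show that a class outside of
  the coboundaries has positive distance from zero, as otherwise the quotient is \<open>x / 0 = 0\<close>.
\<close>

lemma coboundary_bounded:
  fixes h :: "'a set \<Rightarrow> real"
  shows "energy (faces X (Suc m)) (cobd h) \<le>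
    (\<Sum>\<tau>\<in>faces X (Suc m). \<Sum>\<sigma>\<in>faces X m. (boundary_coeff \<tau> \<sigma>)\<^sup>2) * energy (faces X m) h"
  unfolding sum_distrib_right
proof (rule sum_mono)
  fix \<tau> assume "\<tau> \<in> faces X (Suc m)"
  then have "(cobd h \<tau>)\<^sup>2 = (\<Sum>\<sigma>\<in>faces X m. boundary_coeff \<tau> \<sigma> * h \<sigma>)\<^sup>2" by (simp only: cobd_eq_sum[OF X])
  also have "\<dots> \<le> (\<Sum>\<sigma>\<in>faces X m. (boundary_coeff \<tau> \<sigma>)\<^sup>2) * energy (faces X m) h"
    by (rule Cauchy_Schwarz_ineq_sum)
  also have "\<dots> = (\<Sum>\<sigma>\<in>faces X m. (boundary_coeff \<tau> \<sigma>)\<^sup>2 * energy (faces X m) h)"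
    by (rule sum_distrib_right)
  finally show "(cobd h \<tau>)\<^sup>2 \<le> (\<Sum>\<sigma>\<in>faces X m. (boundary_coeff \<tau> \<sigma>)\<^sup>2 * energy (faces X m) h)" .
qed

text \<open>
  By exactness, a cheap filling of \<open>w = \<delta> f\<close> lies in the class of \<open>f\<close>.
\<close>

lemma lambda_number_ge:
  assumes ex: "exact_at TYPE(real) X m" and ne: "faces X (Suc m) \<noteq> {}" and c: "c > 0"
    and fill: "\<And>w :: 'a set \<Rightarrow> real. \<exists>f. (\<forall>\<tau>\<in>faces X (Suc m). cobd f \<tau> = w \<tau>) \<and>
      c * energy (faces X m) f \<le> energy (faces X (Suc m)) w"
  shows "c \<le> lambda_number (int m - 1) X"
  unfolding lambda_number_eq
proof (rule cINF_greatest)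
  let ?A = "cochains X (int m - 1) - coboundaries X (int m - 1) :: ('a set \<Rightarrow> real) set"
  have fin: "finite (faces X (Suc m))" using complexD(1)[OF X] by (rule finite_faces)
  obtain \<tau> where \<tau>: "\<tau> \<in> faces X (Suc m)" using ne by blast
  obtain f1 :: "'a set \<Rightarrow> real" where f1: "\<forall>\<tau>\<in>faces X (Suc m). cobd f1 \<tau> = 1" using fill[of "\<lambda>_. 1"] by blast
  obtain f0 where f0: "f0 \<in> cochains X (int m - 1)"
    "\<And>\<tau>. \<tau> \<in> faces X (Suc m) \<Longrightarrow> cobd f0 \<tau> = cobd f1 \<tau>"
    using restrict_cochain[OF X, of m f1] by metis
  have "cobd f0 \<tau> \<noteq> 0" using f0(2)[OF \<tau>] f1 \<tau> by simp
  then show "?A \<noteq> {}" using not_coboundary[OF \<tau>, of f0] f0(1) by blast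
  fix f assume f: "f \<in> ?A"
  define W where "W = energy (faces X (Suc m)) (cobd f)"
  define K where "K = (\<Sum>\<tau>\<in>faces X (Suc m). \<Sum>\<sigma>\<in>faces X m. (boundary_coeff \<tau> \<sigma> :: real)\<^sup>2)"
  obtain \<rho> where \<rho>: "\<rho> \<in> faces X (Suc m)" "cobd f \<rho> \<noteq> 0"
    using coboundariesI[OF X ex, of f] f by blast
  have "0 < (cobd f \<rho>)\<^sup>2" using \<rho>(2) by simp
  also have "(cobd f \<rho>)\<^sup>2 \<le> W" unfolding W_def using \<rho>(1) fin by (intro member_le_sum) auto
  finally have W: "0 < W" .
  have K0: "0 \<le> K" unfolding K_def by (intro sum_nonneg) auto
  have bound: "W \<le> K * energy (faces X m) (\<lambda>\<sigma>. f \<sigma> + g \<sigma>)" if g: "g \<in> coboundaries X (int m - 1)" for g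
  proof -
    have "W = (\<Sum>\<tau>\<in>faces X (Suc m). (cobd (\<lambda>\<sigma>. f \<sigma> + g \<sigma>) \<tau>)\<^sup>2)"
      unfolding W_def cobd_add using coboundariesD(2)[OF X g] by (intro sum.cong) auto
    also have "\<dots> \<le> K * energy (faces X m) (\<lambda>\<sigma>. f \<sigma> + g \<sigma>)" unfolding K_def by (rule coboundary_bounded)
    finally show ?thesis .
  qed
  have "K \<noteq> 0" using bound[OF zero_mem_coboundaries] W by auto
  then have K: "0 < K" using K0 by simp
  have "W / K \<le> coset_energy f"
    using bound K by (intro coset_energy_ge) (simp add: pos_divide_le_eq mult.commute)
  then have pos: "0 < coset_energy f" using W K by (meson divide_pos_pos less_le_trans)
  obtain h where h: "\<forall>\<tau>\<in>faces X (Suc m). cobd h \<tau> = cobd f \<tau>" "c * energy (faces X m) h \<le> W"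
    using fill[of "cobd f"] unfolding W_def by blast
  obtain h0 where h0: "h0 \<in> cochains X (int m - 1)" "\<And>\<sigma>. \<sigma> \<in> faces X m \<Longrightarrow> h0 \<sigma> = h \<sigma>"
    "\<And>\<tau>. \<tau> \<in> faces X (Suc m) \<Longrightarrow> cobd h0 \<tau> = cobd h \<tau>"
    using restrict_cochain[OF X, of m h] by metis
  have "(\<lambda>\<sigma>. h0 \<sigma> - f \<sigma>) \<in> coboundaries X (int m - 1)"
  proof (rule coboundariesI[OF X ex])
    show "(\<lambda>\<sigma>. h0 \<sigma> - f \<sigma>) \<in> cochains X (int m - 1)" using h0(1) f by (simp add: cochains_iff)
    show "cobd (\<lambda>\<sigma>. h0 \<sigma> - f \<sigma>) \<tau> = 0" if "\<tau> \<in> faces X (Suc m)" for \<tau>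
      using that h(1) h0(3) by (simp add: cobd_diff)
  qed
  from coset_energy_le[OF this, of f] have "coset_energy f \<le> energy (faces X m) h0" by simp
  also have "\<dots> = energy (faces X m) h" using h0(2) by (intro sum.cong) auto
  finally have "c * coset_energy f \<le> c * energy (faces X m) h" using c by (intro mult_left_mono) auto
  then have "c * coset_energy f \<le> W" using h(2) by simp
  then show "c \<le> energy (faces X (Suc m)) (cobd f) / coset_energy f"
    using pos unfolding W_def by (simp add: pos_le_divide_eq)
qed

text \<open>
  Let \<open>u\<close> be the fundamental chain and \<open>N\<close> the number of \<open>m\<close>-simplexes. Every \<open>h\<close> in the class of a filling
  of \<open>u\<close> satisfies \<open>N = \<langle>\<delta> h, u\<rangle> = \<langle>h, \<partial> u\<rangle>\<close>. As \<open>\<partial> u\<close> is supported on \<open>m + 1\<close> facets, Cauchy-Schwarz gives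
  \<open>\<parallel>h\<parallel>\<^sup>2 \<ge> N\<^sup>2 / (m + 1)\<close>, while \<open>\<parallel>\<delta> h\<parallel>\<^sup>2 = N\<close>.
\<close>

lemma lambda_number_le:
  assumes or: "oriented_with_boundary m X" and ne: "faces X (Suc m) \<noteq> {}"
    and fill: "\<And>w :: 'a set \<Rightarrow> real. \<exists>f. \<forall>\<tau>\<in>faces X (Suc m). cobd f \<tau> = w \<tau>"
  shows "lambda_number (int m - 1) X \<le> real (Suc m) / real (card (faces X (Suc m)))"
proof -
  let ?A = "cochains X (int m - 1) - coboundaries X (int m - 1) :: ('a set \<Rightarrow> real) set"
  define N where "N = real (card (faces X (Suc m)))"
  have fin: "finite (faces X (Suc m))" "finite (faces X m)" using complexD(1)[OF X] by (auto intro: finite_faces)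
  have N: "0 < N" using ne fin by (simp add: N_def card_gt_0_iff)
  obtain u :: "'a set \<Rightarrow> real" and B where u: "\<And>\<tau>. \<tau> \<in> faces X (Suc m) \<Longrightarrow> (u \<tau>)\<^sup>2 = 1"
    and B: "B \<subseteq> faces X m" "card B \<le> Suc m"
    and bd: "\<And>\<sigma>. \<sigma> \<in> faces X m \<Longrightarrow> (bdry X m u \<sigma>)\<^sup>2 = of_bool (\<sigma> \<in> B)"
    using or unfolding oriented_with_boundary_def by blast
  obtain f1 where f1: "\<forall>\<tau>\<in>faces X (Suc m). cobd f1 \<tau> = u \<tau>" using fill[of u] by blast
  obtain f where f: "f \<in> cochains X (int m - 1)"
    "\<And>\<tau>. \<tau> \<in> faces X (Suc m) \<Longrightarrow> cobd f \<tau> = u \<tau>"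
    using restrict_cochain[OF X, of m f1] f1 by metis
  obtain \<tau> where \<tau>: "\<tau> \<in> faces X (Suc m)" using ne by blast
  have "u \<tau> \<noteq> 0" using u[OF \<tau>] by auto
  then have "cobd f \<tau> \<noteq> 0" using f(2)[OF \<tau>] by simp
  then have A: "f \<in> ?A" using not_coboundary[OF \<tau>, of f] f(1) by blast
  have energy: "N\<^sup>2 / real (Suc m) \<le> energy (faces X m) (\<lambda>\<sigma>. f \<sigma> + g \<sigma>)"
    if g: "g \<in> coboundaries X (int m - 1)" for g
  proof -
    let ?h = "\<lambda>\<sigma>. f \<sigma> + g \<sigma>"
    have "N = energy (faces X (Suc m)) u" using u by (simp add: N_def)
    also have "\<dots> = (\<Sum>\<tau>\<in>faces X (Suc m). u \<tau> * cobd ?h \<tau>)"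
      using f(2) coboundariesD(2)[OF X g] by (intro sum.cong) (auto simp: cobd_add power2_eq_square)
    also have "\<dots> = (\<Sum>\<tau>\<in>faces X (Suc m). \<Sum>\<sigma>\<in>faces X m. u \<tau> * (boundary_coeff \<tau> \<sigma> * ?h \<sigma>))"
      by (intro sum.cong refl) (simp only: cobd_eq_sum[OF X] sum_distrib_left)
    also have "\<dots> = (\<Sum>\<sigma>\<in>faces X m. \<Sum>\<tau>\<in>faces X (Suc m). u \<tau> * (boundary_coeff \<tau> \<sigma> * ?h \<sigma>))"
      by (rule sum.swap)
    also have "\<dots> = (\<Sum>\<sigma>\<in>faces X m. bdry X m u \<sigma> * ?h \<sigma>)"
      unfolding bdry_def sum_distrib_right by (intro sum.cong refl) (simp only: mult_ac)
    finally have "N\<^sup>2 = (\<Sum>\<sigma>\<in>faces X m. bdry X m u \<sigma> * ?h \<sigma>)\<^sup>2" by simp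
    also have "\<dots> \<le> (\<Sum>\<sigma>\<in>faces X m. (bdry X m u \<sigma>)\<^sup>2) * energy (faces X m) ?h"
      by (rule Cauchy_Schwarz_ineq_sum)
    also have "(\<Sum>\<sigma>\<in>faces X m. (bdry X m u \<sigma>)\<^sup>2) = (\<Sum>\<sigma>\<in>faces X m. of_bool (\<sigma> \<in> B))"
      using bd by (intro sum.cong) auto
    also have "\<dots> = real (card B)" using B fin by (simp add: Int_absorb1)
    also have "real (card B) * energy (faces X m) ?h \<le> real (Suc m) * energy (faces X m) ?h"
      using B by (intro mult_right_mono sum_nonneg) auto
    finally show ?thesis by (subst pos_divide_le_eq) (simp_all only: mult.commute of_nat_0_less_iff zero_less_Suc)
  qed
  have E: "N\<^sup>2 / real (Suc m) \<le> coset_energy f" using energy by (rule coset_energy_ge)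
  have "0 \<le> coset_energy h" for h by (rule coset_energy_ge) (auto intro: sum_nonneg)
  then have "bdd_below ((\<lambda>f. energy (faces X (Suc m)) (cobd f) / coset_energy f) ` ?A)"
    by (intro bdd_belowI2[of _ 0] divide_nonneg_nonneg sum_nonneg) auto
  then have "lambda_number (int m - 1) X \<le> energy (faces X (Suc m)) (cobd f) / coset_energy f"
    unfolding lambda_number_eq using A by (intro cINF_lower)
  also have "energy (faces X (Suc m)) (cobd f) = N" using f(2) u by (simp add: N_def)
  also have "N / coset_energy f \<le> N / (N\<^sup>2 / real (Suc m))"
    using E N by (intro divide_left_mono) (auto intro!: mult_pos_pos divide_pos_pos less_le_trans[OF _ E])
  also have "\<dots> = real (Suc m) / N" using N by (simp add: power2_eq_square)
  finally show ?thesis by (simp only: N_def)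
qed

end

section \<open>The two families\<close>

lemma stacked_family:
  assumes m: "m > 1" and k: "k \<ge> 1"
  shows "\<exists>X :: nat set set. simplicial_ball m X \<and>
     lambda_number (int m - 1) X \<ge> (real m - 1)\<^sup>2 / (2 * (real m + 1)) \<and>
     0 \<le> cheeger_number (int m - 1) X \<and> cheeger_number (int m - 1) X \<le> 1 / real k"
proof -
  obtain X where X: "stacked m X" and deep: "\<And>\<phi> :: nat set \<Rightarrow> bit.
     \<forall>\<tau>\<in>faces X (Suc m). cobd \<phi> \<tau> = of_bool (\<tau> = {..m}) \<Longrightarrow> k \<le> card {\<sigma> \<in> faces X m. \<phi> \<sigma> = 1}"
    using stacked_deep[of m k] by blast
  note cx = stacked_complex(1)[OF X]
  have root: "{..m} \<in> faces X (Suc m)" using stacked_complex(3)[OF X] by (simp add: faces_iff)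
  let ?c = "(real m - 1)\<^sup>2 / (2 * (real m + 1))"
  have m1: "real m - 1 > 0" using m by simp
  have "?c \<le> lambda_number (int m - 1) X"
  proof (rule lambda_number_ge[OF cx])
    show "exact_at TYPE(real) X m" using stacked_exact[OF X] m by simp
    show "faces X (Suc m) \<noteq> {}" using root by blast
    show "?c > 0" using m1 by simp
    fix w :: "nat set \<Rightarrow> real"
    obtain f where f: "\<forall>\<tau>\<in>faces X (Suc m). cobd f \<tau> = w \<tau>"
      "(real m - 1) * energy (faces X m) f + (real m + 1) * energy (free_facets m X) f
      \<le> 2 * (real m + 1) / (real m - 1) * energy (faces X (Suc m)) w"
      using stacked_filling_energy[OF X m, of w] by blast
    define S W where "S = energy (faces X m) f" and "W = energy (faces X (Suc m)) w"
    have "0 \<le> (real m + 1) * energy (free_facets m X) f" by (intro mult_nonneg_nonneg sum_nonneg) auto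
    then have le: "(real m - 1) * S \<le> 2 * (real m + 1) / (real m - 1) * W" using f(2) unfolding S_def W_def by simp
    have "?c * S = (real m - 1) / (2 * (real m + 1)) * ((real m - 1) * S)" by (simp add: power2_eq_square)
    also have "\<dots> \<le> (real m - 1) / (2 * (real m + 1)) * (2 * (real m + 1) / (real m - 1) * W)"
      using le m1 by (intro mult_left_mono) auto
    also have "\<dots> = W" using m1 by simp
    finally show "\<exists>f. (\<forall>\<tau>\<in>faces X (Suc m). cobd f \<tau> = w \<tau>) \<and>
        ?c * energy (faces X m) f \<le> energy (faces X (Suc m)) w"
      using f(1) unfolding S_def W_def by blast
  qed
  moreover obtain \<phi> :: "nat set \<Rightarrow> bit" where "\<forall>\<tau>\<in>faces X (Suc m). cobd \<phi> \<tau> = of_bool (\<tau> = {..m})"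
    using stacked_filling[OF X, of "\<lambda>\<tau>. of_bool (\<tau> = {..m})"] m by auto
  then have "0 \<le> cheeger_number (int m - 1) X" "cheeger_number (int m - 1) X \<le> 1 / real k"
    using cheeger_number_le[OF cx k root, of \<phi>] deep by blast+
  moreover have "simplicial_ball m X" using stacked_ball[OF X] m by simp
  ultimately show ?thesis by blast
qed

lemma layered_family:
  assumes m: "m > 1" and k: "k \<ge> 1"
  shows "\<exists>X :: nat set set. simplicial_ball m X \<and>
     lambda_number (int m - 1) X \<le> 1 / real m ^ (k - 1) \<and> cheeger_number (int m - 1) X \<ge> 1 / real k"
proof -
  obtain X D where X: "layered m (Suc m) X D" and D: "\<forall>\<tau>\<in>faces X (Suc m). D \<tau> \<le> k"
    and core: "card (core_faces m (Suc m) X) = Suc m * m ^ (k - 1)"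
    using layered_exists[OF k, of m] by blast
  note cx = layered_complex(1)[OF X]
  have fin: "finite (faces X (Suc m))" using complexD(1)[OF cx] by (rule finite_faces)
  then have card: "Suc m * m ^ (k - 1) \<le> card (faces X (Suc m))"
    unfolding core[symmetric] by (intro card_mono) auto
  moreover have pos: "0 < Suc m * m ^ (k - 1)" using m by simp
  ultimately have ne: "faces X (Suc m) \<noteq> {}" by auto
  have "lambda_number (int m - 1) X \<le> real (Suc m) / real (card (faces X (Suc m)))"
  proof (rule lambda_number_le[OF cx layered_complex(4)[OF X] ne])
    fix w :: "nat set \<Rightarrow> real"
    obtain \<Phi> :: "nat set \<Rightarrow> nat set \<Rightarrow> real" where \<Phi>: "\<And>\<tau>. \<tau> \<in> faces X (Suc m) \<Longrightarrow> fills m (Suc m) X \<tau> (\<Phi> \<tau>)"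
      using layered_fills[OF X, where ?'f = real] by metis
    have "cobd (\<lambda>\<sigma>. \<Sum>\<tau>\<in>faces X (Suc m). w \<tau> * \<Phi> \<tau> \<sigma>) \<tau>' = w \<tau>'" if \<tau>': "\<tau>' \<in> faces X (Suc m)" for \<tau>'
    proof -
      have "cobd (\<lambda>\<sigma>. \<Sum>\<tau>\<in>faces X (Suc m). w \<tau> * \<Phi> \<tau> \<sigma>) \<tau>' =
          (\<Sum>\<tau>\<in>faces X (Suc m). w \<tau> * cobd (\<Phi> \<tau>) \<tau>')"
        by (simp only: cobd_sum cobd_scale)
      also have "\<dots> = (\<Sum>\<tau>\<in>faces X (Suc m). if \<tau>' = \<tau> then w \<tau> else 0)"
        using \<Phi> \<tau>' by (intro sum.cong) (auto simp: fills_def)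
      also have "\<dots> = w \<tau>'" using \<tau>' fin by simp
      finally show ?thesis .
    qed
    then show "\<exists>f. \<forall>\<tau>\<in>faces X (Suc m). cobd f \<tau> = w \<tau>" by blast
  qed
  also have "\<dots> \<le> real (Suc m) / real (Suc m * m ^ (k - 1))"
  proof (rule frac_le)
    show "real (Suc m * m ^ (k - 1)) \<le> real (card (faces X (Suc m)))" using card by (rule of_nat_mono)
    show "0 < real (Suc m * m ^ (k - 1))" using pos by (simp only: of_nat_0_less_iff)
  qed simp_all
  also have "\<dots> = 1 / real m ^ (k - 1)"
    unfolding of_nat_mult of_nat_power by (rule nonzero_divide_mult_cancel_left) simp
  finally have "lambda_number (int m - 1) X \<le> 1 / real m ^ (k - 1)" .
  moreover have "cheeger_number (int m - 1) X \<ge> 1 / real k"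
  proof (rule cheeger_number_ge[OF cx layered_complex(3)[OF X] ne k])
    fix \<tau> assume \<tau>: "\<tau> \<in> faces X (Suc m)"
    obtain \<phi> :: "nat set \<Rightarrow> bit" where \<phi>: "fills m (Suc m) X \<tau> \<phi>" "card {\<rho>. \<phi> \<rho> \<noteq> 0} \<le> D \<tau>"
      using layered_fills[OF X \<tau>] by blast
    have "D \<tau> \<le> k" using D \<tau> by blast
    then have "card {\<rho>. \<phi> \<rho> \<noteq> 0} \<le> k" using \<phi>(2) by (rule order_trans[rotated])
    then show "\<exists>\<phi> :: nat set \<Rightarrow> bit. (\<forall>\<sigma>. \<phi> \<sigma> \<noteq> 0 \<longrightarrow> \<sigma> \<in> faces X m) \<and>
      (\<forall>\<tau>'\<in>faces X (Suc m). cobd \<phi> \<tau>' = of_bool (\<tau>' = \<tau>)) \<and> card {\<sigma>. \<phi> \<sigma> \<noteq> 0} \<le> k"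
      using \<phi>(1) unfolding fills_def by blast
  qed
  ultimately show ?thesis using layered_ball[OF X] by blast
qed

theorem proposition2p10:
  fixes m :: nat
  assumes "m > 1"
  shows "\<exists>(X :: nat \<Rightarrow> nat set set) (Y :: nat \<Rightarrow> nat set set).
    (\<forall>k\<ge>1. simplicial_ball m (X k)) \<and>
    (\<forall>k\<ge>1. simplicial_ball m (Y k)) \<and>
    (\<forall>k\<ge>1. lambda_number (int m - 1) (X k) \<ge> (real m - 1)\<^sup>2 / (2 * (real m + 1))) \<and>
    (\<lambda>k. cheeger_number (int m - 1) (X k)) \<longlonglongrightarrow> 0 \<and>
    (\<forall>k>1. lambda_number (int m - 1) (Y k) \<le> 1 / real m ^ (k - 1)) \<and>
    (\<forall>k\<ge>1. cheeger_number (int m - 1) (Y k) \<ge> 1 / real k)"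
proof -
  obtain X :: "nat \<Rightarrow> nat set set" where X: "\<And>k. k \<ge> 1 \<Longrightarrow> simplicial_ball m (X k) \<and>
     lambda_number (int m - 1) (X k) \<ge> (real m - 1)\<^sup>2 / (2 * (real m + 1)) \<and>
     0 \<le> cheeger_number (int m - 1) (X k) \<and> cheeger_number (int m - 1) (X k) \<le> 1 / real k"
    using stacked_family[OF assms] by metis
  obtain Y :: "nat \<Rightarrow> nat set set" where Y: "\<And>k. k \<ge> 1 \<Longrightarrow> simplicial_ball m (Y k) \<and>
     lambda_number (int m - 1) (Y k) \<le> 1 / real m ^ (k - 1) \<and> cheeger_number (int m - 1) (Y k) \<ge> 1 / real k"
    using layered_family[OF assms] by metis
  have "(\<lambda>k. cheeger_number (int m - 1) (X k)) \<longlonglongrightarrow> 0"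
  proof (rule tendsto_sandwich[OF _ _ tendsto_const])
    show "\<forall>\<^sub>F k in sequentially. 0 \<le> cheeger_number (int m - 1) (X k)"
      using eventually_ge_at_top[of 1] by eventually_elim (use X in blast)
    show "\<forall>\<^sub>F k in sequentially. cheeger_number (int m - 1) (X k) \<le> 1 / real k"
      using eventually_ge_at_top[of 1] by eventually_elim (use X in blast)
    show "(\<lambda>k. 1 / real k) \<longlonglongrightarrow> 0" by (rule lim_1_over_n)
  qed
  then show ?thesis using X Y by (intro exI[of _ X] exI[of _ Y]) auto
qed

end
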